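(* Let $n\ge0$ and let $s_0,s_1,\dots,s_{2n+1}$ be real numbers such that $S_n=(s_{i+j})_{i,j=0}^n>0$ (in particular $\det S_n\ne0$). Then the truncated Hamburger moment problem $$\int_{\mathbb R}t^j\,d\mu(t)=s_j,\qquad j=0,1,\dots,2n+1,$$ for a positive measure $\mu$ on $\mathbb R$ is solvable, and the formula $$\varphi(\lambda)=\int_{\mathbb R}\frac{d\mu(t)}{t-\lambda}=-\frac{Q_n(\lambda)\tau(\lambda)+Q_{n+1}(\lambda)}{P_n(\lambda)\tau(\lambda)+P_{n+1}(\lambda)}$$ describes the set of its solutions $\mu$ when $\tau$ ranges over all functions of the class $\mathbf N_{0,1}$ satisfying (O) $\tau(\lambda)=o(1)$ as $\lambda\hat\to\infty$. Moreover, for $\varphi=-\frac{Q_n\tau+Q_{n+1}}{P_n\tau+P_{n+1}}$, one has $\varphi\in\mathcal I_0({\bf s},2n+1)$ if and only if $\tau$ belongs to $\mathbf N_0$ and satisfies (O).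
   Context: $\mathbf N_0$ is the class of Nevanlinna functions: $\varphi$ holomorphic on $\mathbb C\setminus\mathbb R$, $\varphi(\bar\lambda)=\overline{\varphi(\lambda)}$, $\mathrm{Im}\,\varphi(\lambda)\ge0$ for $\lambda\in\mathbb C_+$. $\lambda\hat\to\infty$ means that $\lambda\to\infty$ nontangentially ($\delta<\arg\lambda<\pi-\delta$, $\delta>0$). $\mathbf N_{0,1}$ is the set of $\varphi\in\mathbf N_0$ with $\lim_{z\hat\to\infty}\varphi(z)/z=0$ and $\int_\eta^\infty\frac{|\mathrm{Im}\,\varphi(iy)|}{y}\,dy<\infty$ for $\eta>0$ large enough. $\mathcal I_0({\bf s},2n+1)$ is the set of $\varphi\in\mathbf N_0$ such that $\varphi(\lambda)=-\frac{s_0}{\lambda}-\dots-\frac{s_{2n+1}}{\lambda^{2n+2}}+o\left(\frac1{\lambda^{2n+2}}\right)$ as $\lambda\hat\to\infty$. $\mathfrak S$ is the linear functional on polynomials of degree at most $2n+1$ with $\mathfrak S(t^j)=s_j$. $P_n$ is the polynomial of degree $n$ with positive leading coefficient, orthonormal with respect to $\mathfrak S$ ($\mathfrak S(P_n(t)t^i)=0$ for $i<n$, $\mathfrak S(P_n^2)=1$); $P_{n+1}$ is a polynomial of degree $n+1$ with positive leading coefficient such that $\mathfrak S(P_{n+1}(t)t^i)=0$ for $0\le i\le n$ (its positive normalization factor, which is not determined by $s_0,\dots,s_{2n+1}$, may be fixed arbitrarily). The polynomials of the second kind are $Q_k(\lambda)=\mathfrak S\left(\frac{P_k(t)-P_k(\lambda)}{t-\lambda}\right)$,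 $k=n,n+1$, $\mathfrak S$ acting in the variable $t$. *)

theory Defs
  imports "HOL-Analysis.Analysis" "HOL-Computational_Algebra.Polynomial" "HOL-Library.Landau_Symbols"
begin

section \<open>Data of the moment problem\<close>

definition hankel_pos_def :: "(nat \<Rightarrow> real) \<Rightarrow> nat \<Rightarrow> bool" where
  "hankel_pos_def s n \<longleftrightarrow>
     (\<forall>x :: nat \<Rightarrow> real. (\<exists>i\<le>n. x i \<noteq> 0) \<longrightarrow> 0 < (\<Sum>i\<le>n. \<Sum>j\<le>n. s (i + j) * x i * x j))"

text \<open>Since \<^const>\<open>has_bochner_integral\<close> includes integrability, all the absolute moments up to
  the order \<open>m\<close> are finite; \<open>j = 0\<close> makes \<open>\<mu>\<close> a finite measure.\<close>

definition moment_solution :: "(nat \<Rightarrow> real) \<Rightarrow> nat \<Rightarrow> real measure \<Rightarrow> bool" where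
  "moment_solution s m \<mu> \<longleftrightarrow>
     sets \<mu> = sets borel \<and> (\<forall>j\<le>m. has_bochner_integral \<mu> (\<lambda>t. t ^ j) (s j))"

definition cauchy_transform_eq :: "real measure \<Rightarrow> (complex \<Rightarrow> complex) \<Rightarrow> bool" where
  "cauchy_transform_eq \<mu> \<phi> \<longleftrightarrow>
     (\<forall>z\<in>-\<real>. has_bochner_integral \<mu> (\<lambda>t. 1 / (of_real t - z)) (\<phi> z))"

section \<open>Orthogonal polynomials\<close>

text \<open>The functional \<open>t\<^sup>j \<mapsto> s\<^sub>j\<close>, for real coefficients and, extended by linearity, for
  complex ones.\<close>

definition moment_functional :: "(nat \<Rightarrow> real) \<Rightarrow> 'a :: real_vector poly \<Rightarrow> 'a" where
  "moment_functional s p = (\<Sum>i\<le>degree p. s i *\<^sub>R coeff p i)"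

definition orthogonal_poly :: "(nat \<Rightarrow> real) \<Rightarrow> nat \<Rightarrow> real poly \<Rightarrow> bool" where
  "orthogonal_poly s k P \<longleftrightarrow>
     degree P = k \<and> 0 < lead_coeff P \<and> (\<forall>i<k. moment_functional s (P * monom 1 i) = 0)"

definition orthonormal_poly :: "(nat \<Rightarrow> real) \<Rightarrow> nat \<Rightarrow> real poly \<Rightarrow> bool" where
  "orthonormal_poly s k P \<longleftrightarrow> orthogonal_poly s k P \<and> moment_functional s (P ^ 2) = 1"

definition cpoly :: "real poly \<Rightarrow> complex \<Rightarrow> complex" where
  "cpoly P z = poly (map_poly of_real P) z"

text \<open>The difference quotient \<open>(P(t) - P(z)) / (t - z)\<close> is formed as a polynomial in \<open>t\<close>, with
  \<open>z\<close> a constant; the division is exact.\<close>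

definition second_kind :: "(nat \<Rightarrow> real) \<Rightarrow> real poly \<Rightarrow> complex \<Rightarrow> complex" where
  "second_kind s P z =
     moment_functional s ((map_poly of_real P - [:cpoly P z:]) div [:-z, 1:])"

definition lin_frac :: "(nat \<Rightarrow> real) \<Rightarrow> real poly \<Rightarrow> real poly \<Rightarrow> (complex \<Rightarrow> complex) \<Rightarrow>
    complex \<Rightarrow> complex" where
  "lin_frac s P P' \<tau> z =
     - ((second_kind s P z * \<tau> z + second_kind s P' z) / (cpoly P z * \<tau> z + cpoly P' z))"

section \<open>Nevanlinna functions\<close>

text \<open>Functions on \<open>-\<real>\<close> are represented by total functions whose values on \<open>\<real>\<close> are irrelevant.\<close>

definition nevanlinna :: "(complex \<Rightarrow> complex) set" where
  "nevanlinna = {\<phi>. \<phi> holomorphic_on (-\<real>) \<and> (\<forall>z\<in>-\<real>. \<phi> (cnj z) = cnj (\<phi> z)) \<and>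
     (\<forall>z. 0 < Im z \<longrightarrow> 0 \<le> Im (\<phi> z))}"

text \<open>The supremum of filters expresses that a limit holds in each sector separately, with no
  uniformity in \<open>\<delta>\<close>.\<close>

definition nontangential :: "complex filter" where
  "nontangential =
     (SUP \<delta>\<in>{0<..}. inf at_infinity (principal {z. \<delta> < Arg z \<and> Arg z < pi - \<delta>}))"

lemma eventually_nontangential:
  "eventually P nontangential \<longleftrightarrow>
     (\<forall>\<delta>>0. \<exists>R. \<forall>z. R \<le> norm z \<longrightarrow> \<delta> < Arg z \<and> Arg z < pi - \<delta> \<longrightarrow> P z)"
  by (simp add: nontangential_def eventually_Sup eventually_inf_principal eventually_at_infinity)
    (simp add: Ball_def)

definition nevanlinna_01 :: "(complex \<Rightarrow> complex) set" where
  "nevanlinna_01 = {\<phi> \<in> nevanlinna. ((\<lambda>z. \<phi> z / z) \<longlongrightarrow> 0) nontangential \<and>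
     (\<forall>\<^sub>F \<eta> in at_top. set_integrable lborel {\<eta><..} (\<lambda>y. \<bar>Im (\<phi> (\<i> * of_real y))\<bar> / y))}"

definition nevanlinna_asymp :: "(nat \<Rightarrow> real) \<Rightarrow> nat \<Rightarrow> (complex \<Rightarrow> complex) set" where
  "nevanlinna_asymp s m = {\<phi> \<in> nevanlinna.
     (\<lambda>z. \<phi> z - (\<Sum>j\<le>m. - (of_real (s j) / z ^ (j + 1))))
       \<in> o[nontangential](\<lambda>z. 1 / z ^ (m + 1))}"

end

theory Submission
  imports Defs "HOL-Complex_Analysis.Complex_Analysis" "HOL-Probability.Probability" "HOL-Real_Asymp.Real_Asymp"
begin

text \<open>Fix \<open>z\<close> and \<open>c = \<tau> z\<close> and put \<open>N = c P\<^sub>n + P\<^sub>n\<^sub>+\<^sub>1\<close>, \<open>R(t) = (N(t) - N(z)) / (t - z)\<close>, so that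
  \<open>\<phi>(z) = - \<SS>(R) / N(z)\<close>. Applying \<open>\<SS>\<close> to \<open>N(t) = N(z) + (t - z) R(t)\<close> times the conjugate of \<open>R\<close>,
  orthogonality gives \<open>|N(z)|\<^sup>2 Im \<phi>(z) = Im z \<SS>(|R|\<^sup>2) + h a Im c\<close> with positive constants \<open>h\<close> and \<open>a\<close>;
  hence a Nevanlinna function \<open>\<tau>\<close> yields a Nevanlinna function \<open>\<phi>\<close>. Conversely, if \<open>\<phi>\<close> is the Cauchy
  transform of a measure \<open>\<mu>\<close> with moments \<open>s\<^sub>0, \<dots>, s\<^sub>2\<^sub>n\<close>, then the same computation gives
  \<open>h a Im c = Im z \<integral> |N(t) / (t - z)|\<^sup>2 d\<mu>(t)\<close>. This is nonnegative and, integrated along \<open>z = i y\<close> with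
  respect to \<open>dy / y\<close>, it is finite precisely when the moment of order \<open>2n + 1\<close> converges absolutely.
  The measure \<open>\<mu>\<close> comes from the Herglotz representation on the disc, and its moments are read off
  the asymptotic expansion by monotone convergence.\<close>

section \<open>Cauchy transforms of Nevanlinna functions\<close>

text \<open>With S for the moment functional, the linear fractional relation is used in the bilinear
  form N(z) \<phi>(z) + S(R) = 0. It is linear in \<phi>(z) and in \<tau>(z), can be solved for
  either, and avoids division by zero. Solving for \<tau> requires that P \<phi> + Q has no zeros
  off the real axis. This is a positivity statement about the measure, so even holomorphy of \<tau>
  has to wait until \<phi> is represented by a measure. The obstacle is the last moment. On the
  imaginary axis the expansion controls integrals of nonnegative functions only for the even powers
  t^(2k) with k \<le> n; absolute convergence of the moment of order 2n + 1 cannot be extracted from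
  it. Hence \<open>nevanlinna\<close> suffices for the expansion, while solutions need
  \<open>nevanlinna_01\<close>. The two orders match because N has exact degree n + 1: integrating
  |N(t)|^2 / (t^2 + y^2) over y > \<eta> leaves a function of size |t|^(2n + 1), and the dependence
  of N on \<tau>(i y) is harmless once |\<tau>(i y)| \<le> 1.\<close>

definition circ :: "real \<Rightarrow> complex" where
  "circ x = exp (2 * of_real pi * \<i> * of_real x)"

lemma norm_circ [simp]: "norm (circ x) = 1"
  by (simp add: circ_def)

lemma circ_nonzero [simp]: "circ x \<noteq> 0"
  by (simp add: circ_def)

lemma isCont_circ [continuous_intros]: "isCont circ x"
  unfolding circ_def by (intro continuous_intros)

lemma continuous_on_circ [continuous_intros]: "continuous_on A circ"
  by (simp add: continuous_at_imp_continuous_on isCont_circ)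

lemma circ_measurable [measurable]: "circ \<in> borel_measurable borel"
  by (intro borel_measurable_continuous_onI continuous_on_circ)

lemma circ_neq: "norm z < 1 \<Longrightarrow> circ x \<noteq> z"
  by (metis norm_circ less_irrefl)

lemma cauchy_circ:
  assumes "f holomorphic_on cball 0 1" "norm z < 1"
  shows "((\<lambda>x. f (circ x) * (circ x / (circ x - z))) has_integral f z) {0..1}"
proof -
  have "((\<lambda>u. f u / (u - z)) has_contour_integral 2 * of_real pi * \<i> * f z) (circlepath 0 1)"
    by (intro Cauchy_integral_circlepath_simple) (use assms in auto)
  then have "((\<lambda>x. f (circlepath 0 1 x) / (circlepath 0 1 x - z) *
       vector_derivative (circlepath 0 1) (at x)) has_integral 2 * of_real pi * \<i> * f z) {0..1}"
    by (simp add: has_contour_integral)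
  then have "((\<lambda>x. 2 * of_real pi * \<i> * (f (circ x) * (circ x / (circ x - z))))
      has_integral 2 * of_real pi * \<i> * f z) {0..1}"
    unfolding vector_derivative_circlepath by (simp add: circlepath circ_def mult_ac)
  from has_integral_mult_right[OF this, of "inverse (2 * of_real pi * \<i>)"] show ?thesis
    by (simp add: field_simps)
qed

lemma has_integral_cnj': "(f has_integral I) S \<Longrightarrow> ((\<lambda>x. cnj (f x)) has_integral cnj I) S"
  using has_integral_linear[of f I S cnj] by (simp add: o_def bounded_linear_cnj)

text \<open>Schwarz's formula. Write Re g = (g + cnj g) / 2: Cauchy's formula reproduces the half
  with g, and the other half is made of conjugates of boundary values of functions holomorphic on
  the disc, which the mean value property evaluates.\<close>

lemma schwarz_circ:
  assumes g: "g holomorphic_on cball 0 1" and z: "norm z < 1"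
  shows "((\<lambda>x. of_real (Re (g (circ x))) * ((circ x + z) / (circ x - z)))
     has_integral g z - \<i> * of_real (Im (g 0))) {0..1}"
proof -
  have ne: "1 - cnj z * u \<noteq> 0" if "u \<in> cball 0 1" for u
  proof
    assume "1 - cnj z * u = 0"
    then have "norm (cnj z * u) = 1" by simp
    moreover have "norm (cnj z * u) \<le> norm z * 1"
      unfolding norm_mult using that by (intro mult_mono) auto
    ultimately show False using z by simp
  qed
  have 1: "((\<lambda>x. g (circ x) * (circ x / (circ x - z))) has_integral g z) {0..1}"
    by (rule cauchy_circ[OF g z])
  have 2: "((\<lambda>x. g (circ x)) has_integral g 0) {0..1}"
    using cauchy_circ[OF g, of 0] by simp
  have 0: "((\<lambda>x. g (circ x) * (cnj z * circ x / (1 - cnj z * circ x))) has_integral 0) {0..1}"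
  proof -
    have "(\<lambda>u. g u * (cnj z * u / (1 - cnj z * u))) holomorphic_on cball 0 1"
      using g ne by (intro holomorphic_intros) auto
    from cauchy_circ[OF this, of 0] show ?thesis by simp
  qed
  \<comment> \<open>On the unit circle cnj u = 1 / u, so this integrand is the conjugate of the one
    in \<open>0\<close>, a holomorphic function that vanishes at the origin.\<close>
  have 3: "((\<lambda>x. cnj (g (circ x)) * (z / (circ x - z))) has_integral 0) {0..1}"
  proof (rule has_integral_eq[rotated])
    show "((\<lambda>x. cnj (g (circ x) * (cnj z * circ x / (1 - cnj z * circ x)))) has_integral 0) {0..1}"
      using has_integral_cnj'[OF 0] by simp
    fix x
    have "cnj (circ x) * circ x = 1" 
      using complex_norm_square[of "circ x"] by (simp add: mult.commute)
    then have c: "cnj (circ x) = 1 / circ x" by (simp add: field_simps)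
    show "cnj (g (circ x) * (cnj z * circ x / (1 - cnj z * circ x))) = cnj (g (circ x)) * (z / (circ x - z))"
      using circ_neq[OF z, of x] by (simp add: c divide_simps)
  qed
  \<comment> \<open>With u = \<open>circ x\<close>, the Schwarz kernel (u + z) / (u - z) is written
    as 2 u / (u - z) - 1 next to g and as 1 + 2 z / (u - z) next to cnj g.\<close>
  have "((\<lambda>x. (2 * (g (circ x) * (circ x / (circ x - z))) - g (circ x) + cnj (g (circ x)) +
      2 * (cnj (g (circ x)) * (z / (circ x - z)))) / 2) has_integral (2 * g z - g 0 + cnj (g 0) + 2 * 0) / 2) {0..1}"
    by (intro has_integral_divide has_integral_add has_integral_diff has_integral_mult_right 1 2 3
        has_integral_cnj')
  moreover have "(2 * g z - g 0 + cnj (g 0) + 2 * 0) / 2 = g z - \<i> * of_real (Im (g 0))"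
    by (simp add: complex_eq_iff)
  moreover have "(2 * (g (circ x) * (circ x / (circ x - z))) - g (circ x) + cnj (g (circ x)) +
      2 * (cnj (g (circ x)) * (z / (circ x - z)))) / 2 = of_real (Re (g (circ x))) * ((circ x + z) / (circ x - z))" for x
  proof -
    have r: "of_real (Re w) = (w + cnj w) / 2" for w by (simp add: complex_eq_iff)
    have "circ x - z \<noteq> 0" using circ_neq[OF z, of x] by simp
    then show ?thesis unfolding r by (simp add: divide_simps) (simp add: algebra_simps)
  qed
  ultimately show ?thesis by (simp only:)
qed

text \<open>On the circle of radius \<open>r k\<close> the Schwarz formula represents f by the
  density Re f, which is nonnegative with total mass Re f(0) = 1; a weak limit of these measures
  represents f itself. Pulling the circle back to [0, 1] by \<open>circ\<close> turns them into
  measures on the line, to which Helly's selection theorem applies, and for fixed z the kernel is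
  bounded and continuous.\<close>

lemma herglotz_disc:
  assumes f: "f holomorphic_on ball 0 1" and pos: "\<And>z. norm z < 1 \<Longrightarrow> 0 \<le> Re (f z)" and f0: "Re (f 0) = 1"
  shows "\<exists>\<nu>. real_distribution \<nu> \<and>
    (\<forall>z. norm z < 1 \<longrightarrow> f z = \<i> * of_real (Im (f 0)) + (\<integral>x. (circ x + z) / (circ x - z) \<partial>\<nu>))"
proof -
  \<comment> \<open>\<open>k + 2\<close> keeps every radius positive, including the one for k =
    0.\<close>
  define r :: "nat \<Rightarrow> real" where "r k = 1 - 1 / (k + 2)" for k
  have r: "0 < r k" "r k < 1" for k by (auto simp: r_def field_simps)
  define w where "w k x = Re (f (of_real (r k) * circ x))" for k x
  define \<nu> where "\<nu> k = density lborel (\<lambda>x. ennreal (indicator {0..1} x * w k x))" for k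
  have wpos: "0 \<le> w k x" for k x
    unfolding w_def using r[of k] by (intro pos) (simp add: norm_mult)
  have wc: "continuous_on UNIV (w k)" for k
  proof -
    have "continuous_on UNIV (\<lambda>x. f (of_real (r k) * circ x))"
      by (rule continuous_on_compose2[OF holomorphic_on_imp_continuous_on[OF f]])
        (use r[of k] in \<open>auto intro!: continuous_intros simp: norm_mult\<close>)
    then show ?thesis unfolding w_def by (intro continuous_intros)
  qed
  have wm [measurable]: "w k \<in> borel_measurable borel" for k
    by (intro borel_measurable_continuous_onI wc)
  have int: "(\<integral>x. h x \<partial>\<nu> k) = integral {0..1} (\<lambda>x. w k x *\<^sub>R h x)"
    if h: "continuous_on UNIV h" for h :: "real \<Rightarrow> complex" and k
  proof -
    have [measurable]: "h \<in> borel_measurable borel" by (intro borel_measurable_continuous_onI h)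
    have "(\<integral>x. h x \<partial>\<nu> k) = (\<integral>x. (indicator {0..1} x * w k x) *\<^sub>R h x \<partial>lborel)"
      unfolding \<nu>_def using wpos by (intro integral_density) auto
    also have "\<dots> = (LINT x:{0..1}|lborel. w k x *\<^sub>R h x)"
      by (simp add: set_lebesgue_integral_def)
    also have "\<dots> = integral {0..1} (\<lambda>x. w k x *\<^sub>R h x)"
      by (intro set_borel_integral_eq_integral borel_integrable_atLeastAtMost' continuous_intros
           continuous_on_subset[OF h] continuous_on_subset[OF wc]) auto
    finally show ?thesis .
  qed
  have hol: "(\<lambda>z. f (of_real (r k) * z)) holomorphic_on cball 0 1" for k
  proof -
    have "r k * norm z < 1" if "norm z \<le> 1" for z :: complex
      by (rule le_less_trans[OF mult_left_mono[OF that less_imp_le[OF r(1)]]]) (simp add: r(2))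
    then have "(\<lambda>z. of_real (r k) * z) ` cball 0 1 \<subseteq> ball (0::complex) 1"
      using r[of k] by (auto simp: norm_mult dist_norm)
    then have "f \<circ> (\<lambda>z. of_real (r k) * z) holomorphic_on cball 0 1"
      by (intro holomorphic_on_compose_gen[OF _ f] holomorphic_intros)
    then show ?thesis by (simp add: o_def)
  qed
  have repr: "(\<integral>x. (circ x + z) / (circ x - z) \<partial>\<nu> k) = f (of_real (r k) * z) - \<i> * of_real (Im (f 0))"
    if z: "norm z < 1" for z k
  proof -
    have "(\<integral>x. (circ x + z) / (circ x - z) \<partial>\<nu> k) = integral {0..1} (\<lambda>x. w k x *\<^sub>R ((circ x + z) / (circ x - z)))"
      using circ_neq[OF z] by (intro int continuous_intros) auto
    also have "\<dots> = f (of_real (r k) * z) - \<i> * of_real (Im (f 0))"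
      using schwarz_circ[OF hol z, of k] by (intro integral_unique) (simp add: w_def scaleR_conv_of_real)
    finally show ?thesis .
  qed
  have rd: "real_distribution (\<nu> k)" for k
  proof -
    have fin: "(\<integral>\<^sup>+ x. ennreal (indicator {0..1} x * w k x) \<partial>lborel) = ennreal (integral {0..1} (w k))"
    proof -
      have "set_integrable lborel {0..1} (w k)"
        by (intro borel_integrable_atLeastAtMost' continuous_on_subset[OF wc]) auto
      then have "(\<integral>\<^sup>+ x. ennreal (indicator {0..1} x * w k x) \<partial>lborel) = ennreal (LINT x:{0..1}|lborel. w k x)"
        unfolding set_integrable_def set_lebesgue_integral_def
        using wpos by (subst nn_integral_eq_integral) auto
      then show ?thesis using \<open>set_integrable lborel {0..1} (w k)\<close>
        by (simp add: set_borel_integral_eq_integral)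
    qed
    have "of_real (integral {0..1} (w k)) = (1::complex)"
    proof -
      have "((\<lambda>x. complex_of_real (w k x)) has_integral of_real (Re (f 0))) {0..1}"
      proof -
        have "f 0 - \<i> * of_real (Im (f 0)) = of_real (Re (f 0))" by (simp add: complex_eq_iff)
        then show ?thesis using schwarz_circ[OF hol, of 0 k] by (simp add: w_def)
      qed
      from has_integral_Re[OF this] have "(w k has_integral Re (f 0)) {0..1}" by simp
      then show ?thesis using f0 by (simp add: integral_unique)
    qed
    then have "integral {0..1} (w k) = 1" by (simp only: of_real_eq_1_iff)
    then have "prob_space (\<nu> k)"
      using fin by (intro prob_spaceI) (auto simp: \<nu>_def emeasure_density)
    then show ?thesis
      by (simp add: real_distribution_def real_distribution_axioms_def \<nu>_def)
  qed
  have tight: "tight \<nu>"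
    unfolding tight_def
  proof (intro conjI allI impI rd)
    fix e :: real assume "0 < e"
    have "measure (\<nu> k) {-1<..1} = 1" for k
    proof -
      interpret real_distribution "\<nu> k" by (rule rd)
      have "AE x in \<nu> k. x \<in> {-1<..1}"
        unfolding \<nu>_def by (subst AE_density) (auto split: split_indicator)
      then show ?thesis by (intro prob_eq_1[THEN iffD2]) auto
    qed
    then show "\<exists>a b. a < b \<and> (\<forall>n. 1 - e < measure (\<nu> n) {a<..b})"
      using \<open>0 < e\<close> by (intro exI[of _ "-1"] exI[of _ 1]) auto
  qed
  from tight_imp_convergent_subsubsequence[OF tight strict_mono_id]
  obtain q N where q: "strict_mono q" and N: "real_distribution N" and wc: "weak_conv_m (\<nu> \<circ> id \<circ> q) N"
    by auto
  have "f z = \<i> * of_real (Im (f 0)) + (\<integral>x. (circ x + z) / (circ x - z) \<partial>N)" if z: "norm z < 1" for z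
  proof -
    have "(\<lambda>k. \<integral>x. (circ x + z) / (circ x - z) \<partial>((\<nu> \<circ> id \<circ> q) k)) \<longlonglongrightarrow> (\<integral>x. (circ x + z) / (circ x - z) \<partial>N)"
    proof (rule weak_conv_imp_integral_bdd_continuous_conv[OF _ N wc, where B = "2 / (1 - norm z)"])
      fix x
      show "isCont (\<lambda>x. (circ x + z) / (circ x - z)) x"
        using circ_neq[OF z] by (intro continuous_intros) auto
      have "norm (circ x + z) \<le> 2" using norm_triangle_ineq[of "circ x" z] z by simp
      moreover have "1 - norm z \<le> norm (circ x - z)" using norm_triangle_ineq2[of "circ x" z] by simp
      ultimately show "norm ((circ x + z) / (circ x - z)) \<le> 2 / (1 - norm z)"
        using z by (simp add: norm_divide frac_le)
    qed (use rd in auto)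
    then have "(\<lambda>k. f (of_real (r (q k)) * z) - \<i> * of_real (Im (f 0))) \<longlonglongrightarrow> (\<integral>x. (circ x + z) / (circ x - z) \<partial>N)"
      by (simp add: repr[OF z])
    moreover have "(\<lambda>k. f (of_real (r (q k)) * z) - \<i> * of_real (Im (f 0))) \<longlonglongrightarrow> f z - \<i> * of_real (Im (f 0))"
    proof -
      have "r \<longlonglongrightarrow> 1 - 0" unfolding r_def
        by (intro tendsto_diff tendsto_const) real_asymp
      then have "(\<lambda>k. r (q k)) \<longlonglongrightarrow> 1"
        using LIMSEQ_subseq_LIMSEQ[OF _ q, of r] by (auto simp: o_def)
      then have "(\<lambda>k. of_real (r (q k)) * z) \<longlonglongrightarrow> of_real 1 * z"
        by (intro tendsto_intros)
      moreover have "isCont f z"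
        using f z holomorphic_on_imp_continuous_on[OF f] by (simp add: continuous_on_eq_continuous_at)
      ultimately have "(\<lambda>k. f (of_real (r (q k)) * z)) \<longlonglongrightarrow> f z"
        by (intro isCont_tendsto_compose[of z f]) auto
      then show ?thesis by (intro tendsto_diff tendsto_const)
    qed
    ultimately have "(\<integral>x. (circ x + z) / (circ x - z) \<partial>N) = f z - \<i> * of_real (Im (f 0))"
      by (rule LIMSEQ_unique)
    then show ?thesis by simp
  qed
  with N show ?thesis by blast
qed


section \<open>Truncated integrals, and the passage from the disc to the upper half-plane\<close>

lemma has_bochner_integral_le:
  fixes f g :: "'a \<Rightarrow> real"
  assumes "has_bochner_integral M f x" "has_bochner_integral M g y" "\<And>t. f t \<le> g t"
  shows "x \<le> y"
  using assms integral_mono[of M f g] by (auto simp: has_bochner_integral_iff)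

text \<open>Monotone convergence: y^2 / (T^2 + y^2) = 1 - T^2 / (T^2 + y^2) increases to 1 with y.
  The limit of the truncated integrals delivers integrability of u together with the value of its
  integral; this is how the total mass and the even moments are obtained from \<phi> on the
  imaginary axis.\<close>

lemma has_bochner_integral_cutoff_limit:
  fixes u T :: "'a \<Rightarrow> real"
  assumes u [measurable]: "u \<in> borel_measurable M" and T [measurable]: "T \<in> borel_measurable M"
    and nn: "\<And>x. 0 \<le> u x"
    and J: "\<forall>\<^sub>F y in at_top. has_bochner_integral M (\<lambda>x. u x * (y\<^sup>2 / ((T x)\<^sup>2 + y\<^sup>2))) (J y)"
    and lim: "(J \<longlongrightarrow> l) at_top"
  shows "has_bochner_integral M u l"
proof -
  obtain Y where Y: "has_bochner_integral M (\<lambda>x. u x * (y\<^sup>2 / ((T x)\<^sup>2 + y\<^sup>2))) (J y)" if "y \<ge> Y" for y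
    using J by (auto simp: eventually_at_top_linorder)
  define a where "a k = \<bar>Y\<bar> + 1 + real k" for k
  have a: "a k \<ge> Y" "a k > 0" for k by (auto simp: a_def)
  have alim: "filterlim a at_top sequentially" unfolding a_def by real_asymp
  have B: "has_bochner_integral M (\<lambda>x. u x * ((a k)\<^sup>2 / ((T x)\<^sup>2 + (a k)\<^sup>2))) (J (a k))" for k
    by (intro Y a)
  have cut: "y\<^sup>2 / (t\<^sup>2 + y\<^sup>2) = 1 - t\<^sup>2 / (t\<^sup>2 + y\<^sup>2)" if "y > 0" for y t :: real
  proof -
    have "t\<^sup>2 + y\<^sup>2 > 0" using that by (intro add_nonneg_pos) auto
    then have "t\<^sup>2 / (t\<^sup>2 + y\<^sup>2) + y\<^sup>2 / (t\<^sup>2 + y\<^sup>2) = 1"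
      unfolding add_divide_distrib[symmetric] by (intro divide_self) auto
    then show ?thesis by simp
  qed
  show ?thesis
  proof (rule has_bochner_integral_monotone_convergence)
    show "integrable M (\<lambda>x. u x * ((a k)\<^sup>2 / ((T x)\<^sup>2 + (a k)\<^sup>2)))" for k
      using B[of k] by (simp add: has_bochner_integral_iff)
    show "(\<lambda>k. \<integral>x. u x * ((a k)\<^sup>2 / ((T x)\<^sup>2 + (a k)\<^sup>2)) \<partial>M) \<longlonglongrightarrow> l"
      using filterlim_compose[OF lim alim] B by (simp add: has_bochner_integral_iff)
    show "AE x in M. incseq (\<lambda>k. u x * ((a k)\<^sup>2 / ((T x)\<^sup>2 + (a k)\<^sup>2)))"
    proof (intro AE_I2 incseq_SucI mult_left_mono nn)
      fix x k
      have "(a k)\<^sup>2 \<le> (a (Suc k))\<^sup>2" using a[of k] by (intro power_mono) (auto simp: a_def)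
      then have "(T x)\<^sup>2 / ((T x)\<^sup>2 + (a (Suc k))\<^sup>2) \<le> (T x)\<^sup>2 / ((T x)\<^sup>2 + (a k)\<^sup>2)"
        using a[of k] by (intro divide_left_mono mult_pos_pos add_nonneg_pos) auto
      then show "(a k)\<^sup>2 / ((T x)\<^sup>2 + (a k)\<^sup>2) \<le> (a (Suc k))\<^sup>2 / ((T x)\<^sup>2 + (a (Suc k))\<^sup>2)"
        using a by (simp add: cut)
    qed
    show "AE x in M. (\<lambda>k. u x * ((a k)\<^sup>2 / ((T x)\<^sup>2 + (a k)\<^sup>2))) \<longlonglongrightarrow> u x"
    proof (intro AE_I2)
      fix x
      have "((\<lambda>y. u x * (y\<^sup>2 / ((T x)\<^sup>2 + y\<^sup>2))) \<longlongrightarrow> u x) at_top" by real_asymp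
      from filterlim_compose[OF this alim]
      show "(\<lambda>k. u x * ((a k)\<^sup>2 / ((T x)\<^sup>2 + (a k)\<^sup>2))) \<longlonglongrightarrow> u x" .
    qed
  qed fact
qed

text \<open>|exp (i f)| = exp (- Im f) \<le> 1, and equality at w is an interior maximum, so exp (i
  f) is constant by the maximum modulus principle.\<close>

lemma upper_half_plane_constant_Im:
  assumes f: "f holomorphic_on {z. 0 < Im z}" and pos: "\<And>z. 0 < Im z \<Longrightarrow> 0 \<le> Im (f z)"
    and w: "0 < Im w" "Im (f w) = 0" and z: "0 < Im z"
  shows "Im (f z) = 0"
proof -
  define h where "h z = exp (\<i> * f z)" for z
  have nh: "norm (h z) = exp (- Im (f z))" for z by (simp add: h_def)
  have "h constant_on {z. 0 < Im z}"
  proof (rule maximum_modulus_principle[where U = "{z. 0 < Im z}" and \<xi> = w])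
    show "h holomorphic_on {z. 0 < Im z}" unfolding h_def by (intro holomorphic_intros f)
    show "connected {z. 0 < Im z}" by (intro convex_connected convex_halfspace_Im_gt)
  qed (use w pos in \<open>auto simp: nh open_halfspace_Im_gt\<close>)
  then have "h z = h w" using w z by (auto simp: constant_on_def)
  then have "norm (h z) = norm (h w)" by simp
  then show ?thesis using w by (simp add: nh)
qed

text \<open>A general Nevanlinna function is a linear term plus a real constant plus the integral of
  (1 + t w) / (t - w) against a finite measure. The growth condition on the imaginary axis excludes
  the linear term, makes 1 + t^2 integrable and forces the constant that is left to vanish, so that
  only the Cauchy transform of a finite measure remains.\<close>

theorem nevanlinna_cauchy_transform:
  fixes c :: real
  assumes hol: "\<phi> holomorphic_on {z. 0 < Im z}" and pos: "\<And>z. 0 < Im z \<Longrightarrow> 0 \<le> Im (\<phi> z)"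
    and lim: "((\<lambda>y. of_real y * \<phi> (\<i> * of_real y)) \<longlongrightarrow> \<i> * of_real c) at_top" and c: "0 < c"
  shows "\<exists>\<mu>. sets \<mu> = sets borel \<and> finite_measure \<mu> \<and>
    (\<forall>w. 0 < Im w \<longrightarrow> has_bochner_integral \<mu> (\<lambda>t. 1 / (of_real t - w)) (\<phi> w))"
proof -
  have limIm: "((\<lambda>y. y * Im (\<phi> (\<i> * of_real y))) \<longlongrightarrow> c) at_top"
    using tendsto_Im[OF lim] by simp
  have ev0: "\<forall>\<^sub>F y in at_top. 0 < y * Im (\<phi> (\<i> * of_real y))"
    using order_tendstoD(1)[OF limIm c] .
  \<comment> \<open>Otherwise Im \<phi> vanishes on the whole half-plane, although y Im \<phi>(i y)
    tends to c > 0. This permits the normalization by \<open>m\<close>.\<close>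
  have "Im (\<phi> \<i>) \<noteq> 0"
  proof
    assume "Im (\<phi> \<i>) = 0"
    then have "Im (\<phi> (\<i> * of_real y)) = 0" if "y > 0" for y
      using upper_half_plane_constant_Im[OF hol pos, of \<i>] that by simp
    then have "\<forall>\<^sub>F y in at_top. y * Im (\<phi> (\<i> * of_real y)) = 0"
      by (intro eventually_mono[OF eventually_gt_at_top[of "0::real"]]) auto
    with ev0 have "\<forall>\<^sub>F y::real in at_top. False" by eventually_elim simp
    then show False by simp
  qed
  define m where "m = Im (\<phi> \<i>)"
  have m: "m > 0" using pos[of \<i>] \<open>Im (\<phi> \<i>) \<noteq> 0\<close> by (simp add: m_def)
  \<comment> \<open>The Cayley transform from the disc to the upper half-plane. It sends 0 to i, so
    that \<open>F\<close> below has real part 1 at 0.\<close>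
  define C where "C \<zeta> = \<i> * (1 + \<zeta>) / (1 - \<zeta>)" for \<zeta> :: complex
  have ImC: "Im (C \<zeta>) = (1 - (norm \<zeta>)\<^sup>2) / (norm (1 - \<zeta>))\<^sup>2" for \<zeta>
    unfolding C_def Im_divide cmod_power2 by (simp add: power2_eq_square algebra_simps)
  have ImC_pos: "0 < Im (C \<zeta>)" if "norm \<zeta> < 1" for \<zeta>
  proof -
    have "\<zeta> \<noteq> 1" using that by auto
    moreover have "(norm \<zeta>)\<^sup>2 < 1" using that by (simp add: abs_square_less_1)
    ultimately show ?thesis unfolding ImC by simp
  qed
  define F where "F \<zeta> = - \<i> * \<phi> (C \<zeta>) / of_real m" for \<zeta>
  have F: "F holomorphic_on ball 0 1"
  proof -
    have "C holomorphic_on ball 0 1" unfolding C_def by (intro holomorphic_intros) auto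
    then have "\<phi> \<circ> C holomorphic_on ball 0 1"
      by (rule holomorphic_on_compose_gen[OF _ hol]) (use ImC_pos in auto)
    then have "(\<lambda>z. \<phi> (C z)) holomorphic_on ball 0 1" by (simp add: o_def)
    then show ?thesis unfolding F_def using m by (intro holomorphic_intros) auto
  qed
  have C0: "C 0 = \<i>" by (simp add: C_def)
  have "\<exists>\<nu>. real_distribution \<nu> \<and> (\<forall>z. norm z < 1 \<longrightarrow>
     F z = \<i> * of_real (Im (F 0)) + (\<integral>x. (circ x + z) / (circ x - z) \<partial>\<nu>))"
    by (rule herglotz_disc[OF F]) (use m pos ImC_pos C0 in \<open>auto simp: F_def m_def\<close>)
  then obtain \<nu> where rd: "real_distribution \<nu>" and rep: "\<And>z. norm z < 1 \<Longrightarrow>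
      F z = \<i> * of_real (Im (F 0)) + (\<integral>x. (circ x + z) / (circ x - z) \<partial>\<nu>)"
    by blast
  interpret real_distribution \<nu> by (rule rd)
  have [measurable_cong]: "sets \<nu> = sets borel" by simp
  \<comment> \<open>The boundary values of the Cayley transform are real except at the pole
    \<open>circ x = 1\<close>, where division by zero sets \<open>T x\<close> to 0; that point is
    treated apart in \<open>K\<close>.\<close>
  define T where "T x = Re (C (circ x))" for x
  have Tm [measurable]: "T \<in> borel_measurable borel" unfolding T_def C_def by measurable
  have CT: "C (circ x) = of_real (T x)" if "circ x \<noteq> 1" for x
    using ImC[of "circ x"] by (simp add: T_def complex_eq_iff)
  \<comment> \<open>This is i times the Schwarz kernel, expressed in t = \<open>T x\<close>. At the
    pole it takes the value w, the limit of (1 + t w) / (t - w) as t tends to infinity.\<close>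
  define K where "K w x = (if circ x = 1 then w else (1 + of_real (T x) * w) / (of_real (T x) - w))" for w :: complex and x
  have kern: "norm ((w - \<i>) / (w + \<i>)) < 1" "C ((w - \<i>) / (w + \<i>)) = w"
     "\<i> * ((circ x + (w - \<i>) / (w + \<i>)) / (circ x - (w - \<i>) / (w + \<i>))) = K w x" if w: "0 < Im w" for w x
  proof -
    have wi: "w + \<i> \<noteq> 0" using w by (auto simp: complex_eq_iff)
    have "(norm (w - \<i>))\<^sup>2 < (norm (w + \<i>))\<^sup>2"
      using w unfolding cmod_power2 by (simp add: power2_eq_square algebra_simps)
    then have "norm (w - \<i>) < norm (w + \<i>)" by (rule power_less_imp_less_base) simp
    then show n: "norm ((w - \<i>) / (w + \<i>)) < 1" using wi by (simp add: norm_divide)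
    show "C ((w - \<i>) / (w + \<i>)) = w" unfolding C_def using wi by (simp add: divide_simps)
    define e where "e = circ x"
    have ne: "e \<noteq> (w - \<i>) / (w + \<i>)" using circ_neq[OF n] by (simp add: e_def)
    have 1: "\<i> * ((e + (w - \<i>) / (w + \<i>)) / (e - (w - \<i>) / (w + \<i>))) =
       \<i> * (e * (w + \<i>) + (w - \<i>)) / (e * (w + \<i>) - (w - \<i>))"
      using wi ne by (simp add: divide_simps)
    have ne': "e * (w + \<i>) - (w - \<i>) \<noteq> 0" using ne wi by (simp add: field_simps)
    show "\<i> * ((circ x + (w - \<i>) / (w + \<i>)) / (circ x - (w - \<i>) / (w + \<i>))) = K w x"
    proof (cases "e = 1")
      case True
      then show ?thesis using 1 by (simp add: K_def e_def)
    next
      case False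
      have "\<i> * (e * (w + \<i>) + (w - \<i>)) / (e * (w + \<i>) - (w - \<i>)) = (1 + C e * w) / (C e - w)"
      proof -
        have "1 - e \<noteq> 0" using False by simp
        have "C e * (1 - e) = \<i> * (1 + e)" using False by (simp add: C_def)
        have "(1 - e) * (C e - w) = C e * (1 - e) - (1 - e) * w"
          by (simp add: algebra_simps)
        also have "\<dots> = e * (w + \<i>) - (w - \<i>)"
          unfolding \<open>C e * (1 - e) = _\<close> by (simp add: algebra_simps)
        finally have a: "(1 - e) * (C e - w) = e * (w + \<i>) - (w - \<i>)" .
        have "(1 - e) * (1 + C e * w) = (1 - e) + C e * (1 - e) * w"
          by (simp add: algebra_simps)
        also have "\<dots> = \<i> * (e * (w + \<i>) + (w - \<i>))"
          unfolding \<open>C e * (1 - e) = _\<close> by (simp add: algebra_simps)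
        finally have b: "(1 - e) * (1 + C e * w) = \<i> * (e * (w + \<i>) + (w - \<i>))" .
        have "(1 + C e * w) / (C e - w) = ((1 - e) * (1 + C e * w)) / ((1 - e) * (C e - w))"
          using \<open>1 - e \<noteq> 0\<close> by simp
        then show ?thesis by (simp only: a b)
      qed
      with 1 False CT show ?thesis by (simp add: K_def e_def)
    qed
  qed
  have Km [measurable]: "K w \<in> borel_measurable borel" for w unfolding K_def by measurable
  have Kint: "integrable \<nu> (K w)" if w: "0 < Im w" for w
  proof -
    define z where "z = (w - \<i>) / (w + \<i>)"
    have z: "norm z < 1" using kern[OF w] by (simp add: z_def)
    have "integrable \<nu> (\<lambda>x. \<i> * ((circ x + z) / (circ x - z)))"
    proof (rule integrable_const_bound[where B = "2 / (1 - norm z)"])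
      show "AE x in \<nu>. norm (\<i> * ((circ x + z) / (circ x - z))) \<le> 2 / (1 - norm z)"
      proof (intro AE_I2)
        fix x
        have "norm (circ x + z) \<le> 2" using norm_triangle_ineq[of "circ x" z] z by simp
        moreover have "1 - norm z \<le> norm (circ x - z)" using norm_triangle_ineq2[of "circ x" z] by simp
        ultimately show "norm (\<i> * ((circ x + z) / (circ x - z))) \<le> 2 / (1 - norm z)"
          using z by (simp add: norm_divide norm_mult frac_le)
      qed
    qed measurable
    then show ?thesis using kern(3)[OF w] by (simp add: z_def)
  qed
  have phi: "\<phi> w = of_real (Re (\<phi> \<i>)) + of_real m * (\<integral>x. K w x \<partial>\<nu>)" if w: "0 < Im w" for w
  proof -
    define z where "z = (w - \<i>) / (w + \<i>)"
    have z: "norm z < 1" "C z = w" using kern[OF w] by (simp_all add: z_def)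
    have "\<phi> w = \<i> * of_real m * F z" using m z by (simp add: F_def)
    also have "F z = \<i> * of_real (Im (F 0)) + (\<integral>x. (circ x + z) / (circ x - z) \<partial>\<nu>)"
      by (rule rep[OF z(1)])
    also have "\<i> * of_real m * \<dots> = - of_real (m * Im (F 0)) + of_real m * (\<i> * (\<integral>x. (circ x + z) / (circ x - z) \<partial>\<nu>))"
      by (simp add: algebra_simps)
    also have "\<i> * (\<integral>x. (circ x + z) / (circ x - z) \<partial>\<nu>) = (\<integral>x. K w x \<partial>\<nu>)"
      using kern(3)[OF w] by (subst integral_mult_right_zero[symmetric]) (simp add: z_def)
    also have "m * Im (F 0) = - Re (\<phi> \<i>)" using m by (simp add: F_def C0)
    finally show ?thesis by simp
  qed
  have sq: "t\<^sup>2 + y\<^sup>2 > 0" if "y > 0" for t y :: real using that by (intro add_nonneg_pos) auto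
  have ImK: "y * Im (K (\<i> * of_real y) x) = (if circ x = 1 then y\<^sup>2 else (1 + (T x)\<^sup>2) * (y\<^sup>2 / ((T x)\<^sup>2 + y\<^sup>2)))"
    if "y > 0" for y x
  proof (cases "circ x = 1")
    case False
    have "Im ((1 + of_real (T x) * (\<i> * of_real y)) / (of_real (T x) - \<i> * of_real y)) = (1 + (T x)\<^sup>2) * y / ((T x)\<^sup>2 + y\<^sup>2)"
      unfolding Im_divide by (simp add: power2_eq_square algebra_simps)
    then have "y * Im (K (\<i> * of_real y) x) = y * ((1 + (T x)\<^sup>2) * y / ((T x)\<^sup>2 + y\<^sup>2))"
      using False by (simp only: K_def if_False)
    then show ?thesis using False by (simp only: if_False power2_eq_square times_divide_eq_right mult_ac)
  qed (simp add: K_def power2_eq_square)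
  have intIm: "has_bochner_integral \<nu> (\<lambda>x. y * Im (K (\<i> * of_real y) x)) (y * Im (\<phi> (\<i> * of_real y)) / m)"
    if "y > 0" for y
  proof -
    have "has_bochner_integral \<nu> (\<lambda>x. y * Im (K (\<i> * of_real y) x)) (y * Im (\<integral>x. K (\<i> * of_real y) x \<partial>\<nu>))"
      using Kint[of "\<i> * of_real y"] that
      by (intro has_bochner_integral_mult_right has_bochner_integral_Im) (auto simp: has_bochner_integral_iff)
    moreover have "Im (\<phi> (\<i> * of_real y)) = m * Im (\<integral>x. K (\<i> * of_real y) x \<partial>\<nu>)"
      using phi[of "\<i> * of_real y"] that by simp
    ultimately show ?thesis using m by simp
  qed
  \<comment> \<open>a mass at \<open>circ x = 1\<close>, which corresponds to \<open>t = \<infinity>\<close>, would add a linear term to \<open>\<phi>\<close>\<close>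
  have null: "AE x in \<nu>. circ x \<noteq> 1"
  proof -
    define Z where "Z = {x. circ x = 1}"
    have Zm [measurable]: "Z \<in> sets borel" unfolding Z_def by measurable
    have le: "y\<^sup>2 * prob Z \<le> y * Im (\<phi> (\<i> * of_real y)) / m" if "y > 0" for y
    proof -
      have "has_bochner_integral \<nu> (\<lambda>x. y\<^sup>2 * indicator Z x) (y\<^sup>2 * prob Z)"
        by (intro has_bochner_integral_mult_right has_bochner_integral_real_indicator) (auto simp: emeasure_eq_measure)
      moreover have "y\<^sup>2 * indicator Z x \<le> y * Im (K (\<i> * of_real y) x)" for x
        using sq[OF that, of "T x"] by (auto simp: ImK[OF that] Z_def split: split_indicator)
      ultimately show ?thesis by (rule has_bochner_integral_le[OF _ intIm[OF that]])
    qed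
    have "\<forall>\<^sub>F y in at_top. prob Z \<le> y * Im (\<phi> (\<i> * of_real y)) / m * (1 / y\<^sup>2)"
      using eventually_gt_at_top[of "0::real"]
    proof eventually_elim
      case (elim y)
      have "prob Z \<le> (y * Im (\<phi> (\<i> * of_real y)) / m) / y\<^sup>2"
        using le[OF elim] elim by (subst pos_le_divide_eq) (auto simp: mult.commute)
      then show ?case by simp
    qed
    moreover have "((\<lambda>y. y * Im (\<phi> (\<i> * of_real y)) / m * (1 / y\<^sup>2)) \<longlongrightarrow> c / m * 0) at_top"
      using m by (intro tendsto_mult tendsto_divide tendsto_const limIm) (auto, real_asymp)
    ultimately have "prob Z \<le> 0" by (intro tendsto_lowerbound) auto
    then have "prob Z = 0" using measure_nonneg[of \<nu> Z] by simp
    then have "AE x in \<nu>. x \<notin> Z" by (subst (asm) prob_eq_0) auto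
    then show ?thesis by (simp add: Z_def)
  qed
  \<comment> \<open>The factor 1 + t^2 comes from (1 + t w) / (t - w) = (1 + t^2) / (t - w) - t,
    which turns the Nevanlinna kernel into the Cauchy kernel.\<close>
  define u where "u x = m * (1 + (T x)\<^sup>2)" for x
  have um [measurable]: "u \<in> borel_measurable borel" unfolding u_def by measurable
  have unn: "0 \<le> u x" for x using m by (simp add: u_def)
  have uint: "has_bochner_integral \<nu> u c"
  proof (rule has_bochner_integral_cutoff_limit[OF _ _ unn _ limIm])
    show "\<forall>\<^sub>F y in at_top. has_bochner_integral \<nu> (\<lambda>x. u x * (y\<^sup>2 / ((T x)\<^sup>2 + y\<^sup>2))) (y * Im (\<phi> (\<i> * of_real y)))"
      using eventually_gt_at_top[of "0::real"]
    proof eventually_elim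
      case (elim y)
      have "has_bochner_integral \<nu> (\<lambda>x. m * (y * Im (K (\<i> * of_real y) x))) (m * (y * Im (\<phi> (\<i> * of_real y)) / m))"
        by (intro has_bochner_integral_mult_right intIm elim)
      then have "has_bochner_integral \<nu> (\<lambda>x. m * (y * Im (K (\<i> * of_real y) x))) (y * Im (\<phi> (\<i> * of_real y)))"
        using m by simp
      then show ?case
      proof (subst (asm) has_bochner_integral_cong_AE)
        show "AE x in \<nu>. m * (y * Im (K (\<i> * of_real y) x)) = u x * (y\<^sup>2 / ((T x)\<^sup>2 + y\<^sup>2))"
          using null by eventually_elim (use elim in \<open>simp add: ImK u_def\<close>)
      qed simp_all
    qed
  qed auto
  define \<mu> where "\<mu> = distr (density \<nu> u) borel T"
  have sets\<mu>: "sets \<mu> = sets borel" by (simp add: \<mu>_def)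
  have integral\<mu>: "(\<integral>t. g t \<partial>\<mu>) = (\<integral>x. u x *\<^sub>R g (T x) \<partial>\<nu>)"
    and integrable\<mu>: "integrable \<mu> g \<longleftrightarrow> integrable \<nu> (\<lambda>x. u x *\<^sub>R g (T x))"
    if [measurable]: "g \<in> borel_measurable borel" for g :: "real \<Rightarrow> complex"
    unfolding \<mu>_def using unn
    by (simp_all add: integral_distr integrable_distr_eq integral_density integrable_density)
  have fin: "finite_measure \<mu>"
  proof
    have "emeasure \<mu> (space \<mu>) = (\<integral>\<^sup>+x. u x \<partial>\<nu>)"
      unfolding \<mu>_def by (simp add: emeasure_distr emeasure_density)
    also have "\<dots> = ennreal c" using uint unn
      by (subst nn_integral_eq_integral) (auto simp: has_bochner_integral_iff)
    finally show "emeasure \<mu> (space \<mu>) \<noteq> \<infinity>" by simp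
  qed
  interpret mu: finite_measure \<mu> by (rule fin)
  have [measurable_cong]: "sets \<mu> = sets borel" by fact
  have bound: "norm (1 / (of_real t - w)) \<le> 1 / Im w" if "0 < Im w" for t :: real and w :: complex
  proof -
    have "Im w \<le> norm (of_real t - w)" using abs_Im_le_cmod[of "of_real t - w"] by simp
    then show ?thesis using that by (simp add: norm_divide frac_le)
  qed
  have int: "integrable \<mu> (\<lambda>t. 1 / (of_real t - w))" if "0 < Im w" for w
    by (rule mu.integrable_const_bound[where B = "1 / Im w"]) (use bound[OF that] in auto)
  have Tint: "integrable \<nu> T"
  proof (rule Bochner_Integration.integrable_bound[of _ "\<lambda>x. u x / m"])
    show "integrable \<nu> (\<lambda>x. u x / m)" using uint by (simp add: has_bochner_integral_iff)
    have "\<bar>t\<bar> \<le> 1 + t\<^sup>2" for t :: real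
    proof -
      have "0 \<le> (\<bar>t\<bar> - 1)\<^sup>2 + \<bar>t\<bar>" by simp
      then show ?thesis by (simp add: power2_diff)
    qed
    then show "AE x in \<nu>. norm (T x) \<le> norm (u x / m)" using m by (auto simp: u_def)
  qed auto
  \<comment> \<open>What the splitting of the kernel leaves over, independent of w. Along the
    imaginary axis \<phi> and the Cauchy transform both tend to 0, so it vanishes.\<close>
  define \<kappa> where "\<kappa> = of_real (Re (\<phi> \<i>)) - of_real m * (\<integral>x. of_real (T x) \<partial>\<nu> :: complex)"
  have phi2: "\<phi> w = \<kappa> + (\<integral>t. 1 / (of_real t - w) \<partial>\<mu>)" if w: "0 < Im w" for w
  proof -
    have nz: "of_real t - w \<noteq> 0" for t using w by (auto simp: complex_eq_iff)
    have i: "integrable \<nu> (\<lambda>x. u x *\<^sub>R (1 / (of_real (T x) - w)))"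
      using int[OF w] by (simp add: integrable\<mu>)
    have "of_real m * (\<integral>x. K w x \<partial>\<nu>) = (\<integral>x. of_real m * K w x \<partial>\<nu>)" by simp
    also have "\<dots> = (\<integral>x. u x *\<^sub>R (1 / (of_real (T x) - w)) - of_real m * of_real (T x) \<partial>\<nu>)"
    proof (rule integral_cong_AE)
      show "(\<lambda>x. of_real m * K w x) \<in> borel_measurable \<nu>" by measurable
      show "AE x in \<nu>. of_real m * K w x = u x *\<^sub>R (1 / (of_real (T x) - w)) - of_real m * of_real (T x)"
        using null
      proof eventually_elim
        case (elim x)
        have "(1 + of_real (T x) * w) / (of_real (T x) - w) = (1 + (of_real (T x))\<^sup>2) / (of_real (T x) - w) - of_real (T x)"
        proof -
          have "(1 + a\<^sup>2) / (a - w) - a = (1 + a * w) / (a - w)" if "a - w \<noteq> 0" for a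
          proof -
            have "(1 + a\<^sup>2) / (a - w) - a = (1 + a\<^sup>2 - a * (a - w)) / (a - w)"
              using that by (simp add: diff_divide_distrib)
            also have "1 + a\<^sup>2 - a * (a - w) = 1 + a * w"
              by (simp add: algebra_simps power2_eq_square)
            finally show ?thesis .
          qed
          from this[OF nz[of "T x"]] show ?thesis by (rule sym)
        qed
        then have "of_real m * K w x = of_real m * ((1 + (of_real (T x))\<^sup>2) / (of_real (T x) - w) - of_real (T x))"
          using elim by (simp only: K_def if_False)
        also have "\<dots> = u x *\<^sub>R (1 / (of_real (T x) - w)) - of_real m * of_real (T x)"
          by (simp add: u_def scaleR_conv_of_real right_diff_distrib)
        finally show ?case .
      qed
    qed measurable
    also have "\<dots> = (\<integral>x. u x *\<^sub>R (1 / (of_real (T x) - w)) \<partial>\<nu>) - of_real m * (\<integral>x. of_real (T x) \<partial>\<nu>)"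
      using Tint i by (subst Bochner_Integration.integral_diff) auto
    also have "(\<integral>x. u x *\<^sub>R (1 / (of_real (T x) - w)) \<partial>\<nu>) = (\<integral>t. 1 / (of_real t - w) \<partial>\<mu>)"
      by (simp add: integral\<mu>)
    finally show ?thesis by (simp add: phi[OF w] \<kappa>_def)
  qed
  have "\<kappa> = 0"
  proof -
    have "((\<lambda>y. \<integral>t. 1 / (of_real t - \<i> * of_real y) \<partial>\<mu>) \<longlongrightarrow> 0) at_top"
    proof (rule Lim_null_comparison)
      show "\<forall>\<^sub>F y in at_top. norm (\<integral>t. 1 / (of_real t - \<i> * of_real y) \<partial>\<mu>) \<le> measure \<mu> (space \<mu>) / y"
        using eventually_gt_at_top[of "0::real"]
      proof eventually_elim
        case (elim y)
        have "norm (\<integral>t. 1 / (of_real t - \<i> * of_real y) \<partial>\<mu>) \<le> (\<integral>t. 1 / y \<partial>\<mu>)"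
        proof (rule Bochner_Integration.integral_norm_bound_integral)
          show "integrable \<mu> (\<lambda>t. 1 / (of_real t - \<i> * of_real y))" using elim by (intro int) simp
          show "norm (1 / (of_real t - \<i> * of_real y)) \<le> 1 / y" for t :: real
            using bound[of "\<i> * of_real y" t] elim by simp
        qed simp
        then show ?case by (simp add: mult.commute)
      qed
      show "((\<lambda>y. measure \<mu> (space \<mu>) / y) \<longlongrightarrow> 0) at_top" by real_asymp
    qed
    moreover have "((\<lambda>y. \<phi> (\<i> * of_real y)) \<longlongrightarrow> 0) at_top"
    proof -
      have "((\<lambda>y. of_real (1 / y) * (of_real y * \<phi> (\<i> * of_real y))) \<longlongrightarrow> of_real 0 * (\<i> * of_real c)) at_top"
        by (intro tendsto_mult lim tendsto_of_real) real_asymp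
      then have "((\<lambda>y. of_real (1 / y) * (of_real y * \<phi> (\<i> * of_real y))) \<longlongrightarrow> 0) at_top" by simp
      then show ?thesis
        by (rule Lim_transform_eventually) (intro eventually_mono[OF eventually_gt_at_top[of "0::real"]], simp)
    qed
    ultimately have "((\<lambda>y. \<phi> (\<i> * of_real y) - (\<integral>t. 1 / (of_real t - \<i> * of_real y) \<partial>\<mu>)) \<longlongrightarrow> 0 - 0) at_top"
      by (rule tendsto_diff[rotated])
    moreover have "\<forall>\<^sub>F y in at_top. \<phi> (\<i> * of_real y) - (\<integral>t. 1 / (of_real t - \<i> * of_real y) \<partial>\<mu>) = \<kappa>"
      using eventually_gt_at_top[of "0::real"] by eventually_elim (subst phi2, auto)
    ultimately have "((\<lambda>y::real. \<kappa>) \<longlongrightarrow> 0) at_top"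
      by (simp add: tendsto_cong)
    then show ?thesis by (simp add: tendsto_const_iff)
  qed
  with phi2 int have "\<forall>w. 0 < Im w \<longrightarrow> has_bochner_integral \<mu> (\<lambda>t. 1 / (of_real t - w)) (\<phi> w)"
    by (auto simp: has_bochner_integral_iff)
  with sets\<mu> fin show ?thesis by blast
qed

section \<open>The moment functional\<close>

lemma moment_functional_eq_sum:
  assumes "degree p \<le> N"
  shows "moment_functional s p = (\<Sum>i\<le>N. s i *\<^sub>R coeff p i)"
  unfolding moment_functional_def
  using assms by (intro sum.mono_neutral_left) (auto simp: coeff_eq_0)

lemma moment_functional_0 [simp]: "moment_functional s 0 = 0"
  by (simp add: moment_functional_def)

lemma moment_functional_add: "moment_functional s (p + q) = moment_functional s p + moment_functional s q"
proof -
  define N where "N = max (degree p) (degree q)"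
  have "degree (p + q) \<le> N" "degree p \<le> N" "degree q \<le> N"
    by (auto simp: N_def intro: degree_add_le)
  then show ?thesis
    by (simp add: moment_functional_eq_sum[where N = N] scaleR_add_right sum.distrib)
qed

lemma moment_functional_smult:
  fixes c :: "'a :: {real_algebra, comm_semiring_0}"
  shows "moment_functional s (smult c p) = c * moment_functional s p"
proof -
  have "degree (smult c p) \<le> degree p" by (rule degree_smult_le)
  then show ?thesis
    by (simp add: moment_functional_eq_sum[where N = "degree p"] sum_distrib_left)
qed

lemma moment_functional_diff:
  fixes p q :: "'a :: {real_algebra, comm_ring} poly"
  shows "moment_functional s (p - q) = moment_functional s p - moment_functional s q"
  by (metis add_diff_cancel_right' diff_add_cancel moment_functional_add)

lemma moment_functional_sum:
  "moment_functional s (\<Sum>i\<in>A. f i) = (\<Sum>i\<in>A. moment_functional s (f i))"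
  by (induction A rule: infinite_finite_induct) (simp_all add: moment_functional_add)

lemma moment_functional_pCons:
  "moment_functional s (pCons a p) = s 0 *\<^sub>R a + moment_functional (\<lambda>i. s (Suc i)) p"
proof -
  have "degree (pCons a p) \<le> Suc (degree p)" by (simp add: degree_pCons_le)
  then show ?thesis
    by (simp add: moment_functional_eq_sum[where N = "Suc (degree p)"] moment_functional_eq_sum[OF order.refl]
        sum.atMost_Suc_shift del: sum.atMost_Suc)
qed

lemma moment_functional_monom: "moment_functional s (monom c i) = s i *\<^sub>R c"
  by (induction i arbitrary: s) (simp_all add: monom_0 monom_Suc moment_functional_pCons)

lemma map_poly_of_real_mult:
  "map_poly of_real (p * q) = (map_poly of_real p * map_poly of_real q :: complex poly)"
  by (intro poly_eqI) (simp add: coeff_map_poly coeff_mult)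

lemma map_poly_cnj_mult: "map_poly cnj (p * q) = map_poly cnj p * map_poly cnj q"
  by (intro poly_eqI) (simp add: coeff_map_poly coeff_mult)

lemma map_poly_cnj_of_real [simp]: "map_poly cnj (map_poly of_real p) = map_poly of_real p"
  by (intro poly_eqI) (simp add: coeff_map_poly)

lemma map_poly_cnj_cnj [simp]: "map_poly cnj (map_poly cnj p) = p"
  by (intro poly_eqI) (simp add: coeff_map_poly)

lemma degree_map_poly_cnj [simp]: "degree (map_poly cnj p) = degree p"
  by (simp add: degree_map_poly)

lemma degree_map_poly_of_real [simp]: "degree (map_poly of_real p :: complex poly) = degree p"
  by (simp add: degree_map_poly)

lemma poly_map_poly_cnj: "poly (map_poly cnj p) z = cnj (poly p (cnj z))"
  by (induction p) (simp_all add: map_poly_pCons)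

lemma moment_functional_cnj: "moment_functional s (map_poly cnj p) = cnj (moment_functional s p)"
  by (simp add: moment_functional_def coeff_map_poly)

lemma moment_functional_of_real:
  "moment_functional s (map_poly of_real p :: complex poly) = of_real (moment_functional s p)"
  by (simp add: moment_functional_def coeff_map_poly scaleR_conv_of_real)

lemma cpoly_cnj: "cpoly P (cnj z) = cnj (cpoly P z)"
  unfolding cpoly_def by (metis map_poly_cnj_of_real poly_map_poly_cnj complex_cnj_cnj)

lemma poly_synthetic_div: "poly p t = poly p z + (t - z) * poly (synthetic_div p z) t"
  for p :: "'a :: comm_ring_1 poly"
  using arg_cong[OF synthetic_div_correct'[of z p], of "\<lambda>q. poly q t"] by (simp add: algebra_simps)

lemma second_kind_eq: "second_kind s P z = moment_functional s (synthetic_div (map_poly of_real P) z)"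
proof -
  have eq: "map_poly of_real P - [:cpoly P z:] = [:-z, 1:] * synthetic_div (map_poly of_real P) z"
    using synthetic_div_correct'[of z "map_poly of_real P"] unfolding cpoly_def by (metis add_diff_cancel_right')
  show ?thesis unfolding second_kind_def eq by (subst nonzero_mult_div_cancel_left) auto
qed

lemma second_kind_0 [simp]: "second_kind s 0 z = 0"
  by (simp add: second_kind_eq)

text \<open>The difference quotient of a + t P(t) is P(z) + t (P(t) - P(z)) / (t - z), and a factor
  t shifts the moment sequence. Inductions over P that use this recursion therefore keep
  \<open>s\<close> arbitrary.\<close>

lemma second_kind_pCons:
  "second_kind s (pCons a P) z = s 0 * cpoly P z + second_kind (\<lambda>i. s (Suc i)) P z"
  by (simp add: second_kind_eq map_poly_pCons moment_functional_pCons cpoly_def scaleR_conv_of_real)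

lemma cpoly_pCons: "cpoly (pCons a P) z = a + z * cpoly P z"
  by (simp add: cpoly_def map_poly_pCons)

lemma cpoly_holomorphic [holomorphic_intros]: "cpoly P holomorphic_on A"
  unfolding cpoly_def by (intro holomorphic_intros)

lemma second_kind_holomorphic [holomorphic_intros]: "second_kind s P holomorphic_on A"
proof (induction P arbitrary: s)
  case (pCons a P)
  show ?case unfolding second_kind_pCons by (intro holomorphic_intros pCons.IH)
qed (simp add: second_kind_0[abs_def])

lemma second_kind_cnj: "second_kind s P (cnj z) = cnj (second_kind s P z)"
  by (induction P arbitrary: s) (simp_all add: second_kind_pCons cpoly_cnj)

section \<open>Positivity and orthogonality of the moment functional\<close>

lemma moment_functional_mult_cnj:
  assumes "degree R \<le> n"
  shows "moment_functional s (R * map_poly cnj R) =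
    (\<Sum>i\<le>n. \<Sum>j\<le>n. s (i + j) * (coeff R i * cnj (coeff R j)))"
proof -
  have R: "R = (\<Sum>i\<le>n. monom (coeff R i) i)" using poly_as_sum_of_monoms'[OF assms] by simp
  have R': "map_poly cnj R = (\<Sum>i\<le>n. monom (cnj (coeff R i)) i)"
    using poly_as_sum_of_monoms'[of "map_poly cnj R" n] assms by (simp add: coeff_map_poly)
  have "R * map_poly cnj R = (\<Sum>i\<le>n. \<Sum>j\<le>n. monom (coeff R i * cnj (coeff R j)) (i + j))"
    by (subst R, subst R') (simp add: sum_product mult_monom)
  then show ?thesis by (simp add: moment_functional_sum moment_functional_monom scaleR_conv_of_real)
qed

text \<open>\<open>R * map_poly cnj R\<close> is |R|^2 on the real line. The Hankel matrix is real
  and symmetric, so its Hermitian form at complex coefficients is the sum of the forms at their real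
  and imaginary parts; this carries positivity from real vectors to complex polynomials.\<close>

lemma hankel_pos:
  assumes "hankel_pos_def s n" "degree R \<le> n" "R \<noteq> 0"
  shows "Im (moment_functional s (R * map_poly cnj R)) = 0" "0 < Re (moment_functional s (R * map_poly cnj R))"
proof -
  have "map_poly cnj (R * map_poly cnj R) = R * map_poly cnj R"
    by (simp add: map_poly_cnj_mult mult.commute)
  then have "cnj (moment_functional s (R * map_poly cnj R)) = moment_functional s (R * map_poly cnj R)"
    using moment_functional_cnj[of s "R * map_poly cnj R"] by simp
  then show "Im (moment_functional s (R * map_poly cnj R)) = 0"
    by (simp add: complex_eq_iff)
  define q where "q x = (\<Sum>i\<le>n. \<Sum>j\<le>n. s (i + j) * x i * x j)" for x
  have q: "0 < q x" if "\<exists>i\<le>n. x i \<noteq> 0" for x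
    using assms(1) that unfolding hankel_pos_def_def q_def by blast
  have q0: "0 \<le> q x" for x
  proof (cases "\<exists>i\<le>n. x i \<noteq> 0")
    case False
    then have "q x = 0" unfolding q_def by (intro sum.neutral) auto
    then show ?thesis by simp
  qed (use q less_imp_le in blast)
  have "Re (moment_functional s (R * map_poly cnj R)) = q (\<lambda>i. Re (coeff R i)) + q (\<lambda>i. Im (coeff R i))"
    unfolding moment_functional_mult_cnj[OF assms(2)] q_def by (simp add: sum.distrib[symmetric] algebra_simps)
  moreover have "(\<exists>i\<le>n. Re (coeff R i) \<noteq> 0) \<or> (\<exists>i\<le>n. Im (coeff R i) \<noteq> 0)"
  proof -
    have "coeff R (degree R) \<noteq> 0" using assms(3) by simp
    then show ?thesis using assms(2) by (auto simp: complex_eq_iff)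
  qed
  then have "0 < q (\<lambda>i. Re (coeff R i)) \<or> 0 < q (\<lambda>i. Im (coeff R i))"
    using q[of "\<lambda>i. Re (coeff R i)"] q[of "\<lambda>i. Im (coeff R i)"] by blast
  ultimately show "0 < Re (moment_functional s (R * map_poly cnj R))"
    using q0[of "\<lambda>i. Re (coeff R i)"] q0[of "\<lambda>i. Im (coeff R i)"] by linarith
qed

text \<open>P annihilates all powers below k, so only the coefficient of t^k in q counts.\<close>

lemma orthogonal_poly_mult:
  fixes q :: "complex poly"
  assumes "orthogonal_poly s k P" "degree q \<le> k"
  shows "moment_functional s (map_poly of_real P * q) = moment_functional s (P * monom 1 k) * coeff q k"
proof -
  have "moment_functional s (map_poly of_real P * q) =
      (\<Sum>i\<le>k. moment_functional s (smult (coeff q i) (map_poly of_real (P * monom 1 i))))"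
  proof -
    have "map_poly of_real P * q = map_poly of_real P * (\<Sum>i\<le>k. monom (coeff q i) i)"
      using poly_as_sum_of_monoms'[OF assms(2)] by simp
    also have "\<dots> = (\<Sum>i\<le>k. smult (coeff q i) (map_poly of_real (P * monom 1 i)))"
      by (simp add: sum_distrib_left map_poly_of_real_mult map_poly_monom smult_monom flip: mult_smult_right)
    finally show ?thesis by (simp add: moment_functional_sum)
  qed
  also have "\<dots> = (\<Sum>i\<le>k. coeff q i * of_real (moment_functional s (P * monom 1 i)))"
    by (simp add: moment_functional_smult moment_functional_of_real)
  also have "\<dots> = (\<Sum>i\<in>{k}. coeff q i * of_real (moment_functional s (P * monom 1 i)))"
    using assms(1) by (intro sum.mono_neutral_right) (auto simp: orthogonal_poly_def)
  finally show ?thesis by (simp add: mult.commute)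
qed

section \<open>Imaginary parts of the linear fractional transformation\<close>

text \<open>In the proof \<open>H\<close> and \<open>pCons 0 H\<close> stand for |R|^2 and t |R|^2.
  They have real coefficients, so their functionals are real, and the imaginary part of the
  expansion along N = N(z) + (t - z) R keeps only the terms carrying N(z) and Im z.\<close>

lemma im_moment_identity:
  fixes N :: "complex poly" and z :: complex
  defines "R \<equiv> synthetic_div N z"
  shows "Im (moment_functional s (N * map_poly cnj R)) =
    Im (poly N z * cnj (moment_functional s R)) - Im z * Re (moment_functional s (R * map_poly cnj R))"
proof -
  define H where "H = R * map_poly cnj R"
  have H: "map_poly cnj H = H" by (simp add: H_def map_poly_cnj_mult mult.commute)
  then have "map_poly cnj (pCons 0 H) = pCons 0 H" by (simp add: map_poly_pCons)
  then have r: "Im (moment_functional s H) = 0" "Im (moment_functional s (pCons 0 H)) = 0"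
    using moment_functional_cnj[of s H] moment_functional_cnj[of s "pCons 0 H"] H
    by (simp_all add: complex_eq_iff)
  have "N * map_poly cnj R = ([:- z, 1:] * R + [:poly N z:]) * map_poly cnj R"
    unfolding R_def synthetic_div_correct' ..
  also have "\<dots> = pCons 0 H - smult z H + smult (poly N z) (map_poly cnj R)"
    by (simp add: H_def algebra_simps)
  finally have "moment_functional s (N * map_poly cnj R) = moment_functional s (pCons 0 H) - z * moment_functional s H +
      poly N z * cnj (moment_functional s R)"
    by (simp add: moment_functional_add moment_functional_diff moment_functional_smult moment_functional_cnj)
  then show ?thesis using r by (simp add: H_def)
qed

lemma synthetic_div_smult_add:
  "synthetic_div (smult c p + q) z = smult c (synthetic_div p z) + synthetic_div q z"
  for p :: "'a :: comm_ring_1 poly"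
proof -
  have "(smult c p + q) + smult z (smult c (synthetic_div p z) + synthetic_div q z)
     = smult c (p + smult z (synthetic_div p z)) + (q + smult z (synthetic_div q z))"
    by (simp add: algebra_simps smult_add_right)
  also have "\<dots> = pCons (c * poly p z + poly q z) (smult c (synthetic_div p z) + synthetic_div q z)"
    by (simp add: synthetic_div_correct)
  finally show ?thesis using synthetic_div_unique by metis
qed

text \<open>The product rule for difference quotients. This asymmetric form leaves p whole in the
  last summand, where orthogonality of p can act.\<close>

lemma synthetic_div_mult:
  "synthetic_div (p * q) z = smult (poly q z) (synthetic_div p z) + p * synthetic_div q z"
  for p :: "'a :: comm_ring_1 poly"
proof -
  define p1 q1 where "p1 = synthetic_div p z" and "q1 = synthetic_div q z"
  have p: "p = [:- z, 1:] * p1 + [:poly p z:]" and q: "q = [:- z, 1:] * q1 + [:poly q z:]"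
    unfolding p1_def q1_def by (simp_all only: synthetic_div_correct')
  have "p * q = p * ([:- z, 1:] * q1) + p * [:poly q z:]"
    by (subst q) (simp only: distrib_left)
  also have "p * [:poly q z:] = ([:- z, 1:] * p1 + [:poly p z:]) * [:poly q z:]"
    by (subst p) (rule refl)
  finally have "p * q = [:- z, 1:] * (smult (poly q z) p1 + p * q1) + [:poly p z * poly q z:]"
    by (simp add: algebra_simps smult_add_right)
  then have "p * q + smult z (smult (poly q z) p1 + p * q1) = pCons (poly p z * poly q z) (smult (poly q z) p1 + p * q1)"
    by (simp add: algebra_simps smult_add_right)
  from synthetic_div_unique[OF this] show ?thesis by (simp add: p1_def q1_def)
qed

lemma has_bochner_integral_poly:
  fixes p :: "complex poly"
  assumes "moment_solution s m \<mu>" "degree p \<le> m"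
  shows "has_bochner_integral \<mu> (\<lambda>t. poly p (of_real t)) (moment_functional s p)"
proof -
  have "has_bochner_integral \<mu> (\<lambda>t. \<Sum>i\<le>degree p. (t ^ i) *\<^sub>R coeff p i) (\<Sum>i\<le>degree p. s i *\<^sub>R coeff p i)"
    using assms unfolding moment_solution_def
    by (intro has_bochner_integral_sum has_bochner_integral_scaleR_left) auto
  then show ?thesis
    by (simp add: moment_functional_def poly_altdef scaleR_conv_of_real mult.commute)
qed

text \<open>p may exceed the available moments by one degree: p(t) / (t - z) is p(z) / (t - z) plus
  the difference quotient, whose degree is at most m.\<close>

lemma has_bochner_integral_poly_divide:
  fixes p :: "complex poly"
  assumes \<mu>: "moment_solution s m \<mu>" and p: "degree p \<le> m + 1" and z: "z \<notin> \<real>"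
    and \<phi>: "has_bochner_integral \<mu> (\<lambda>t. 1 / (of_real t - z)) \<phi>"
  shows "has_bochner_integral \<mu> (\<lambda>t. poly p (of_real t) / (of_real t - z))
    (poly p z * \<phi> + moment_functional s (synthetic_div p z))"
proof -
  have "has_bochner_integral \<mu> (\<lambda>t. poly p z * (1 / (of_real t - z)) + poly (synthetic_div p z) (of_real t))
     (poly p z * \<phi> + moment_functional s (synthetic_div p z))"
    using p by (intro has_bochner_integral_add has_bochner_integral_mult_right \<phi>
      has_bochner_integral_poly[OF \<mu>]) (simp add: degree_synthetic_div)
  moreover have "poly p z * (1 / (of_real t - z)) + poly (synthetic_div p z) (of_real t) = poly p (of_real t) / (of_real t - z)" for t
  proof -
    have "of_real t - z \<noteq> 0" using z by auto
    then show ?thesis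
      by (subst (2) poly_synthetic_div[of _ _ z]) (simp add: add_divide_distrib)
  qed
  ultimately show ?thesis by simp
qed

text \<open>Put a = N(t) / (t - z) and b = R(t), so that a - b = N(z) / (t - z). Then |a|^2 = |a -
  b|^2 - |b|^2 + 2 Re (a cnj b). The first term integrates to |N(z)|^2 Im \<phi> / Im z, the second
  is given by the moments, and the cross term integrates to 0. The assumption \<open>zero\<close> is
  the linear fractional relation with the division cleared.\<close>

lemma stieltjes_norm_square:
  fixes N :: "complex poly" and z :: complex
  defines "R \<equiv> synthetic_div N z"
  assumes \<mu>: "moment_solution s (2 * n) \<mu>" and N: "degree N \<le> n + 1"
    and orth: "\<And>q. q = 0 \<or> degree q < n \<Longrightarrow> moment_functional s (N * q) = 0"
    and z: "z \<notin> \<real>" and \<phi>: "has_bochner_integral \<mu> (\<lambda>t. 1 / (of_real t - z)) \<phi>"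
    and zero: "poly N z * \<phi> + moment_functional s R = 0"
  shows "has_bochner_integral \<mu> (\<lambda>t. (norm (poly N (of_real t) / (of_real t - z)))\<^sup>2)
    (Im (moment_functional s (N * map_poly cnj R)) / Im z)"
proof -
  define R' where "R' = map_poly cnj R"
  have degR: "degree R \<le> n" unfolding R_def using N by (simp add: degree_synthetic_div)
  have R't: "poly R' (of_real t) = cnj (poly R (of_real t))" for t
    by (simp add: R'_def poly_map_poly_cnj)
  have Imz: "Im z \<noteq> 0" using z by (simp add: complex_is_Real_iff)
  \<comment> \<open>One more than the order of the available moments; the division by t - z makes up
    for it.\<close>
  have "degree (N * R') \<le> 2 * n + 1"
    using degree_mult_le[of N R'] N degR by (simp add: R'_def)
  then have "has_bochner_integral \<mu> (\<lambda>t. poly (N * R') (of_real t) / (of_real t - z))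
    (poly (N * R') z * \<phi> + moment_functional s (synthetic_div (N * R') z))"
    by (intro has_bochner_integral_poly_divide[OF \<mu> _ z \<phi>])
  \<comment> \<open>The product rule splits off N times the quotient of \<open>R'\<close>, which
    orthogonality removes; what stays is a multiple of \<open>zero\<close>. For n = 0 no degree is
    below n, and the alternative \<open>q = 0\<close> applies.\<close>
  moreover have "poly (N * R') z * \<phi> + moment_functional s (synthetic_div (N * R') z) = 0"
  proof -
    have "synthetic_div R' z = 0 \<or> degree (synthetic_div R' z) < n"
      using degR by (cases "degree R' = 0") (auto simp: synthetic_div_eq_0_iff degree_synthetic_div R'_def)
    from orth[OF this] have "moment_functional s (synthetic_div (N * R') z) = poly R' z * moment_functional s R"
      by (simp add: synthetic_div_mult moment_functional_add moment_functional_smult R_def)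
    then have "poly (N * R') z * \<phi> + moment_functional s (synthetic_div (N * R') z) = poly R' z * (poly N z * \<phi> + moment_functional s R)"
      by (simp add: algebra_simps)
    then show ?thesis using zero by simp
  qed
  ultimately have 1: "has_bochner_integral \<mu> (\<lambda>t. poly (N * R') (of_real t) / (of_real t - z)) 0"
    by simp
  have "degree (R * R') \<le> 2 * n"
    using degree_mult_le[of R R'] degR by (simp add: R'_def)
  then have 2: "has_bochner_integral \<mu> (\<lambda>t. poly (R * R') (of_real t)) (moment_functional s (R * R'))"
    by (rule has_bochner_integral_poly[OF \<mu>])
  have nz: "of_real t - z \<noteq> 0" for t using z by auto
  have "has_bochner_integral \<mu> (\<lambda>t. (norm (poly N z))\<^sup>2 * (Im (1 / (of_real t - z)) / Im z) - Re (poly (R * R') (of_real t))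
       + 2 * Re (poly (N * R') (of_real t) / (of_real t - z)))
     ((norm (poly N z))\<^sup>2 * (Im \<phi> / Im z) - Re (moment_functional s (R * R')) + 2 * Re 0)"
    by (intro has_bochner_integral_add has_bochner_integral_diff has_bochner_integral_mult_right
       has_bochner_integral_divide_zero has_bochner_integral_Im has_bochner_integral_Re \<phi> 1 2)
  moreover have "(norm (poly N z))\<^sup>2 * (Im (1 / (of_real t - z)) / Im z) - Re (poly (R * R') (of_real t))
       + 2 * Re (poly (N * R') (of_real t) / (of_real t - z)) = (norm (poly N (of_real t) / (of_real t - z)))\<^sup>2" for t
  proof -
    define a where "a = poly N (of_real t) / (of_real t - z)"
    define b where "b = poly R (of_real t)"
    have "poly N z / (of_real t - z) = a - b"
      unfolding a_def b_def poly_synthetic_div[of N "of_real t" z] R_def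
      using nz[of t] by (simp add: add_divide_distrib)
    then have "(norm (poly N z))\<^sup>2 / (norm (of_real t - z))\<^sup>2 = (norm (a - b))\<^sup>2"
      by (metis norm_divide power_divide)
    also have "\<dots> = (norm a)\<^sup>2 + (norm b)\<^sup>2 - 2 * Re (a * cnj b)"
      unfolding cmod_power2 by (simp add: power2_eq_square algebra_simps)
    finally have e: "(norm (poly N z))\<^sup>2 / (norm (of_real t - z))\<^sup>2 = (norm a)\<^sup>2 + (norm b)\<^sup>2 - 2 * Re (a * cnj b)" .
    have "Im (1 / (of_real t - z)) / Im z = 1 / (norm (of_real t - z))\<^sup>2"
      using Imz unfolding Im_divide cmod_power2 by simp
    moreover have "Re (poly (R * R') (of_real t)) = (norm b)\<^sup>2"
      unfolding b_def cmod_power2 by (simp add: R't power2_eq_square)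
    moreover have "poly (N * R') (of_real t) / (of_real t - z) = a * cnj b"
      by (simp add: a_def b_def R't)
    ultimately show ?thesis using e by (simp add: a_def[symmetric])
  qed
  moreover have "(norm (poly N z))\<^sup>2 * (Im \<phi> / Im z) - Re (moment_functional s (R * R')) + 2 * Re 0 =
     Im (moment_functional s (N * R')) / Im z"
  proof -
    have "moment_functional s R = - (poly N z * \<phi>)"
      using zero by (simp add: add_eq_0_iff)
    then have "poly N z * cnj (moment_functional s R) = - (poly N z * cnj (poly N z)) * cnj \<phi>" by simp
    also have "poly N z * cnj (poly N z) = of_real ((norm (poly N z))\<^sup>2)" by (rule complex_norm_square[symmetric])
    finally have "Im (poly N z * cnj (moment_functional s R)) = (norm (poly N z))\<^sup>2 * Im \<phi>" by simp
    then have "Im (moment_functional s (N * R')) = (norm (poly N z))\<^sup>2 * Im \<phi> - Im z * Re (moment_functional s (R * R'))"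
      using im_moment_identity[of s N z] by (simp add: R_def R'_def)
    then show ?thesis using Imz by (simp add: diff_divide_distrib)
  qed
  ultimately show ?thesis by (simp only: R'_def[symmetric])
qed

section \<open>The linear fractional transformation built from \<open>P\<close> and
  \<open>P'\<close>\<close>

locale hamburger_data =
  fixes s :: "nat \<Rightarrow> real" and n :: nat and P P' :: "real poly"
  assumes pos: "hankel_pos_def s n" and P: "orthonormal_poly s n P" and P': "orthogonal_poly s (n + 1) P'"
begin

definition h :: real where "h = moment_functional s (P * monom 1 n)"
definition a :: real where "a = lead_coeff P'"

text \<open>With \<open>c = \<tau> z\<close>, \<open>den c\<close> evaluated at \<open>z\<close> is the denominator of \<open>lin_frac\<close>, and the moment
  functional of \<open>num c z\<close> is its numerator, up to the sign.\<close>

definition den :: "complex \<Rightarrow> complex poly" where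
  "den c = smult c (map_poly of_real P) + map_poly of_real P'"

definition num :: "complex \<Rightarrow> complex \<Rightarrow> complex poly" where
  "num c z = synthetic_div (den c) z"

lemma degs [simp]: "degree P = n" "degree P' = n + 1"
  using P P' by (auto simp: orthonormal_poly_def orthogonal_poly_def)

lemma a_pos: "0 < a"
  using P' by (simp add: a_def orthogonal_poly_def)

text \<open>In S(P^2) = 1 only the leading term of the second factor counts, so h is the reciprocal
  of the leading coefficient of P.\<close>

lemma h_pos: "0 < h"
proof -
  have o: "orthogonal_poly s n P" using P by (simp add: orthonormal_poly_def)
  have "complex_of_real 1 = moment_functional s (map_poly of_real (P ^ 2))"
    using P unfolding orthonormal_poly_def by (simp add: moment_functional_of_real)
  also have "\<dots> = moment_functional s (map_poly of_real P * map_poly of_real P)"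
    by (simp add: power2_eq_square map_poly_of_real_mult)
  also have "\<dots> = of_real h * coeff (map_poly of_real P) n"
    by (subst orthogonal_poly_mult[OF o]) (simp_all add: h_def)
  also have "\<dots> = of_real (h * lead_coeff P)" by (simp add: coeff_map_poly)
  finally have "h * lead_coeff P = 1" by (metis of_real_eq_iff)
  moreover have "0 < lead_coeff P" using o by (simp add: orthogonal_poly_def)
  ultimately show ?thesis by (metis zero_less_mult_pos2 zero_less_one)
qed

lemma s0_pos: "0 < s 0"
proof -
  have "0 < (\<Sum>i\<le>n. \<Sum>j\<le>n. s (i + j) * (if i = 0 then 1 else 0) * (if j = 0 then 1 else 0))"
    using pos unfolding hankel_pos_def_def by (elim allE[of _ "\<lambda>i. if i = 0 then 1 else 0"]) auto
  also have "\<dots> = (\<Sum>i\<in>{0}. \<Sum>j\<in>{0}. s (i + j))"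
    by (intro sum.mono_neutral_cong_right sum.neutral) (auto intro!: sum.mono_neutral_cong_right)
  finally show ?thesis by simp
qed

lemma degree_den: "degree (den c) \<le> n + 1"
  unfolding den_def by (intro degree_add_le) auto

lemma poly_den: "poly (den c) z = cpoly P z * c + cpoly P' z"
  by (simp add: den_def cpoly_def)

lemma moment_num: "moment_functional s (num c z) = second_kind s P z * c + second_kind s P' z"
  by (simp add: num_def den_def synthetic_div_smult_add moment_functional_add moment_functional_smult second_kind_eq)

lemma degree_num: "degree (num c z) \<le> n"
  using degree_den[of c] by (simp add: num_def degree_synthetic_div)

text \<open>A difference quotient inherits the leading coefficient, and in \<open>den c\<close> the
  number c multiplies a polynomial of degree n only. Independence of c and z produces the constant
  \<open>h * a\<close> in \<open>moment_den_num\<close>, and a > 0 shows that \<open>num c z\<close>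
  is never 0.\<close>

lemma coeff_num: "coeff (num c z) n = of_real a"
proof -
  have "coeff (num c z) n = coeff (den c + smult z (num c z)) (n + 1)"
    unfolding num_def by (subst synthetic_div_correct) simp
  also have "\<dots> = of_real a"
    using degree_num[of c z] by (simp add: den_def coeff_map_poly coeff_eq_0 a_def)
  finally show ?thesis .
qed

lemma orth_P: "degree q \<le> n \<Longrightarrow> moment_functional s (map_poly of_real P * q) = of_real h * coeff q n" for q :: "complex poly"
  using orthogonal_poly_mult[of s n P q] P by (simp add: orthonormal_poly_def h_def)

lemma orth_P': "degree q \<le> n \<Longrightarrow> moment_functional s (map_poly of_real P' * q) = 0" for q :: "complex poly"
  using orthogonal_poly_mult[OF P', of q] by (simp add: coeff_eq_0)

lemma orth_den: "degree q \<le> n \<Longrightarrow> moment_functional s (den c * q) = c * of_real h * coeff q n"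
  by (simp add: den_def distrib_right moment_functional_add moment_functional_smult orth_P orth_P')

lemma moment_den_num: "moment_functional s (den c * map_poly cnj (num c z)) = c * of_real (h * a)"
  using degree_num[of c z] by (simp add: orth_den coeff_map_poly coeff_num)

lemma den_num_im:
  "Im (poly (den c) z * cnj (moment_functional s (num c z))) =
     h * a * Im c + Im z * Re (moment_functional s (num c z * map_poly cnj (num c z)))"
  using im_moment_identity[of s "den c" z] unfolding num_def[symmetric] moment_den_num
  by (simp add: mult.commute)

lemma lin_frac_eq: "lin_frac s P P' \<tau> z = - (moment_functional s (num (\<tau> z) z) / poly (den (\<tau> z)) z)"
  by (simp add: lin_frac_def moment_num poly_den)

text \<open>The inequality is strict even for real c, because the Hankel form is positive at
  \<open>num c z\<close>; so the denominator has no zeros in the upper half-plane.\<close>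

lemma den_num_im_pos:
  assumes "0 \<le> Im c" "0 < Im z"
  shows "0 < Im (poly (den c) z * cnj (moment_functional s (num c z)))"
proof -
  have "num c z \<noteq> 0" using coeff_num[of c z] a_pos by auto
  then show ?thesis
    using hankel_pos(2)[OF pos degree_num] assms h_pos a_pos
    unfolding den_num_im by (intro add_nonneg_pos mult_nonneg_nonneg mult_pos_pos) auto
qed

lemma den_nonzero: "0 \<le> Im c \<Longrightarrow> 0 < Im z \<Longrightarrow> poly (den c) z \<noteq> 0"
  using den_num_im_pos[of c z] by auto

lemma lin_frac_Im:
  assumes "0 \<le> Im (\<tau> z)" "0 < Im z"
  shows "0 < Im (lin_frac s P P' \<tau> z)"
proof -
  define d where "d = poly (den (\<tau> z)) z"
  define k where "k = moment_functional s (num (\<tau> z) z)"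
  have d: "d \<noteq> 0" using den_nonzero assms by (simp add: d_def)
  have "Im (- (k / d)) = Im (d * cnj k) / (norm d)\<^sup>2"
    unfolding complex_div_cnj[of k d] by (simp add: Im_divide_of_real cmod_power2) (simp add: minus_divide_left)
  also have "\<dots> > 0" using den_num_im_pos[OF assms] d by (simp add: d_def k_def)
  finally show ?thesis by (simp add: lin_frac_eq d_def k_def)
qed

lemma cross_zero_iff:
  assumes "poly (den c) z \<noteq> 0"
  shows "poly (den c) z * w + moment_functional s (num c z) = 0 \<longleftrightarrow> w = - (moment_functional s (num c z) / poly (den c) z)"
proof -
  have "w = - (k / d) \<longleftrightarrow> d * w + k = 0" if "d \<noteq> 0" for d k
  proof -
    have "w = - (k / d) \<longleftrightarrow> w * d = - k"
      unfolding minus_divide_left using that by (rule nonzero_eq_divide_eq)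
    also have "\<dots> \<longleftrightarrow> d * w + k = 0" by (simp only: eq_neg_iff_add_eq_0 mult.commute[of w d])
    finally show ?thesis .
  qed
  from this[OF assms] show ?thesis by blast
qed

text \<open>This expression is the coefficient of \<tau>(z) in the relation that determines
  \<tau>(z). If it vanished, \<open>stieltjes_norm_square\<close> with N = P would give |P(t) / (t -
  z)|^2 the integral 0, because the quotient of P has no term t^n. Then P = 0 almost everywhere,
  against S(P^2) = 1.\<close>

lemma second_den_nonzero:
  assumes \<mu>: "moment_solution s (2 * n) \<mu>" and z: "z \<notin> \<real>" and \<phi>: "has_bochner_integral \<mu> (\<lambda>t. 1 / (of_real t - z)) \<phi>"
  shows "cpoly P z * \<phi> + second_kind s P z \<noteq> 0"
proof
  assume zero: "cpoly P z * \<phi> + second_kind s P z = 0"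
  define N where "N = (map_poly of_real P :: complex poly)"
  define R where "R = synthetic_div N z"
  have R: "degree R \<le> n" "coeff R n = 0"
  proof -
    show "degree R \<le> n" by (simp add: R_def degree_synthetic_div N_def)
    show "coeff R n = 0"
    proof (cases "n = 0")
      case True
      then have "R = 0" by (simp add: R_def synthetic_div_eq_0_iff N_def)
      then show ?thesis by simp
    next
      case False
      then have "degree R < n" by (simp add: R_def degree_synthetic_div N_def)
      then show ?thesis by (rule coeff_eq_0)
    qed
  qed
  have "moment_functional s (N * q) = 0" if "q = 0 \<or> degree q < n" for q :: "complex poly"
    using that orth_P[of q] by (auto simp: N_def coeff_eq_0)
  moreover have "poly N z * \<phi> + moment_functional s (synthetic_div N z) = 0"
    using zero by (simp add: N_def cpoly_def second_kind_eq)
  ultimately have "has_bochner_integral \<mu> (\<lambda>t. (norm (poly N (of_real t) / (of_real t - z)))\<^sup>2)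
      (Im (moment_functional s (N * map_poly cnj R)) / Im z)"
    unfolding R_def by (intro stieltjes_norm_square[OF \<mu> _ _ z \<phi>]) (auto simp: N_def)
  moreover have "moment_functional s (N * map_poly cnj R) = 0"
    using R by (simp add: N_def orth_P coeff_map_poly)
  ultimately have 0: "has_bochner_integral \<mu> (\<lambda>t. (norm (poly N (of_real t) / (of_real t - z)))\<^sup>2) 0" by simp
  have "AE t in \<mu>. (norm (poly N (of_real t) / (of_real t - z)))\<^sup>2 = 0"
    using 0 by (subst integral_nonneg_eq_0_iff_AE[symmetric]) (auto simp: has_bochner_integral_iff)
  then have AE: "AE t in \<mu>. poly (map_poly of_real (P ^ 2)) (complex_of_real t) = 0"
  proof eventually_elim
    case (elim t)
    have "of_real t - z \<noteq> 0" using z by auto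
    then have "poly N (of_real t) = 0" using elim by simp
    then show ?case by (simp add: N_def power2_eq_square map_poly_of_real_mult)
  qed
  have "has_bochner_integral \<mu> (\<lambda>t. poly (map_poly of_real (P ^ 2)) (complex_of_real t)) (moment_functional s (map_poly of_real (P ^ 2)))"
    by (rule has_bochner_integral_poly[OF \<mu>]) (simp add: degree_power_eq degree_map_poly order.trans[OF degree_power_le])
  moreover have "moment_functional s (map_poly of_real (P ^ 2)) = (1 :: complex)"
    using P by (simp add: moment_functional_of_real orthonormal_poly_def)
  ultimately have "(\<integral>t. poly (map_poly of_real (P ^ 2)) (complex_of_real t) \<partial>\<mu>) = 1"
    by (simp add: has_bochner_integral_iff)
  moreover have "(\<integral>t. poly (map_poly of_real (P ^ 2)) (complex_of_real t) \<partial>\<mu>) = 0"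
    using AE by (rule integral_eq_zero_AE)
  ultimately show False by simp
qed

lemma tau_Im:
  assumes \<mu>: "moment_solution s (2 * n) \<mu>" and z: "z \<notin> \<real>" and \<phi>: "has_bochner_integral \<mu> (\<lambda>t. 1 / (of_real t - z)) \<phi>"
    and zero: "poly (den c) z * \<phi> + moment_functional s (num c z) = 0"
  shows "has_bochner_integral \<mu> (\<lambda>t. (norm (poly (den c) (of_real t) / (of_real t - z)))\<^sup>2) (h * a * Im c / Im z)"
proof -
  have "moment_functional s (den c * q) = 0" if "q = 0 \<or> degree q < n" for q :: "complex poly"
    using that by (auto simp: orth_den coeff_eq_0)
  then have "has_bochner_integral \<mu> (\<lambda>t. (norm (poly (den c) (of_real t) / (of_real t - z)))\<^sup>2)
      (Im (moment_functional s (den c * map_poly cnj (num c z))) / Im z)"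
    unfolding num_def using zero by (intro stieltjes_norm_square[OF \<mu> degree_den _ z \<phi>]) (auto simp: num_def)
  then show ?thesis by (simp add: moment_den_num mult_ac)
qed

end

section \<open>Asymptotic expansions\<close>

text \<open>The expansion of - \<phi>; with this sign the remainder is
  \<open>\<phi> z + moment_series s m z\<close>.\<close>

definition moment_series :: "(nat \<Rightarrow> real) \<Rightarrow> nat \<Rightarrow> complex \<Rightarrow> complex" where
  "moment_series s m z = (\<Sum>j\<le>m. of_real (s j) / z ^ (j + 1))"

lemma nontangential_le_at_infinity: "nontangential \<le> at_infinity"
  unfolding nontangential_def by (intro SUP_least) simp

lemma eventually_nontangential_Im_pos: "\<forall>\<^sub>F z in nontangential. 0 < Im z"
  unfolding eventually_nontangential
proof (intro allI impI exI[of _ 0])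
  fix \<delta> :: real and z assume "0 < \<delta>" "\<delta> < Arg z \<and> Arg z < pi - \<delta>"
  then show "0 < Im z" using Arg_lt_pi[of z] by auto
qed

lemma filterlim_imaginary_axis: "filterlim (\<lambda>y. \<i> * of_real y) nontangential at_top"
  unfolding filterlim_def le_filter_def eventually_filtermap eventually_nontangential
proof (intro allI impI)
  fix Q :: "complex \<Rightarrow> bool"
  assume *: "\<forall>\<delta>>0. \<exists>R. \<forall>z. R \<le> norm z \<longrightarrow> \<delta> < Arg z \<and> Arg z < pi - \<delta> \<longrightarrow> Q z"
  \<comment> \<open>Any aperture below pi / 2 would do, since the positive imaginary axis has
    argument pi / 2.\<close>
  have "0 < pi / 4" by simp
  with * obtain R where R: "\<And>z. R \<le> norm z \<Longrightarrow> pi / 4 < Arg z \<and> Arg z < pi - pi / 4 \<Longrightarrow> Q z"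
    by blast
  show "\<forall>\<^sub>F y in at_top. Q (\<i> * of_real y)"
    using eventually_ge_at_top[of "max R 1"]
  proof eventually_elim
    case (elim y)
    have "Arg (\<i> * of_real y) = pi / 2"
      using elim Arg_times_of_real2[of y \<i>] by simp
    then show ?case using elim by (intro R) (auto simp: norm_mult)
  qed
qed

lemma nontangential_neq_bot [simp]: "nontangential \<noteq> bot"
proof
  assume "nontangential = bot"
  then have "\<forall>\<^sub>F z in nontangential. False" by simp
  from eventually_compose_filterlim[OF this filterlim_imaginary_axis] show False by simp
qed

lemma inverse_power_tendsto_0:
  assumes "0 < k"
  shows "((\<lambda>z. 1 / z ^ k) \<longlongrightarrow> (0 :: 'a :: real_normed_field)) at_infinity"
proof -
  have "((\<lambda>z. inverse z ^ k) \<longlongrightarrow> (0 :: 'a) ^ k) at_infinity"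
    by (intro tendsto_power tendsto_inverse_0)
  then show ?thesis using assms by (simp add: power_one_over inverse_eq_divide power_0_left)
qed

lemma power_quotient_tendsto:
  assumes "i \<le> m"
  shows "((\<lambda>z. z ^ i / z ^ m) \<longlongrightarrow> (if i = m then 1 else (0 :: 'a :: real_normed_field))) at_infinity"
proof (rule Lim_transform_eventually)
  have nz: "\<forall>\<^sub>F z :: 'a in at_infinity. z \<noteq> 0"
    using eventually_not_equal_at_infinity .
  show "((\<lambda>z. 1 / z ^ (m - i)) \<longlongrightarrow> (if i = m then 1 else (0 :: 'a))) at_infinity"
    using inverse_power_tendsto_0[of "m - i"] assms by auto
  show "\<forall>\<^sub>F z :: 'a in at_infinity. 1 / z ^ (m - i) = z ^ i / z ^ m"
    using nz by eventually_elim (use assms in \<open>simp add: power_diff\<close>)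
qed

lemma poly_quotient_tendsto:
  fixes p :: "'a :: real_normed_field poly"
  assumes "degree p \<le> m"
  shows "((\<lambda>z. poly p z / z ^ m) \<longlongrightarrow> coeff p m) at_infinity"
proof -
  have "((\<lambda>z. \<Sum>i\<le>m. coeff p i * (z ^ i / z ^ m)) \<longlongrightarrow> (\<Sum>i\<le>m. coeff p i * (if i = m then 1 else 0))) at_infinity"
    by (intro tendsto_sum tendsto_mult tendsto_const power_quotient_tendsto) auto
  moreover have "(\<Sum>i\<le>m. coeff p i * (if i = m then 1 else 0)) = coeff p m"
    by (subst sum.mono_neutral_right[of _ "{m}"]) auto
  moreover have "(\<Sum>i\<le>m. coeff p i * (z ^ i / z ^ m)) = poly p z / z ^ m" for z
  proof -
    have "poly p z = (\<Sum>i\<le>m. coeff p i * z ^ i)"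
      unfolding poly_altdef using assms by (intro sum.mono_neutral_left) (auto simp: coeff_eq_0)
    then show ?thesis by (simp add: sum_divide_distrib)
  qed
  ultimately show ?thesis by simp
qed

lemma moment_series_Suc:
  assumes "z \<noteq> 0"
  shows "z * moment_series s (Suc m) z = s 0 + moment_series (\<lambda>i. s (Suc i)) m z"
  unfolding moment_series_def using assms
  by (simp add: sum.atMost_Suc_shift sum_distrib_left distrib_left del: sum.atMost_Suc)

lemma moment_series_tail:
  assumes "m \<le> M"
  shows "((\<lambda>z. z ^ (m + 1) * (moment_series s M z - moment_series s m z)) \<longlongrightarrow> 0) at_infinity"
proof (rule Lim_transform_eventually)
  have "((\<lambda>z. \<Sum>j\<in>{m<..M}. of_real (s j) * (1 / z ^ (j - m))) \<longlongrightarrow> (\<Sum>j\<in>{m<..M}. of_real (s j) * (0 :: complex))) at_infinity"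
    by (intro tendsto_sum tendsto_mult tendsto_const inverse_power_tendsto_0) auto
  then show "((\<lambda>z. \<Sum>j\<in>{m<..M}. of_real (s j) * (1 / z ^ (j - m))) \<longlongrightarrow> (0 :: complex)) at_infinity" by simp
  show "\<forall>\<^sub>F z in at_infinity. (\<Sum>j\<in>{m<..M}. of_real (s j) * (1 / z ^ (j - m))) =
      z ^ (m + 1) * (moment_series s M z - moment_series s m z)"
    using eventually_not_equal_at_infinity[of 0]
  proof eventually_elim
    case (elim z)
    have "{..M} = {..m} \<union> {m<..M}" using assms by auto
    then have "moment_series s M z = moment_series s m z + (\<Sum>j\<in>{m<..M}. of_real (s j) / z ^ (j + 1))"
      unfolding moment_series_def by (simp only:) (rule sum.union_disjoint, auto)
    then have "z ^ (m + 1) * (moment_series s M z - moment_series s m z) = (\<Sum>j\<in>{m<..M}. z ^ (m + 1) * (of_real (s j) / z ^ (j + 1)))"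
      by (simp add: sum_distrib_left)
    also have "\<dots> = (\<Sum>j\<in>{m<..M}. of_real (s j) * (1 / z ^ (j - m)))"
    proof (rule sum.cong)
      fix j assume "j \<in> {m<..M}"
      then have "j + 1 = (m + 1) + (j - m)" by auto
      then have "z ^ (j + 1) = z ^ (m + 1) * z ^ (j - m)" by (metis power_add)
      then show "z ^ (m + 1) * (of_real (s j) / z ^ (j + 1)) = of_real (s j) * (1 / z ^ (j - m))"
        using elim by simp
    qed simp
    finally show ?case by simp
  qed
qed

text \<open>In the product of P with the series, \<open>second_kind\<close> is the polynomial part
  and the coefficient of z^(-i-1) is S(P t^i). The induction multiplies the series by z, which
  splits off \<open>s 0\<close> and shifts the moments. Each degree of P costs one term of the
  series, hence \<open>degree P + m \<le> M\<close>.\<close>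

lemma cpoly_moment_series:
  assumes "P = 0 \<or> degree P + m \<le> M"
  shows "((\<lambda>z. z ^ (m + 1) * (cpoly P z * moment_series s M z - second_kind s P z -
    moment_series (\<lambda>i. moment_functional s (P * monom 1 i)) m z)) \<longlongrightarrow> 0) at_infinity"
  using assms
proof (induction P arbitrary: s M)
  case 0
  show ?case by (simp add: cpoly_def moment_series_def)
next
  case (pCons a P)
  define s' where "s' = (\<lambda>i. s (Suc i))"
  define T where "T = (\<lambda>i. moment_functional s' (P * monom 1 i))"
  have mM: "m \<le> M" and PM: "P \<noteq> 0 \<Longrightarrow> \<exists>M'. M = Suc M' \<and> degree P + m \<le> M'"
  proof -
    have "pCons a P \<noteq> 0" using pCons.hyps by auto
    then show "m \<le> M" using pCons.prems by (auto split: if_splits)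
    assume "P \<noteq> 0"
    then show "\<exists>M'. M = Suc M' \<and> degree P + m \<le> M'"
      using pCons.prems by (intro exI[of _ "M - 1"]) auto
  qed
  have "moment_functional s (pCons a P * monom 1 i) = a * s i + T i" for i
  proof -
    have "pCons a P * monom 1 i = smult a (monom 1 i) + pCons 0 (P * monom 1 i)" by simp
    moreover have "moment_functional s (monom 1 i :: real poly) = s i"
      by (simp add: moment_functional_monom)
    ultimately show ?thesis
      by (simp only: moment_functional_add moment_functional_smult moment_functional_pCons T_def s'_def) simp
  qed
  then have eq: "moment_series (\<lambda>i. moment_functional s (pCons a P * monom 1 i)) m z =
      a * moment_series s m z + moment_series T m z" for z
    by (simp add: moment_series_def sum_distrib_left sum.distrib[symmetric] add_divide_distrib)
  have 1: "((\<lambda>z. of_real a * (z ^ (m + 1) * (moment_series s M z - moment_series s m z))) \<longlongrightarrow> of_real a * 0) at_infinity"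
    by (intro tendsto_mult tendsto_const moment_series_tail mM)
  have 2: "((\<lambda>z. z ^ (m + 1) * (cpoly P z * (z * moment_series s M z - s 0) - second_kind s' P z - moment_series T m z)) \<longlongrightarrow> 0) at_infinity"
  proof (cases "P = 0")
    case True
    then show ?thesis by (simp add: cpoly_def T_def moment_series_def)
  next
    case False
    then obtain M' where M': "M = Suc M'" "degree P + m \<le> M'" using PM by blast
    have "((\<lambda>z. z ^ (m + 1) * (cpoly P z * moment_series s' M' z - second_kind s' P z - moment_series T m z)) \<longlongrightarrow> 0) at_infinity"
      unfolding T_def using M' by (intro pCons.IH) auto
    then show ?thesis
    proof (rule Lim_transform_eventually)
      show "\<forall>\<^sub>F z in at_infinity. z ^ (m + 1) * (cpoly P z * moment_series s' M' z - second_kind s' P z - moment_series T m z) =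
          z ^ (m + 1) * (cpoly P z * (z * moment_series s M z - s 0) - second_kind s' P z - moment_series T m z)"
        using eventually_not_equal_at_infinity[of 0]
        by eventually_elim (simp add: M'(1) moment_series_Suc s'_def)
    qed
  qed
  have "((\<lambda>z. of_real a * (z ^ (m + 1) * (moment_series s M z - moment_series s m z)) +
     z ^ (m + 1) * (cpoly P z * (z * moment_series s M z - s 0) - second_kind s' P z - moment_series T m z)) \<longlongrightarrow> of_real a * 0 + 0) at_infinity"
    by (intro tendsto_add 1 2)
  moreover have "of_real a * (z ^ (m + 1) * (moment_series s M z - moment_series s m z)) +
     z ^ (m + 1) * (cpoly P z * (z * moment_series s M z - s 0) - second_kind s' P z - moment_series T m z) =
     z ^ (m + 1) * (cpoly (pCons a P) z * moment_series s M z - second_kind s (pCons a P) z -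
       moment_series (\<lambda>i. moment_functional s (pCons a P * monom 1 i)) m z)" for z
    unfolding eq cpoly_pCons second_kind_pCons s'_def[symmetric] by (simp add: algebra_simps)
  ultimately show ?case by simp
qed

lemma nevanlinna_asymp_iff:
  "\<phi> \<in> nevanlinna_asymp s m \<longleftrightarrow> \<phi> \<in> nevanlinna \<and>
    ((\<lambda>z. z ^ (m + 1) * (\<phi> z + moment_series s m z)) \<longlongrightarrow> 0) nontangential"
proof -
  have nz: "\<forall>\<^sub>F z in nontangential. 1 / z ^ (m + 1) \<noteq> 0"
    using eventually_nontangential_Im_pos by eventually_elim auto
  have "(\<lambda>z. \<phi> z - (\<Sum>j\<le>m. - (of_real (s j) / z ^ (j + 1)))) \<in> o[nontangential](\<lambda>z. 1 / z ^ (m + 1)) \<longleftrightarrow>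
     ((\<lambda>z. (\<phi> z - (\<Sum>j\<le>m. - (of_real (s j) / z ^ (j + 1)))) / (1 / z ^ (m + 1))) \<longlongrightarrow> 0) nontangential"
    by (rule iffI, erule smalloD_tendsto, erule smalloI_tendsto[OF _ nz])
  also have "(\<lambda>z. (\<phi> z - (\<Sum>j\<le>m. - (of_real (s j) / z ^ (j + 1)))) / (1 / z ^ (m + 1))) =
      (\<lambda>z. z ^ (m + 1) * (\<phi> z + moment_series s m z))"
    by (simp add: moment_series_def sum_negf mult.commute)
  finally show ?thesis by (simp add: nevanlinna_asymp_def)
qed

lemma smallo_1_iff: "f \<in> o[F](\<lambda>_. 1) \<longleftrightarrow> (f \<longlongrightarrow> 0) F"
  for f :: "'a \<Rightarrow> 'b :: real_normed_field"
proof
  show "f \<in> o[F](\<lambda>_. 1) \<Longrightarrow> (f \<longlongrightarrow> 0) F" by (drule smalloD_tendsto) simp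
  show "(f \<longlongrightarrow> 0) F \<Longrightarrow> f \<in> o[F](\<lambda>_. 1)" by (rule smalloI_tendsto) simp_all
qed

section \<open>The linear fractional transformation at infinity\<close>

context hamburger_data
begin

text \<open>By orthogonality the first coefficient that survives for \<open>P\<close> is h, at order
  n + 1, and up to that order none survives for \<open>P'\<close>. The second claim concerns a
  polynomial of degree n + 1 and n + 1 coefficients, which uses up exactly the moments of order 0 to
  2n + 1.\<close>

lemma P_series: "((\<lambda>z. z ^ (n + 1) * (cpoly P z * moment_series s (2 * n + 1) z - second_kind s P z)) \<longlongrightarrow> of_real h) at_infinity"
  and P'_series: "((\<lambda>z. z ^ (n + 1) * (cpoly P' z * moment_series s (2 * n + 1) z - second_kind s P' z)) \<longlongrightarrow> 0) at_infinity"
proof -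
  have m: "moment_functional s (P * monom 1 i) = (if i = n then h else 0)" if "i \<le> n" for i
    using P that by (auto simp: h_def orthonormal_poly_def orthogonal_poly_def)
  have 1: "moment_series (\<lambda>i. moment_functional s (P * monom 1 i)) n z = of_real h / z ^ (n + 1)" for z
    unfolding moment_series_def
    by (subst sum.mono_neutral_cong_right[of _ "{n}" _ "\<lambda>i. of_real h / z ^ (i + 1)"]) (auto simp: m)
  have 2: "moment_series (\<lambda>i. moment_functional s (P' * monom 1 i)) n z = 0" for z
    unfolding moment_series_def using P' by (intro sum.neutral) (auto simp: orthogonal_poly_def)
  show "((\<lambda>z. z ^ (n + 1) * (cpoly P' z * moment_series s (2 * n + 1) z - second_kind s P' z)) \<longlongrightarrow> 0) at_infinity"
    using cpoly_moment_series[of P' n "2 * n + 1" s] by (simp add: 2)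
  have "((\<lambda>z. z ^ (n + 1) * (cpoly P z * moment_series s (2 * n + 1) z - second_kind s P z - of_real h / z ^ (n + 1)) + of_real h) \<longlongrightarrow> 0 + of_real h) at_infinity"
    using cpoly_moment_series[of P n "2 * n + 1" s] unfolding 1 by (intro tendsto_add tendsto_const) simp
  then have "((\<lambda>z. z ^ (n + 1) * (cpoly P z * moment_series s (2 * n + 1) z - second_kind s P z - of_real h / z ^ (n + 1)) + of_real h) \<longlongrightarrow> of_real h) at_infinity"
    by simp
  then show "((\<lambda>z. z ^ (n + 1) * (cpoly P z * moment_series s (2 * n + 1) z - second_kind s P z)) \<longlongrightarrow> of_real h) at_infinity"
  proof (rule Lim_transform_eventually)
    show "\<forall>\<^sub>F z in at_infinity. z ^ (n + 1) * (cpoly P z * moment_series s (2 * n + 1) z - second_kind s P z - of_real h / z ^ (n + 1)) + of_real h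
       = z ^ (n + 1) * (cpoly P z * moment_series s (2 * n + 1) z - second_kind s P z)"
      using eventually_not_equal_at_infinity[of 0] by eventually_elim (simp add: right_diff_distrib)
  qed
qed

lemma P_quotient: "((\<lambda>z. cpoly P z / z ^ (n + 1)) \<longlongrightarrow> 0) at_infinity"
  and P'_quotient: "((\<lambda>z. cpoly P' z / z ^ (n + 1)) \<longlongrightarrow> of_real a) at_infinity"
  using poly_quotient_tendsto[of "map_poly of_real P :: complex poly" "n + 1"]
    poly_quotient_tendsto[of "map_poly of_real P' :: complex poly" "n + 1"]
  by (simp_all add: cpoly_def[abs_def] coeff_map_poly coeff_eq_0 a_def)

text \<open>Write P \<phi> + Q = P (\<phi> + series) - (P series - Q) and scale by z^(n + 1). The
  first term tends to 0 because P / z^(n + 1) stays bounded, and the rest tends to - h by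
  \<open>P_series\<close>; for \<open>P'\<close> the limit is 0. \<tau> is minus the quotient of the
  expression for \<open>P'\<close> by the one for \<open>P\<close>, and h is nonzero.\<close>

lemma tau_tendsto_0:
  assumes \<phi>: "((\<lambda>z. z ^ (2 * n + 1 + 1) * (\<phi> z + moment_series s (2 * n + 1) z)) \<longlongrightarrow> 0) nontangential"
    and zero: "\<forall>\<^sub>F z in nontangential. poly (den (\<tau> z)) z * \<phi> z + moment_functional s (num (\<tau> z) z) = 0"
  shows "(\<tau> \<longlongrightarrow> 0) nontangential"
proof -
  note le = tendsto_mono[OF nontangential_le_at_infinity]
  have lim: "((\<lambda>z. z ^ (n + 1) * (cpoly p z * \<phi> z + second_kind s p z)) \<longlongrightarrow> - l) nontangential"
    if series: "((\<lambda>z. z ^ (n + 1) * (cpoly p z * moment_series s (2 * n + 1) z - second_kind s p z)) \<longlongrightarrow> l) at_infinity"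
      and quot: "((\<lambda>z. cpoly p z / z ^ (n + 1)) \<longlongrightarrow> c) at_infinity" for p l c
  proof (rule Lim_transform_eventually)
    have "((\<lambda>z. (cpoly p z / z ^ (n + 1)) * (z ^ (2 * n + 1 + 1) * (\<phi> z + moment_series s (2 * n + 1) z)) -
        z ^ (n + 1) * (cpoly p z * moment_series s (2 * n + 1) z - second_kind s p z)) \<longlongrightarrow> c * 0 - l) nontangential"
      by (intro tendsto_diff tendsto_mult le[OF series] le[OF quot] \<phi>)
    then show "((\<lambda>z. (cpoly p z / z ^ (n + 1)) * (z ^ (2 * n + 1 + 1) * (\<phi> z + moment_series s (2 * n + 1) z)) -
        z ^ (n + 1) * (cpoly p z * moment_series s (2 * n + 1) z - second_kind s p z)) \<longlongrightarrow> - l) nontangential" by simp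
    show "\<forall>\<^sub>F z in nontangential. (cpoly p z / z ^ (n + 1)) * (z ^ (2 * n + 1 + 1) * (\<phi> z + moment_series s (2 * n + 1) z)) -
        z ^ (n + 1) * (cpoly p z * moment_series s (2 * n + 1) z - second_kind s p z) =
        z ^ (n + 1) * (cpoly p z * \<phi> z + second_kind s p z)"
      using eventually_nontangential_Im_pos
    proof eventually_elim
      case (elim z)
      define w where "w = z ^ (n + 1)"
      have w: "w \<noteq> 0" using elim by (auto simp: w_def)
      have "2 * n + 1 + 1 = (n + 1) + (n + 1)" by simp
      then have ww: "z ^ (2 * n + 1 + 1) = w * w" unfolding w_def by (metis power_add)
      show ?case unfolding ww w_def[symmetric] using w by (simp add: algebra_simps)
    qed
  qed
  have "((\<lambda>z. - (z ^ (n + 1) * (cpoly P' z * \<phi> z + second_kind s P' z)) / (z ^ (n + 1) * (cpoly P z * \<phi> z + second_kind s P z))) \<longlongrightarrow> - (- 0) / (- of_real h)) nontangential"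
    using h_pos by (intro tendsto_divide tendsto_minus lim[OF P_series P_quotient] lim[OF P'_series P'_quotient]) auto
  then have "((\<lambda>z. - (z ^ (n + 1) * (cpoly P' z * \<phi> z + second_kind s P' z)) / (z ^ (n + 1) * (cpoly P z * \<phi> z + second_kind s P z))) \<longlongrightarrow> 0) nontangential"
    by simp
  moreover have "\<forall>\<^sub>F z in nontangential. z ^ (n + 1) * (cpoly P z * \<phi> z + second_kind s P z) \<noteq> 0"
    using h_pos by (intro tendsto_imp_eventually_ne[OF lim[OF P_series P_quotient]]) auto
  then have "\<forall>\<^sub>F z in nontangential. - (z ^ (n + 1) * (cpoly P' z * \<phi> z + second_kind s P' z)) / (z ^ (n + 1) * (cpoly P z * \<phi> z + second_kind s P z)) = \<tau> z"
    using zero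
  proof eventually_elim
    case (elim z)
    have "\<tau> z * (cpoly P z * \<phi> z + second_kind s P z) = - (cpoly P' z * \<phi> z + second_kind s P' z)"
      using elim(2) by (simp add: poly_den moment_num algebra_simps eq_neg_iff_add_eq_0)
    then have "- (z ^ (n + 1) * (cpoly P' z * \<phi> z + second_kind s P' z)) = \<tau> z * (z ^ (n + 1) * (cpoly P z * \<phi> z + second_kind s P z))"
      by (metis mult.left_commute mult_minus_right)
    then show ?case by (simp only: nonzero_mult_div_cancel_right[OF elim(1)])
  qed
  ultimately show ?thesis by (rule Lim_transform_eventually)
qed

text \<open>z^(2n + 2) (\<phi> + series) equals E / D, with the power shared evenly: z^(n + 1) goes
  to the numerator, which then tends to 0 by orthogonality, and z^(-n - 1) to the denominator, which
  then tends to a > 0.\<close>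

lemma lin_frac_tendsto:
  assumes \<tau>: "(\<tau> \<longlongrightarrow> 0) nontangential"
  shows "((\<lambda>z. z ^ (2 * n + 1 + 1) * (lin_frac s P P' \<tau> z + moment_series s (2 * n + 1) z)) \<longlongrightarrow> 0) nontangential"
proof -
  note le = tendsto_mono[OF nontangential_le_at_infinity]
  define D where "D z = (cpoly P z / z ^ (n + 1)) * \<tau> z + cpoly P' z / z ^ (n + 1)" for z
  define E where "E z = z ^ (n + 1) * (cpoly P z * moment_series s (2 * n + 1) z - second_kind s P z) * \<tau> z +
      z ^ (n + 1) * (cpoly P' z * moment_series s (2 * n + 1) z - second_kind s P' z)" for z
  have D: "(D \<longlongrightarrow> 0 * 0 + of_real a) nontangential"
    unfolding D_def by (intro tendsto_add tendsto_mult le[OF P_quotient] le[OF P'_quotient] \<tau>)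
  have "(E \<longlongrightarrow> of_real h * 0 + 0) nontangential"
    unfolding E_def by (intro tendsto_add tendsto_mult le[OF P_series] le[OF P'_series] \<tau>)
  then have "((\<lambda>z. E z / D z) \<longlongrightarrow> (of_real h * 0 + 0) / (0 * 0 + of_real a)) nontangential"
    using a_pos by (intro tendsto_divide D) auto
  then have "((\<lambda>z. E z / D z) \<longlongrightarrow> 0) nontangential" by simp
  moreover have "\<forall>\<^sub>F z in nontangential. D z \<noteq> 0"
    using a_pos by (intro tendsto_imp_eventually_ne[OF D]) auto
  then have "\<forall>\<^sub>F z in nontangential. E z / D z = z ^ (2 * n + 1 + 1) * (lin_frac s P P' \<tau> z + moment_series s (2 * n + 1) z)"
    using eventually_nontangential_Im_pos
  proof eventually_elim
    case (elim z)
    define w where "w = z ^ (n + 1)"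
    have w: "w \<noteq> 0" using elim by (auto simp: w_def)
    have "2 * n + 1 + 1 = (n + 1) + (n + 1)" by simp
    then have ww: "z ^ (2 * n + 1 + 1) = w * w" unfolding w_def by (metis power_add)
    define d where "d = cpoly P z * \<tau> z + cpoly P' z"
    have Dd: "D z = d / w" by (simp add: D_def d_def w_def add_divide_distrib)
    then have d: "d \<noteq> 0" using elim by auto
    define k where "k = second_kind s P z * \<tau> z + second_kind s P' z"
    have E: "E z = w * (d * moment_series s (2 * n + 1) z - k)"
      unfolding E_def w_def[symmetric] d_def k_def by (simp add: algebra_simps)
    have "E z / D z = w * w * (d * moment_series s (2 * n + 1) z - k) / d"
      unfolding E Dd using w d by simp
    also have "\<dots> = w * w * (- (k / d) + moment_series s (2 * n + 1) z)"
      using d by (simp add: field_simps)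
    finally show ?case by (simp only: ww lin_frac_def d_def[symmetric] k_def[symmetric])
  qed
  ultimately show ?thesis by (rule Lim_transform_eventually)
qed

end

section \<open>Expansions of Cauchy transforms, and recovery of the moments\<close>

lemma sector_Im_ge:
  assumes "0 < \<delta>" "\<delta> < Arg z" "Arg z < pi - \<delta>"
  shows "sin \<delta> * norm z \<le> Im z"
proof -
  have "Im z = norm z * sin (Arg z)"
  proof -
    have "z \<noteq> 0" using assms by (auto simp: Arg_zero)
    then have "z = of_real (norm z) * exp (\<i> * of_real (Arg z))" by (rule Arg_eq)
    then have "Im z = Im (of_real (norm z) * exp (\<i> * of_real (Arg z)))" by (rule arg_cong)
    then show ?thesis by (simp add: Im_exp)
  qed
  moreover have "sin \<delta> \<le> sin (Arg z)"
  proof (cases "Arg z \<le> pi / 2")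
    case True
    then show ?thesis using assms by (intro sin_monotone_2pi_le) auto
  next
    case False
    then have "sin \<delta> \<le> sin (pi - Arg z)" using assms by (intro sin_monotone_2pi_le) auto
    then show ?thesis by simp
  qed
  ultimately show ?thesis by (metis mult.commute mult_left_mono norm_ge_zero)
qed

text \<open>The finite geometric series for 1 / (t - z) with its exact remainder.\<close>

lemma stieltjes_remainder:
  fixes z :: complex
  assumes "of_real t - z \<noteq> 0" "z \<noteq> 0"
  shows "z ^ (m + 1) * (1 / (of_real t - z) + (\<Sum>j\<le>m. of_real (t ^ j) / z ^ (j + 1))) =
    of_real (t ^ (m + 1)) / (of_real t - z)"
proof (induction m)
  case 0
  show ?case using assms by (simp add: field_simps)
next
  case (Suc m)
  have "z ^ (Suc m + 1) * (1 / (of_real t - z) + (\<Sum>j\<le>Suc m. of_real (t ^ j) / z ^ (j + 1))) =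
     z * (z ^ (m + 1) * (1 / (of_real t - z) + (\<Sum>j\<le>m. of_real (t ^ j) / z ^ (j + 1)))) + of_real (t ^ Suc m)"
    using assms by (simp add: algebra_simps)
  also have "\<dots> = z * (of_real (t ^ (m + 1)) / (of_real t - z)) + of_real (t ^ (m + 1))"
    unfolding Suc.IH by simp
  also have "\<dots> = of_real (t ^ (Suc m + 1)) / (of_real t - z)"
    using assms by (simp add: field_simps)
  finally show ?case .
qed

text \<open>The remainder is the integral of t^(m + 1) / (t - z), but |t|^(m + 1) need not be
  integrable. In a sector |t| / |t - z| is at most a constant times the minimum of 1 and |t| / |z|.
  The resulting majorant depends on z only through |z|, lies below a multiple of |t|^m, and tends to
  0 by dominated convergence.\<close>

lemma moment_solution_asymp:
  assumes \<mu>: "moment_solution s m \<mu>"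
    and \<phi>: "\<And>z. 0 < Im z \<Longrightarrow> has_bochner_integral \<mu> (\<lambda>t. 1 / (of_real t - z)) (\<phi> z)"
  shows "((\<lambda>z. z ^ (m + 1) * (\<phi> z + moment_series s m z)) \<longlongrightarrow> 0) nontangential"
proof -
  have [measurable_cong]: "sets \<mu> = sets borel" using \<mu> by (simp add: moment_solution_def)
  have int: "integrable \<mu> (\<lambda>t. \<bar>t\<bar> ^ m)"
  proof -
    have "integrable \<mu> (\<lambda>t. t ^ m)" using \<mu> by (auto simp: moment_solution_def has_bochner_integral_iff)
    then have "integrable \<mu> (\<lambda>t. \<bar>t ^ m\<bar>)" by (rule integrable_abs)
    then show ?thesis by (simp add: power_abs)
  qed
  define w where "w r t = \<bar>t\<bar> ^ m * min 1 (\<bar>t\<bar> / r)" for r t :: real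
  define G where "G r = (\<integral>t. w r t \<partial>\<mu>)" for r
  have wm [measurable]: "w r \<in> borel_measurable borel" for r unfolding w_def by measurable
  have wint: "integrable \<mu> (w r)" if "r > 0" for r
    using int by (rule Bochner_Integration.integrable_bound)
      (use that in \<open>auto simp: w_def abs_mult power_abs intro!: mult_left_le\<close>)
  have "(G \<longlongrightarrow> (\<integral>t. 0 \<partial>\<mu>)) at_top"
    unfolding G_def
  proof (rule integral_dominated_convergence_at_top)
    show "AE t in \<mu>. ((\<lambda>r. w r t) \<longlongrightarrow> 0) at_top"
    proof (intro AE_I2)
      fix t :: real
      have "((\<lambda>r. \<bar>t\<bar> / r) \<longlongrightarrow> 0) at_top"
        by (rule tendsto_divide_0[OF tendsto_const filterlim_at_top_imp_at_infinity[OF filterlim_ident]])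
      from tendsto_mult[OF tendsto_const tendsto_min[OF tendsto_const this], of "\<bar>t\<bar> ^ m" 1]
      show "((\<lambda>r. w r t) \<longlongrightarrow> 0) at_top" by (simp add: w_def)
    qed
    show "\<forall>\<^sub>F r in at_top. AE t in \<mu>. norm (w r t) \<le> \<bar>t\<bar> ^ m"
      using eventually_gt_at_top[of "0::real"]
      by eventually_elim (auto simp: w_def abs_mult power_abs intro!: mult_left_le)
  qed (use int in auto)
  then have G: "(G \<longlongrightarrow> 0) at_top" by simp
  \<comment> \<open>From c |z| \<le> |t - z| and |t| \<le> |t - z| + |z|; the constant 1 + 1 / c
    serves both branches of the minimum.\<close>
  have bound: "norm (z ^ (m + 1) * (\<phi> z + moment_series s m z)) \<le> (1 + 1 / c) * G (norm z)"
    if z: "0 < Im z" and c: "0 < c" "c * norm z \<le> Im z" for z c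
  proof -
    have z0: "z \<noteq> 0" and nz: "of_real t - z \<noteq> 0" for t using z by (auto simp: complex_eq_iff)
    have nonreal: "norm z > 0" using z0 by simp
    have "has_bochner_integral \<mu> (\<lambda>t. z ^ (m + 1) * (1 / (of_real t - z) + (\<Sum>j\<le>m. of_real (t ^ j) / z ^ (j + 1))))
        (z ^ (m + 1) * (\<phi> z + moment_series s m z))"
      unfolding moment_series_def using \<mu>
      by (intro has_bochner_integral_mult_right has_bochner_integral_add has_bochner_integral_sum
          has_bochner_integral_divide_zero has_bochner_integral_of_real \<phi> z) (auto simp: moment_solution_def)
    then have "has_bochner_integral \<mu> (\<lambda>t. of_real (t ^ (m + 1)) / (of_real t - z)) (z ^ (m + 1) * (\<phi> z + moment_series s m z))"
      by (simp only: stieltjes_remainder[OF nz z0])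
    then have I: "integrable \<mu> (\<lambda>t. of_real (t ^ (m + 1)) / (of_real t - z))"
      and e: "z ^ (m + 1) * (\<phi> z + moment_series s m z) = (\<integral>t. of_real (t ^ (m + 1)) / (of_real t - z) \<partial>\<mu>)"
      by (auto simp: has_bochner_integral_iff)
    have "norm (\<integral>t. of_real (t ^ (m + 1)) / (of_real t - z) \<partial>\<mu>) \<le> (\<integral>t. (1 + 1 / c) * w (norm z) t \<partial>\<mu>)"
    proof (rule Bochner_Integration.integral_norm_bound_integral[OF I])
      show "integrable \<mu> (\<lambda>t. (1 + 1 / c) * w (norm z) t)" using wint nonreal by simp
      fix t
      define d where "d = norm (of_real t - z)"
      have d: "0 < d" using nz by (simp add: d_def)
      have cd: "c * norm z \<le> d"
        using c abs_Im_le_cmod[of "of_real t - z"] by (simp add: d_def)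
      have "\<bar>t\<bar> \<le> d + norm z" using norm_triangle_ineq[of "of_real t - z" z] by (simp add: d_def)
      also have "norm z \<le> d / c" using cd c by (simp add: field_simps)
      finally have 1: "\<bar>t\<bar> / d \<le> 1 + 1 / c" using d c by (simp add: field_simps)
      have "\<bar>t\<bar> / d \<le> \<bar>t\<bar> / (c * norm z)"
        using cd c nonreal by (intro divide_left_mono mult_pos_pos) (auto simp: d)
      also have "\<dots> = 1 / c * (\<bar>t\<bar> / norm z)" by simp
      also have "\<dots> \<le> (1 + 1 / c) * (\<bar>t\<bar> / norm z)" by (intro mult_right_mono) auto
      finally have "\<bar>t\<bar> / d \<le> (1 + 1 / c) * min 1 (\<bar>t\<bar> / norm z)"
        using 1 by (simp add: min_def)
      then have "\<bar>t\<bar> ^ m * (\<bar>t\<bar> / d) \<le> \<bar>t\<bar> ^ m * ((1 + 1 / c) * min 1 (\<bar>t\<bar> / norm z))"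
        by (intro mult_left_mono) auto
      then show "norm (of_real (t ^ (m + 1)) / (of_real t - z)) \<le> (1 + 1 / c) * w (norm z) t"
        by (simp add: norm_divide norm_mult norm_power w_def d_def mult_ac)
    qed
    then show ?thesis unfolding e G_def by simp
  qed
  show ?thesis
    unfolding tendsto_iff eventually_nontangential
  proof (intro allI impI)
    fix e \<delta> :: real assume e: "0 < e" and \<delta>: "0 < \<delta>"
    show "\<exists>R. \<forall>z. R \<le> norm z \<longrightarrow> \<delta> < Arg z \<and> Arg z < pi - \<delta> \<longrightarrow>
        dist (z ^ (m + 1) * (\<phi> z + moment_series s m z)) 0 < e"
    \<comment> \<open>For \<delta> \<ge> pi the sector is empty, and sin \<delta> need not be
      positive.\<close>
    proof (cases "\<delta> < pi")
      case True
      define c where "c = sin \<delta>"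
      have c: "0 < c" using True \<delta> by (simp add: c_def sin_gt_zero)
      have "((\<lambda>r. (1 + 1 / c) * G r) \<longlongrightarrow> (1 + 1 / c) * 0) at_top"
        by (intro tendsto_mult tendsto_const G)
      then have "\<forall>\<^sub>F r in at_top. (1 + 1 / c) * G r < e" using e by (intro order_tendstoD) auto
      then obtain R where R: "\<And>r. R \<le> r \<Longrightarrow> (1 + 1 / c) * G r < e"
        by (auto simp: eventually_at_top_linorder)
      show ?thesis
      proof (intro exI allI impI)
        fix z assume z: "R \<le> norm z" "\<delta> < Arg z \<and> Arg z < pi - \<delta>"
        then have "0 < Im z" using Arg_lt_pi[of z] \<delta> by auto
        then have "norm (z ^ (m + 1) * (\<phi> z + moment_series s m z)) \<le> (1 + 1 / c) * G (norm z)"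
          using z \<delta> by (intro bound c) (auto simp: c_def intro: sector_Im_ge)
        also have "\<dots> < e" by (rule R[OF z(1)])
        finally show "dist (z ^ (m + 1) * (\<phi> z + moment_series s m z)) 0 < e" by simp
      qed
    next
      case False
      then have "\<not> (\<delta> < Arg z \<and> Arg z < pi - \<delta>)" for z
        using \<delta> by linarith
      then show ?thesis by blast
    qed
  qed
qed

lemma asymp_truncate:
  assumes \<phi>: "((\<lambda>z. z ^ (m + 1) * (\<phi> z + moment_series s m z)) \<longlongrightarrow> 0) nontangential" and j: "j \<le> m"
  shows "((\<lambda>z. z ^ (j + 1) * (\<phi> z + moment_series s j z)) \<longlongrightarrow> 0) nontangential"
proof (rule Lim_transform_eventually)
  note le = tendsto_mono[OF nontangential_le_at_infinity]
  have "((\<lambda>z. z ^ (j + 1) / z ^ (m + 1) * (z ^ (m + 1) * (\<phi> z + moment_series s m z)) -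
      z ^ (j + 1) * (moment_series s m z - moment_series s j z)) \<longlongrightarrow> (if j + 1 = m + 1 then 1 else 0) * 0 - 0) nontangential"
    using j by (intro tendsto_diff tendsto_mult \<phi> le[OF moment_series_tail] le[OF power_quotient_tendsto]) auto
  then show "((\<lambda>z. z ^ (j + 1) / z ^ (m + 1) * (z ^ (m + 1) * (\<phi> z + moment_series s m z)) -
      z ^ (j + 1) * (moment_series s m z - moment_series s j z)) \<longlongrightarrow> 0) nontangential" by simp
  show "\<forall>\<^sub>F z in nontangential. z ^ (j + 1) / z ^ (m + 1) * (z ^ (m + 1) * (\<phi> z + moment_series s m z)) -
      z ^ (j + 1) * (moment_series s m z - moment_series s j z) = z ^ (j + 1) * (\<phi> z + moment_series s j z)"
    using eventually_nontangential_Im_pos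
  proof eventually_elim
    case (elim z)
    define w v where "w = z ^ (m + 1)" and "v = z ^ (j + 1)"
    have w: "w \<noteq> 0" using elim by (auto simp: w_def)
    show ?case unfolding w_def[symmetric] v_def[symmetric] using w by (simp add: algebra_simps)
  qed
qed

text \<open>Once the lower coefficients agree, the difference of the two remainders truncated at j
  is the constant s j - s' j, and it tends to 0.\<close>

lemma asymp_unique:
  assumes 1: "((\<lambda>z. z ^ (m + 1) * (\<phi> z + moment_series s m z)) \<longlongrightarrow> 0) nontangential"
    and 2: "((\<lambda>z. z ^ (m + 1) * (\<phi> z + moment_series s' m z)) \<longlongrightarrow> 0) nontangential"
  shows "j \<le> m \<Longrightarrow> s j = s' j"
proof (induction j rule: less_induct)
  case (less j)
  have "((\<lambda>z. z ^ (j + 1) * (\<phi> z + moment_series s j z) - z ^ (j + 1) * (\<phi> z + moment_series s' j z)) \<longlongrightarrow> 0 - 0) nontangential"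
    using less.prems by (intro tendsto_diff asymp_truncate[OF 1] asymp_truncate[OF 2])
  moreover have "\<forall>\<^sub>F z in nontangential. z ^ (j + 1) * (\<phi> z + moment_series s j z) - z ^ (j + 1) * (\<phi> z + moment_series s' j z) = of_real (s j - s' j)"
    using eventually_nontangential_Im_pos
  proof eventually_elim
    case (elim z)
    have z: "z \<noteq> 0" using elim by auto
    have split: "{..j} = insert j {..<j}" by auto
    have "moment_series s j z - moment_series s' j z = of_real (s j - s' j) / z ^ (j + 1)"
      unfolding moment_series_def split using less.IH less.prems by (simp add: diff_divide_distrib)
    then have "z ^ (j + 1) * (moment_series s j z - moment_series s' j z) = of_real (s j - s' j)"
      using z by simp
    then show ?case by (simp add: algebra_simps)
  qed
  ultimately have "((\<lambda>z::complex. complex_of_real (s j - s' j)) \<longlongrightarrow> 0) nontangential"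
    by (simp add: tendsto_cong)
  then have "complex_of_real (s j - s' j) = 0" by (simp add: tendsto_const_iff)
  then show ?case by (simp only: of_real_eq_0_iff)
qed

text \<open>Integrability is all that has to be supplied: the actual moments of \<mu> furnish an
  expansion of \<phi>, and the coefficients of an expansion are unique.\<close>

lemma moment_solution_asymp_integrable:
  assumes sets: "sets \<mu> = sets borel"
    and \<phi>: "\<And>z. 0 < Im z \<Longrightarrow> has_bochner_integral \<mu> (\<lambda>t. 1 / (of_real t - z)) (\<phi> z)"
    and asymp: "((\<lambda>z. z ^ (m + 1) * (\<phi> z + moment_series s m z)) \<longlongrightarrow> 0) nontangential"
    and int: "\<And>j. j \<le> m \<Longrightarrow> integrable \<mu> (\<lambda>t. t ^ j)"
  shows "moment_solution s m \<mu>"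
proof -
  define s' where "s' j = (\<integral>t. t ^ j \<partial>\<mu>)" for j
  have s': "moment_solution s' m \<mu>"
    using sets int by (simp add: moment_solution_def has_bochner_integral_iff s'_def)
  have "s j = s' j" if "j \<le> m" for j
    using asymp_unique[OF asymp moment_solution_asymp[OF s' \<phi>]] that by blast
  with s' show ?thesis by (simp add: moment_solution_def)
qed

text \<open>For \<open>z = i y\<close>, the real part of \<open>z\<^sup>2\<^sup>k\<^sup>+\<^sup>1\<close> times the remainder of order \<open>2k\<close> only involves
  moments of even order.\<close>

lemma even_moments:
  assumes sets: "sets \<mu> = sets borel"
    and \<phi>: "\<And>z. 0 < Im z \<Longrightarrow> has_bochner_integral \<mu> (\<lambda>t. 1 / (of_real t - z)) (\<phi> z)"
    and asymp: "((\<lambda>z. z ^ (2 * n + 1) * (\<phi> z + moment_series s (2 * n) z)) \<longlongrightarrow> 0) nontangential"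
  shows "k \<le> n \<Longrightarrow> (\<forall>y>0. has_bochner_integral \<mu> (\<lambda>t. t ^ (2 * k) * (y\<^sup>2 / (t\<^sup>2 + y\<^sup>2)))
      (s (2 * k) - Re ((\<i> * of_real y) ^ (2 * k + 1) * (\<phi> (\<i> * of_real y) + moment_series s (2 * k) (\<i> * of_real y))))) \<and>
    has_bochner_integral \<mu> (\<lambda>t. t ^ (2 * k)) (s (2 * k))"
proof (induction k)
  have [measurable_cong]: "sets \<mu> = sets borel" by fact
  have step: "has_bochner_integral \<mu> (\<lambda>t. t ^ (2 * k)) (s (2 * k))"
    if "k \<le> n" "\<And>y. y > 0 \<Longrightarrow> has_bochner_integral \<mu> (\<lambda>t. t ^ (2 * k) * (y\<^sup>2 / (t\<^sup>2 + y\<^sup>2)))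
      (s (2 * k) - Re ((\<i> * of_real y) ^ (2 * k + 1) * (\<phi> (\<i> * of_real y) + moment_series s (2 * k) (\<i> * of_real y))))" for k
  proof (rule has_bochner_integral_cutoff_limit[where T = "\<lambda>t. t"])
    show "\<forall>\<^sub>F y in at_top. has_bochner_integral \<mu> (\<lambda>t. t ^ (2 * k) * (y\<^sup>2 / (t\<^sup>2 + y\<^sup>2)))
      (s (2 * k) - Re ((\<i> * of_real y) ^ (2 * k + 1) * (\<phi> (\<i> * of_real y) + moment_series s (2 * k) (\<i> * of_real y))))"
      using eventually_gt_at_top[of "0::real"] by eventually_elim (rule that(2))
    have "((\<lambda>z. z ^ (2 * k + 1) * (\<phi> z + moment_series s (2 * k) z)) \<longlongrightarrow> 0) nontangential"
      using \<open>k \<le> n\<close> by (intro asymp_truncate[OF asymp]) auto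
    from filterlim_compose[OF this filterlim_imaginary_axis]
    have "((\<lambda>y. s (2 * k) - Re ((\<i> * of_real y) ^ (2 * k + 1) * (\<phi> (\<i> * of_real y) + moment_series s (2 * k) (\<i> * of_real y)))) \<longlongrightarrow> s (2 * k) - Re 0) at_top"
      by (intro tendsto_diff tendsto_const tendsto_Re)
    then show "((\<lambda>y. s (2 * k) - Re ((\<i> * of_real y) ^ (2 * k + 1) * (\<phi> (\<i> * of_real y) + moment_series s (2 * k) (\<i> * of_real y)))) \<longlongrightarrow> s (2 * k)) at_top"
      by simp
  qed auto
  {
    case 0
    have "has_bochner_integral \<mu> (\<lambda>t. t ^ (2 * 0) * (y\<^sup>2 / (t\<^sup>2 + y\<^sup>2)))
      (s (2 * 0) - Re ((\<i> * of_real y) ^ (2 * 0 + 1) * (\<phi> (\<i> * of_real y) + moment_series s (2 * 0) (\<i> * of_real y))))"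
      if y: "y > 0" for y
    proof -
      have "has_bochner_integral \<mu> (\<lambda>t. y * Im (1 / (of_real t - \<i> * of_real y))) (y * Im (\<phi> (\<i> * of_real y)))"
        using y by (intro has_bochner_integral_mult_right has_bochner_integral_Im \<phi>) simp
      moreover have "y * Im (1 / (of_real t - \<i> * of_real y)) = t ^ (2 * 0) * (y\<^sup>2 / (t\<^sup>2 + y\<^sup>2))" for t
        unfolding Im_divide by (simp add: power2_eq_square)
      moreover have "s (2 * 0) - Re ((\<i> * of_real y) ^ (2 * 0 + 1) * (\<phi> (\<i> * of_real y) + moment_series s (2 * 0) (\<i> * of_real y))) = y * Im (\<phi> (\<i> * of_real y))"
        using y by (simp add: moment_series_def distrib_left Re_divide)
      ultimately show ?thesis by simp
    qed
    then show ?case using step[of 0] by blast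
  next
    case (Suc k)
    have "has_bochner_integral \<mu> (\<lambda>t. t ^ (2 * Suc k) * (y\<^sup>2 / (t\<^sup>2 + y\<^sup>2)))
      (s (2 * Suc k) - Re ((\<i> * of_real y) ^ (2 * Suc k + 1) * (\<phi> (\<i> * of_real y) + moment_series s (2 * Suc k) (\<i> * of_real y))))"
      if y: "y > 0" for y
    proof -
      define z where "z = \<i> * complex_of_real y"
      define Z where "Z = z ^ (2 * k + 1) * (\<phi> z + moment_series s (2 * k) z)"
      have z: "z \<noteq> 0" using y by (simp add: z_def)
      have IH: "has_bochner_integral \<mu> (\<lambda>t. t ^ (2 * k) * (y\<^sup>2 / (t\<^sup>2 + y\<^sup>2))) (s (2 * k) - Re Z)"
        "has_bochner_integral \<mu> (\<lambda>t. t ^ (2 * k)) (s (2 * k))"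
        using Suc y by (simp_all add: Z_def z_def)
      \<comment> \<open>t^(2k + 2) / (t^2 + y^2) = t^(2k) - t^(2k) y^2 / (t^2 + y^2): the next
        truncated moment needs the full moment of order 2k as well as its truncation, which is why
        the induction carries both.\<close>
      have "has_bochner_integral \<mu> (\<lambda>t. y\<^sup>2 * t ^ (2 * k) - y\<^sup>2 * (t ^ (2 * k) * (y\<^sup>2 / (t\<^sup>2 + y\<^sup>2)))) (y\<^sup>2 * s (2 * k) - y\<^sup>2 * (s (2 * k) - Re Z))"
        by (intro has_bochner_integral_diff has_bochner_integral_mult_right IH)
      moreover have "y\<^sup>2 * t ^ (2 * k) - y\<^sup>2 * (t ^ (2 * k) * (y\<^sup>2 / (t\<^sup>2 + y\<^sup>2))) = t ^ (2 * Suc k) * (y\<^sup>2 / (t\<^sup>2 + y\<^sup>2))" for t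
      proof -
        have "0 < t\<^sup>2 + y\<^sup>2" using y by (intro add_nonneg_pos) auto
        then show ?thesis by (simp add: divide_simps) (simp add: algebra_simps power2_eq_square)
      qed
      moreover have "z ^ (2 * Suc k + 1) * (\<phi> z + moment_series s (2 * Suc k) z) = z\<^sup>2 * Z + (z * s (2 * k + 1) + s (2 * Suc k))"
      proof -
        have "moment_series s (2 * Suc k) z = moment_series s (2 * k) z + of_real (s (2 * k + 1)) / z ^ (2 * k + 2) + of_real (s (2 * Suc k)) / z ^ (2 * k + 3)"
          by (simp add: moment_series_def eval_nat_numeral)
        moreover have "z ^ (2 * Suc k + 1) = z\<^sup>2 * z ^ (2 * k + 1)" "z ^ (2 * k + 2) = z * z ^ (2 * k + 1)" "z ^ (2 * k + 3) = z\<^sup>2 * z ^ (2 * k + 1)"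
          by (simp_all add: eval_nat_numeral)
        moreover have "z\<^sup>2 * w * (c + (d + a / (z * w) + b / (z\<^sup>2 * w))) = z\<^sup>2 * (w * (c + d)) + (z * a + b)"
          if "w \<noteq> 0" for w a b c d
          using that z by (simp add: distrib_left power2_eq_square)
        from this[of "z ^ (2 * k + 1)"] z
        have "z\<^sup>2 * z ^ (2 * k + 1) * (c + (d + a / (z * z ^ (2 * k + 1)) + b / (z\<^sup>2 * z ^ (2 * k + 1)))) =
            z\<^sup>2 * (z ^ (2 * k + 1) * (c + d)) + (z * a + b)" for a b c d by simp
        ultimately show ?thesis unfolding Z_def by (simp only:)
      qed
      then have "Re (z ^ (2 * Suc k + 1) * (\<phi> z + moment_series s (2 * Suc k) z)) = - (y\<^sup>2 * Re Z) + s (2 * Suc k)"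
        by (simp add: z_def power_mult_distrib flip: of_real_power)
      then have "s (2 * Suc k) - Re (z ^ (2 * Suc k + 1) * (\<phi> z + moment_series s (2 * Suc k) z)) = y\<^sup>2 * s (2 * k) - y\<^sup>2 * (s (2 * k) - Re Z)"
        by (simp add: algebra_simps)
      ultimately show ?thesis unfolding z_def[symmetric] by simp
    qed
    then show ?case using step[OF Suc.prems] by blast
  }
qed

lemma power_integrable:
  fixes \<mu> :: "real measure"
  assumes sets: "sets \<mu> = sets borel" and 0: "integrable \<mu> (\<lambda>t. 1 :: real)" and m: "integrable \<mu> (\<lambda>t. \<bar>t\<bar> ^ m)" and j: "j \<le> m"
  shows "integrable \<mu> (\<lambda>t. t ^ j)"
proof (rule Bochner_Integration.integrable_bound[OF Bochner_Integration.integrable_add[OF 0 m]])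
  show "(\<lambda>t. t ^ j) \<in> borel_measurable \<mu>"
    unfolding measurable_cong_sets[OF sets refl] by measurable
  have "\<bar>t\<bar> ^ j \<le> 1 + \<bar>t\<bar> ^ m" for t :: real
  proof (cases "\<bar>t\<bar> \<le> 1")
    case True
    then have "\<bar>t\<bar> ^ j \<le> 1" by (intro power_le_one) auto
    then show ?thesis by (simp add: add_increasing2)
  next
    case False
    then have "\<bar>t\<bar> ^ j \<le> \<bar>t\<bar> ^ m" using j by (intro power_increasing) auto
    then show ?thesis by simp
  qed
  then show "AE t in \<mu>. norm (t ^ j) \<le> norm (1 + \<bar>t\<bar> ^ m)"
    by (auto simp: power_abs)
qed

lemma asymp_moment_solution:
  assumes sets: "sets \<mu> = sets borel"
    and \<phi>: "\<And>z. 0 < Im z \<Longrightarrow> has_bochner_integral \<mu> (\<lambda>t. 1 / (of_real t - z)) (\<phi> z)"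
    and asymp: "((\<lambda>z. z ^ (2 * n + 1) * (\<phi> z + moment_series s (2 * n) z)) \<longlongrightarrow> 0) nontangential"
  shows "moment_solution s (2 * n) \<mu>"
proof (rule moment_solution_asymp_integrable[OF sets \<phi> asymp])
  have "integrable \<mu> (\<lambda>t. t ^ (2 * 0))" "integrable \<mu> (\<lambda>t. t ^ (2 * n))"
    using even_moments[OF sets \<phi> asymp, of 0] even_moments[OF sets \<phi> asymp, of n]
    by (auto simp: has_bochner_integral_iff)
  then show "integrable \<mu> (\<lambda>t. t ^ j)" if "j \<le> 2 * n" for j
    using that by (intro power_integrable[OF sets _ _ that]) (simp_all add: power_even_abs)
qed

lemma cauchy_transform_eqI:
  assumes \<phi>: "\<phi> \<in> nevanlinna"
    and int: "\<And>z. 0 < Im z \<Longrightarrow> has_bochner_integral \<mu> (\<lambda>t. 1 / (of_real t - z)) (\<phi> z)"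
  shows "cauchy_transform_eq \<mu> \<phi>"
  unfolding cauchy_transform_eq_def
proof
  fix z :: complex assume z: "z \<in> - \<real>"
  show "has_bochner_integral \<mu> (\<lambda>t. 1 / (of_real t - z)) (\<phi> z)"
  proof (cases "0 < Im z")
    case False
    then have "0 < Im (cnj z)" using z by (auto simp: complex_is_Real_iff)
    from has_bochner_integral_cnj[OF int[OF this]] show ?thesis
      using \<phi> z by (simp add: nevanlinna_def)
  qed (rule int)
qed

text \<open>The truncation of order 0 says that y \<phi>(i y) tends to i s 0, the growth condition
  of \<open>nevanlinna_cauchy_transform\<close>. The conclusion stops at order 2n because the
  expansion does not force |t|^(2n + 1) to be integrable.\<close>

lemma nevanlinna_asymp_measure:
  assumes \<phi>: "\<phi> \<in> nevanlinna_asymp s (2 * n + 1)" and s0: "0 < s 0"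
  shows "\<exists>\<mu>. cauchy_transform_eq \<mu> \<phi> \<and> moment_solution s (2 * n) \<mu>"
proof -
  have nev: "\<phi> \<in> nevanlinna" and asymp: "((\<lambda>z. z ^ (2 * n + 1 + 1) * (\<phi> z + moment_series s (2 * n + 1) z)) \<longlongrightarrow> 0) nontangential"
    using \<phi> by (auto simp: nevanlinna_asymp_iff)
  have hol: "\<phi> holomorphic_on {z. 0 < Im z}"
    using nev by (auto simp: nevanlinna_def complex_is_Real_iff elim!: holomorphic_on_subset)
  have "((\<lambda>z. z ^ (0 + 1) * (\<phi> z + moment_series s 0 z)) \<longlongrightarrow> 0) nontangential"
    by (rule asymp_truncate[OF asymp]) simp
  from filterlim_compose[OF this filterlim_imaginary_axis]
  have "((\<lambda>y. - \<i> * ((\<i> * of_real y) ^ (0 + 1) * (\<phi> (\<i> * of_real y) + moment_series s 0 (\<i> * of_real y))) + \<i> * of_real (s 0)) \<longlongrightarrow> - \<i> * 0 + \<i> * of_real (s 0)) at_top"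
    by (intro tendsto_add tendsto_mult tendsto_const)
  then have "((\<lambda>y. of_real y * \<phi> (\<i> * of_real y)) \<longlongrightarrow> - \<i> * 0 + \<i> * of_real (s 0)) at_top"
  proof (rule Lim_transform_eventually)
    show "\<forall>\<^sub>F y in at_top. - \<i> * ((\<i> * of_real y) ^ (0 + 1) * (\<phi> (\<i> * of_real y) + moment_series s 0 (\<i> * of_real y))) + \<i> * of_real (s 0) = of_real y * \<phi> (\<i> * of_real y)"
      using eventually_gt_at_top[of "0::real"] by eventually_elim (simp add: moment_series_def algebra_simps)
  qed
  then have "((\<lambda>y. of_real y * \<phi> (\<i> * of_real y)) \<longlongrightarrow> \<i> * of_real (s 0)) at_top" by simp
  from nevanlinna_cauchy_transform[OF hol _ this s0] nev
  obtain \<mu> where \<mu>: "sets \<mu> = sets borel" "\<And>z. 0 < Im z \<Longrightarrow> has_bochner_integral \<mu> (\<lambda>t. 1 / (of_real t - z)) (\<phi> z)"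
    unfolding nevanlinna_def by blast
  have lim: "((\<lambda>z. z ^ (2 * n + 1) * (\<phi> z + moment_series s (2 * n) z)) \<longlongrightarrow> 0) nontangential"
    by (rule asymp_truncate[OF asymp]) simp
  have "moment_solution s (2 * n) \<mu>"
    by (rule asymp_moment_solution[OF \<mu>(1) _ lim]) (rule \<mu>(2))
  with cauchy_transform_eqI[OF nev \<mu>(2)] show ?thesis by blast
qed

section \<open>The integrability condition at infinity\<close>

lemma nn_integral_inverse_square:
  assumes "0 \<le> b" "0 < \<eta>"
  shows "(\<integral>\<^sup>+y. ennreal (1 / (b + y)\<^sup>2) * indicator {\<eta>..} y \<partial>lborel) = ennreal (1 / (b + \<eta>))"
proof -
  have "(\<integral>\<^sup>+y. ennreal (1 / (b + y)\<^sup>2) * indicator {\<eta>..} y \<partial>lborel) = ennreal (0 - (- 1 / (b + \<eta>)))"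
  proof (rule nn_integral_FTC_atLeast)
    show "((\<lambda>y. - 1 / (b + y)) has_real_derivative 1 / (b + y)\<^sup>2) (at y)" if "\<eta> \<le> y" for y
      using assms that by (auto intro!: derivative_eq_intros simp: power2_eq_square)
    show "((\<lambda>y. - 1 / (b + y)) \<longlongrightarrow> 0) at_top" by real_asymp
  qed auto
  then show ?thesis by simp
qed

text \<open>Tonelli's theorem with the kernel 1 / (|t| + y)^2 in place of 1 / (t^2 + y^2): the two
  are comparable by \<open>kernel_bounds\<close>, and this one has an elementary primitive.
  Integration over y turns a weight of size t^(2n + 2) into one of size |t|^(2n + 1).\<close>

lemma nn_integral_kac:
  fixes \<mu> :: "real measure" and V :: "real \<Rightarrow> real"
  assumes sets: "sets \<mu> = sets borel" and fin: "finite_measure \<mu>" and V [measurable]: "V \<in> borel_measurable borel"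
    and nn: "\<And>t. 0 \<le> V t" and \<eta>: "0 < \<eta>"
  shows "(\<integral>\<^sup>+y. (\<integral>\<^sup>+t. ennreal (V t / (\<bar>t\<bar> + y)\<^sup>2) * indicator {\<eta>..} y \<partial>\<mu>) \<partial>lborel) =
    (\<integral>\<^sup>+t. ennreal (V t / (\<bar>t\<bar> + \<eta>)) \<partial>\<mu>)"
proof -
  interpret finite_measure \<mu> by fact
  interpret pair_sigma_finite \<mu> lborel ..
  have [measurable_cong]: "sets \<mu> = sets borel" by fact
  have "(\<integral>\<^sup>+y. (\<integral>\<^sup>+t. ennreal (V t / (\<bar>t\<bar> + y)\<^sup>2) * indicator {\<eta>..} y \<partial>\<mu>) \<partial>lborel) =
      (\<integral>\<^sup>+t. (\<integral>\<^sup>+y. ennreal (V t / (\<bar>t\<bar> + y)\<^sup>2) * indicator {\<eta>..} y \<partial>lborel) \<partial>\<mu>)"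
    by (rule Fubini') measurable
  also have "\<dots> = (\<integral>\<^sup>+t. ennreal (V t / (\<bar>t\<bar> + \<eta>)) \<partial>\<mu>)"
  proof (rule nn_integral_cong)
    fix t
    have "(\<integral>\<^sup>+y. ennreal (V t / (\<bar>t\<bar> + y)\<^sup>2) * indicator {\<eta>..} y \<partial>lborel) =
        (\<integral>\<^sup>+y. ennreal (V t) * (ennreal (1 / (\<bar>t\<bar> + y)\<^sup>2) * indicator {\<eta>..} y) \<partial>lborel)"
      using nn by (intro nn_integral_cong) (simp add: ennreal_mult[symmetric] mult.assoc[symmetric])
    also have "\<dots> = ennreal (V t) * ennreal (1 / (\<bar>t\<bar> + \<eta>))"
      using \<eta> by (subst nn_integral_cmult) (simp_all add: nn_integral_inverse_square)
    finally show "(\<integral>\<^sup>+y. ennreal (V t / (\<bar>t\<bar> + y)\<^sup>2) * indicator {\<eta>..} y \<partial>lborel) = ennreal (V t / (\<bar>t\<bar> + \<eta>))"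
      using nn \<eta> by (simp add: ennreal_mult[symmetric])
  qed
  finally show ?thesis .
qed

lemma moment_solution_finite_measure:
  assumes "moment_solution s m \<mu>"
  shows "finite_measure \<mu>"
proof -
  have "has_bochner_integral \<mu> (\<lambda>t. t ^ 0) (s 0)" using assms unfolding moment_solution_def by blast
  then have "integrable \<mu> (\<lambda>t. 1 :: real)" by (simp add: has_bochner_integral_iff)
  also have "?this \<longleftrightarrow> integrable \<mu> (indicator (space \<mu>) :: real \<Rightarrow> real)"
    by (intro Bochner_Integration.integrable_cong) auto
  finally show ?thesis by (intro finite_measureI) (auto simp: integrable_indicator_iff)
qed

lemma borel_measurable_poly [measurable]: "poly p \<in> borel_measurable borel" for p :: "real poly"
  by (intro borel_measurable_continuous_onI continuous_intros)

lemma poly_integrable: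
  fixes p :: "real poly"
  assumes "moment_solution s m \<mu>" "degree p \<le> m"
  shows "integrable \<mu> (poly p)"
proof -
  have "integrable \<mu> (\<lambda>t. \<Sum>i\<le>degree p. coeff p i * t ^ i)"
    using assms by (intro Bochner_Integration.integrable_sum integrable_mult_right)
      (auto simp: moment_solution_def has_bochner_integral_iff)
  then show ?thesis by (simp add: poly_altdef[abs_def])
qed

text \<open>Division by |t| + \<eta> lowers the growth by one degree: V = b + t W, and |t| / (|t| +
  \<eta>) \<le> 1.\<close>

lemma poly_kac_integrable:
  fixes V :: "real poly"
  assumes \<mu>: "moment_solution s m \<mu>" and V: "degree V \<le> m + 1" and nn: "\<And>t. 0 \<le> poly V t" and \<eta>: "0 < \<eta>"
  shows "(\<integral>\<^sup>+t. ennreal (poly V t / (\<bar>t\<bar> + \<eta>)) \<partial>\<mu>) < \<infinity>"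
proof -
  have sets: "sets \<mu> = sets borel" using \<mu> by (simp add: moment_solution_def)
  have [measurable_cong]: "sets \<mu> = sets borel" by fact
  obtain b W where VW: "V = pCons b W" by (cases V)
  have "degree W \<le> m" using V VW by (auto split: if_splits)
  then have W: "integrable \<mu> (poly W)" by (rule poly_integrable[OF \<mu>])
  have "integrable \<mu> (\<lambda>t. \<bar>b\<bar> / \<eta> + \<bar>poly W t\<bar>)"
  proof -
    interpret finite_measure \<mu> by (rule moment_solution_finite_measure[OF \<mu>])
    show ?thesis by (intro Bochner_Integration.integrable_add integrable_const integrable_abs W)
  qed
  then have "integrable \<mu> (\<lambda>t. poly V t / (\<bar>t\<bar> + \<eta>))"
  proof (rule Bochner_Integration.integrable_bound)
    show "(\<lambda>t. poly V t / (\<bar>t\<bar> + \<eta>)) \<in> borel_measurable \<mu>" by measurable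
    have "norm (poly V t / (\<bar>t\<bar> + \<eta>)) \<le> norm (\<bar>b\<bar> / \<eta> + \<bar>poly W t\<bar>)" for t
    proof -
      have "\<bar>poly V t\<bar> / (\<bar>t\<bar> + \<eta>) \<le> (\<bar>b\<bar> + \<bar>t\<bar> * \<bar>poly W t\<bar>) / (\<bar>t\<bar> + \<eta>)"
        using \<eta> abs_triangle_ineq[of b "t * poly W t"] by (intro divide_right_mono) (auto simp: VW abs_mult)
      also have "\<dots> = \<bar>b\<bar> / (\<bar>t\<bar> + \<eta>) + \<bar>t\<bar> / (\<bar>t\<bar> + \<eta>) * \<bar>poly W t\<bar>" by (simp add: add_divide_distrib)
      also have "\<dots> \<le> \<bar>b\<bar> / \<eta> + 1 * \<bar>poly W t\<bar>"
        using \<eta> by (intro add_mono mult_right_mono divide_left_mono) auto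
      finally show ?thesis using \<eta> by simp
    qed
    then show "AE t in \<mu>. norm (poly V t / (\<bar>t\<bar> + \<eta>)) \<le> norm (\<bar>b\<bar> / \<eta> + \<bar>poly W t\<bar>)" by simp
  qed
  then show ?thesis
    using nn \<eta> by (subst nn_integral_eq_integral) auto
qed

text \<open>For large |t| the leading term gives |p(t)| \<ge> (l / 2) |t|^(n + 1), where l is the
  modulus of the leading coefficient, and |t| + \<eta> \<le> 2 |t|; hence C = 8 / l^2. On the
  remaining bounded interval a power of its radius serves as B.\<close>

lemma poly_square_lower_bound:
  fixes p :: "real poly"
  assumes p: "degree p = Suc n" and \<eta>: "0 < \<eta>"
  shows "\<exists>B C. 0 \<le> B \<and> 0 \<le> C \<and> (\<forall>t. \<bar>t\<bar> ^ (2 * n + 1) \<le> B + C * ((poly p t)\<^sup>2 / (\<bar>t\<bar> + \<eta>)))"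
proof -
  define l where "l = \<bar>coeff p (Suc n)\<bar>"
  have l: "0 < l" using p by (auto simp: l_def) (metis leading_coeff_0_iff degree_0 nat.distinct(1))
  have "((\<lambda>t. \<bar>poly p t / t ^ Suc n\<bar>) \<longlongrightarrow> l) at_infinity"
    unfolding l_def using p by (intro tendsto_rabs poly_quotient_tendsto) simp
  then have "\<forall>\<^sub>F t in at_infinity. l / 2 < \<bar>poly p t / t ^ Suc n\<bar>" using l by (intro order_tendstoD) auto
  then obtain T where T: "\<And>t. T \<le> \<bar>t\<bar> \<Longrightarrow> l / 2 < \<bar>poly p t / t ^ Suc n\<bar>"
    by (auto simp: eventually_at_infinity)
  define S where "S = max T \<eta>"
  have "\<bar>t\<bar> ^ (2 * n + 1) \<le> S ^ (2 * n + 1) + 8 / l\<^sup>2 * ((poly p t)\<^sup>2 / (\<bar>t\<bar> + \<eta>))" for t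
  proof (cases "\<bar>t\<bar> \<le> S")
    case True
    then have "\<bar>t\<bar> ^ (2 * n + 1) \<le> S ^ (2 * n + 1)" by (intro power_mono) auto
    moreover have "0 \<le> 8 / l\<^sup>2 * ((poly p t)\<^sup>2 / (\<bar>t\<bar> + \<eta>))" using \<eta> by simp
    ultimately show ?thesis by linarith
  next
    case False
    then have t: "T \<le> \<bar>t\<bar>" "\<eta> \<le> \<bar>t\<bar>" "0 < \<bar>t\<bar>" using \<eta> by (auto simp: S_def)
    have "l / 2 * \<bar>t\<bar> ^ Suc n \<le> \<bar>poly p t\<bar>"
      using T[OF t(1)] t(3) by (simp add: abs_divide abs_mult power_abs field_simps)
    then have "(l / 2 * \<bar>t\<bar> ^ Suc n)\<^sup>2 \<le> (poly p t)\<^sup>2"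
      using l by (simp add: abs_le_square_iff[symmetric] abs_mult)
    then have "(l / 2 * \<bar>t\<bar> ^ Suc n)\<^sup>2 / (2 * \<bar>t\<bar>) \<le> (poly p t)\<^sup>2 / (\<bar>t\<bar> + \<eta>)"
      using t \<eta> by (intro frac_le) auto
    moreover have "(l / 2 * \<bar>t\<bar> ^ Suc n)\<^sup>2 / (2 * \<bar>t\<bar>) = l\<^sup>2 / 8 * \<bar>t\<bar> ^ (2 * n + 1)"
    proof -
      have "(\<bar>t\<bar> ^ Suc n)\<^sup>2 = \<bar>t\<bar> * \<bar>t\<bar> ^ (2 * n + 1)"
        by (simp add: power2_eq_square mult_2 power_add)
      then show ?thesis using t(3) by (simp add: power_mult_distrib power_divide)
    qed
    ultimately have "l\<^sup>2 / 8 * \<bar>t\<bar> ^ (2 * n + 1) \<le> (poly p t)\<^sup>2 / (\<bar>t\<bar> + \<eta>)"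
      by (simp only:)
    from mult_left_mono[OF this, of "8 / l\<^sup>2"]
    have "\<bar>t\<bar> ^ (2 * n + 1) \<le> 8 / l\<^sup>2 * ((poly p t)\<^sup>2 / (\<bar>t\<bar> + \<eta>))" using l by simp
    moreover have "0 \<le> S ^ (2 * n + 1)" using \<eta> by (intro zero_le_power) (simp add: S_def)
    ultimately show ?thesis by linarith
  qed
  moreover have "0 \<le> S ^ (2 * n + 1)" using \<eta> by (intro zero_le_power) (simp add: S_def)
  ultimately show ?thesis by (intro exI[of _ "S ^ (2 * n + 1)"] exI[of _ "8 / l\<^sup>2"]) auto
qed

lemma norm_sum_square_le: "(norm (x + y))\<^sup>2 \<le> 2 * (norm x)\<^sup>2 + 2 * (norm y)\<^sup>2"
  for x y :: "'a :: real_normed_vector"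
proof -
  have "(norm (x + y))\<^sup>2 \<le> (norm x + norm y)\<^sup>2" by (intro power_mono norm_triangle_ineq) auto
  also have "\<dots> \<le> 2 * (norm x)\<^sup>2 + 2 * (norm y)\<^sup>2"
    using zero_le_power2[of "norm x - norm y"] by (simp add: power2_sum power2_diff)
  finally show ?thesis .
qed

section \<open>Integrability of Im \<tau>(i y) / y and the absolute moment of order 2n + 1\<close>

context hamburger_data
begin

lemma den_of_real: "poly (den c) (of_real t) = of_real (poly P t) * c + of_real (poly P' t)"
proof -
  have "poly (map_poly of_real p) (of_real t) = complex_of_real (poly p t)" for p
    by (induction p) (simp_all add: map_poly_pCons)
  then show ?thesis by (simp add: den_def mult.commute)
qed

lemma norm_den_quotient:
  "(norm (poly (den c) (of_real t) / (of_real t - \<i> * of_real y)))\<^sup>2 = (norm (poly (den c) (of_real t)))\<^sup>2 / (t\<^sup>2 + y\<^sup>2)"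
  by (simp add: norm_divide power_divide cmod_power2)

text \<open>The first two bounds exchange the kernel of \<open>tau_Im\<close> for that of
  \<open>nn_integral_kac\<close>. The third serves the term in P^2, which is integrable by itself,
  so that the decay in y is enough.\<close>

lemma kernel_bounds:
  fixes t y :: real
  assumes "0 < y"
  shows "1 / (\<bar>t\<bar> + y)\<^sup>2 \<le> 1 / (t\<^sup>2 + y\<^sup>2)" "1 / (t\<^sup>2 + y\<^sup>2) \<le> 2 / (\<bar>t\<bar> + y)\<^sup>2" "1 / (t\<^sup>2 + y\<^sup>2) \<le> 1 / y\<^sup>2"
proof -
  have p: "0 < t\<^sup>2 + y\<^sup>2" using assms by (intro add_nonneg_pos) auto
  have q: "0 < (\<bar>t\<bar> + y)\<^sup>2" using assms by simp
  have e: "(\<bar>t\<bar> + y)\<^sup>2 = t\<^sup>2 + y\<^sup>2 + 2 * \<bar>t\<bar> * y" by (simp add: power2_sum)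
  show "1 / (\<bar>t\<bar> + y)\<^sup>2 \<le> 1 / (t\<^sup>2 + y\<^sup>2)"
    using p q assms by (intro divide_left_mono) (auto simp: e)
  have "(\<bar>t\<bar> + y)\<^sup>2 \<le> 2 * (t\<^sup>2 + y\<^sup>2)"
    using zero_le_power2[of "\<bar>t\<bar> - y"] by (simp add: power2_diff power2_sum)
  then show "1 / (t\<^sup>2 + y\<^sup>2) \<le> 2 / (\<bar>t\<bar> + y)\<^sup>2"
  proof -
    assume le: "(\<bar>t\<bar> + y)\<^sup>2 \<le> 2 * (t\<^sup>2 + y\<^sup>2)"
    have "1 / (t\<^sup>2 + y\<^sup>2) = 2 / (2 * (t\<^sup>2 + y\<^sup>2))"
      by (simp del: distrib_left_numeral)
    also have "\<dots> \<le> 2 / (\<bar>t\<bar> + y)\<^sup>2"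
    proof (rule divide_left_mono[OF le])
      show "0 < 2 * (t\<^sup>2 + y\<^sup>2) * (\<bar>t\<bar> + y)\<^sup>2"
        by (rule mult_pos_pos[OF mult_pos_pos[OF zero_less_numeral p] q])
    qed simp
    finally show ?thesis .
  qed
  show "1 / (t\<^sup>2 + y\<^sup>2) \<le> 1 / y\<^sup>2" using p assms by (intro divide_left_mono) auto
qed

lemma tau_eventually_bounded:
  fixes \<tau> :: "complex \<Rightarrow> complex"
  assumes "(\<tau> \<longlongrightarrow> 0) nontangential"
  obtains Y where "1 \<le> Y" "\<And>y. Y \<le> y \<Longrightarrow> norm (\<tau> (\<i> * of_real y)) \<le> 1"
proof -
  have "((\<lambda>y. norm (\<tau> (\<i> * of_real y))) \<longlongrightarrow> norm (0 :: complex)) at_top"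
    by (intro tendsto_norm filterlim_compose[OF assms filterlim_imaginary_axis])
  then have "\<forall>\<^sub>F y in at_top. norm (\<tau> (\<i> * of_real y)) < 1" by (intro order_tendstoD) auto
  then obtain Y where Y: "\<And>y. Y \<le> y \<Longrightarrow> norm (\<tau> (\<i> * of_real y)) < 1"
    by (auto simp: eventually_at_top_linorder)
  show ?thesis
  proof (rule that)
    show "norm (\<tau> (\<i> * of_real y)) \<le> 1" if "max Y 1 \<le> y" for y using Y[of y] that by simp
  qed simp
qed

text \<open>For large y the value c = \<tau>(i y) satisfies |c| \<le> 1, so |N(t)|^2 \<le> 2 V(t)
  with V = P^2 + \<open>P'\<close>^2, uniformly in c. V has degree 2n + 2, one more than the order
  of the available moments, as \<open>poly_kac_integrable\<close> allows.\<close>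

lemma kac_forward:
  assumes \<mu>: "moment_solution s (2 * n + 1) \<mu>" and hol: "\<tau> holomorphic_on - \<real>" and lim: "(\<tau> \<longlongrightarrow> 0) nontangential"
    and eq: "\<And>z. 0 < Im z \<Longrightarrow> has_bochner_integral \<mu> (\<lambda>t. (norm (poly (den (\<tau> z)) (of_real t) / (of_real t - z)))\<^sup>2) (h * a * Im (\<tau> z) / Im z)"
  shows "\<forall>\<^sub>F \<eta> in at_top. set_integrable lborel {\<eta><..} (\<lambda>y. \<bar>Im (\<tau> (\<i> * of_real y))\<bar> / y)"
proof -
  obtain Y where Y: "1 \<le> Y" "\<And>y. Y \<le> y \<Longrightarrow> norm (\<tau> (\<i> * of_real y)) \<le> 1"
    using tau_eventually_bounded[OF lim] by blast
  have sets: "sets \<mu> = sets borel" using \<mu> by (simp add: moment_solution_def)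
  have [measurable_cong]: "sets \<mu> = sets borel" by fact
  have fin: "finite_measure \<mu>" by (rule moment_solution_finite_measure[OF \<mu>])
  define V where "V = P * P + P' * P'"
  have Vt: "poly V t = (poly P t)\<^sup>2 + (poly P' t)\<^sup>2" for t by (simp add: V_def power2_eq_square)
  have degV: "degree V \<le> 2 * n + 1 + 1"
    unfolding V_def by (intro degree_add_le order.trans[OF degree_mult_le]) auto
  \<comment> \<open>One factor 2 comes from the square of a sum, the other from
    \<open>kernel_bounds\<close>, and \<open>h * a\<close> from the assumption
    \<open>eq\<close>.\<close>
  define C where "C = 4 / (h * a)"
  have C: "0 < C" using h_pos a_pos by (simp add: C_def)
  have bound: "ennreal (\<bar>Im (\<tau> (\<i> * of_real y))\<bar> / y) \<le> (\<integral>\<^sup>+t. ennreal (C * poly V t / (\<bar>t\<bar> + y)\<^sup>2) \<partial>\<mu>)"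
    if y: "Y \<le> y" for y
  proof -
    define c where "c = \<tau> (\<i> * of_real y)"
    have y0: "0 < y" using y Y by simp
    have c1: "norm c \<le> 1" using Y(2)[OF y] by (simp add: c_def)
    have I: "has_bochner_integral \<mu> (\<lambda>t. (norm (poly (den c) (of_real t)))\<^sup>2 / (t\<^sup>2 + y\<^sup>2)) (h * a * Im c / y)"
      using eq[of "\<i> * of_real y"] y0 unfolding c_def[symmetric] norm_den_quotient by simp
    have nn: "0 \<le> h * a * Im c / y"
      by (rule has_bochner_integral_le[OF has_bochner_integral_zero I]) simp
    moreover have "0 < h * a" using h_pos a_pos by simp
    ultimately have "0 \<le> Im c" using y0 by (auto simp: zero_le_divide_iff zero_le_mult_iff)
    then have "ennreal (\<bar>Im c\<bar> / y) = ennreal (1 / (h * a)) * ennreal (h * a * Im c / y)"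
      using h_pos a_pos nn by (simp add: ennreal_mult[symmetric])
    also have "ennreal (h * a * Im c / y) = (\<integral>\<^sup>+t. ennreal ((norm (poly (den c) (of_real t)))\<^sup>2 / (t\<^sup>2 + y\<^sup>2)) \<partial>\<mu>)"
      using I by (subst nn_integral_eq_integral) (auto simp: has_bochner_integral_iff)
    also have "\<dots> \<le> (\<integral>\<^sup>+t. ennreal (4 * poly V t / (\<bar>t\<bar> + y)\<^sup>2) \<partial>\<mu>)"
    proof (intro nn_integral_mono ennreal_leI)
      fix t
      have "(norm (poly (den c) (of_real t)))\<^sup>2 \<le> 2 * (norm (of_real (poly P t) * c))\<^sup>2 + 2 * (norm (of_real (poly P' t) :: complex))\<^sup>2"
        unfolding den_of_real by (rule norm_sum_square_le)
      also have "\<dots> \<le> 2 * (poly P t)\<^sup>2 * 1 + 2 * (poly P' t)\<^sup>2"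
        using c1 by (auto simp: norm_mult power_mult_distrib abs_square_le_1 intro!: mult_left_le)
      also have "\<dots> = 2 * poly V t" by (simp add: Vt)
      finally have "(norm (poly (den c) (of_real t)))\<^sup>2 * (1 / (t\<^sup>2 + y\<^sup>2)) \<le> 2 * poly V t * (2 / (\<bar>t\<bar> + y)\<^sup>2)"
        using kernel_bounds(2)[OF y0] y0 by (intro mult_mono) (auto simp: Vt)
      then show "(norm (poly (den c) (of_real t)))\<^sup>2 / (t\<^sup>2 + y\<^sup>2) \<le> 4 * poly V t / (\<bar>t\<bar> + y)\<^sup>2" by simp
    qed
    also have "ennreal (1 / (h * a)) * (\<integral>\<^sup>+t. ennreal (4 * poly V t / (\<bar>t\<bar> + y)\<^sup>2) \<partial>\<mu>) =
        (\<integral>\<^sup>+t. ennreal (1 / (h * a)) * ennreal (4 * poly V t / (\<bar>t\<bar> + y)\<^sup>2) \<partial>\<mu>)"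
      by (rule nn_integral_cmult[symmetric]) measurable
    also have "\<dots> = (\<integral>\<^sup>+t. ennreal (C * poly V t / (\<bar>t\<bar> + y)\<^sup>2) \<partial>\<mu>)"
      using h_pos a_pos by (intro nn_integral_cong) (simp add: ennreal_mult[symmetric] C_def Vt)
    finally show ?thesis by (simp add: c_def mult_left_mono)
  qed
  have "set_integrable lborel {\<eta><..} (\<lambda>y. \<bar>Im (\<tau> (\<i> * of_real y))\<bar> / y)" if \<eta>: "Y \<le> \<eta>" for \<eta>
    unfolding set_integrable_def
  proof (rule integrableI_nonneg)
    have "continuous_on {\<eta><..} (\<lambda>y. \<bar>Im (\<tau> (\<i> * of_real y))\<bar> / y)"
      using \<eta> Y by (intro continuous_intros continuous_on_compose2[OF holomorphic_on_imp_continuous_on[OF hol]])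
        (auto simp: complex_is_Real_iff)
    then show "(\<lambda>y. indicator {\<eta><..} y *\<^sub>R (\<bar>Im (\<tau> (\<i> * of_real y))\<bar> / y)) \<in> borel_measurable lborel"
      using borel_measurable_continuous_on_indicator[of "{\<eta><..}" "\<lambda>y. \<bar>Im (\<tau> (\<i> * of_real y))\<bar> / y"] by simp
    show "AE y in lborel. 0 \<le> indicator {\<eta><..} y *\<^sub>R (\<bar>Im (\<tau> (\<i> * of_real y))\<bar> / y)"
      using \<eta> Y by (intro AE_I2) (auto split: split_indicator)
    have "(\<integral>\<^sup>+y. ennreal (indicator {\<eta><..} y *\<^sub>R (\<bar>Im (\<tau> (\<i> * of_real y))\<bar> / y)) \<partial>lborel) \<le>
       (\<integral>\<^sup>+y. (\<integral>\<^sup>+t. ennreal (C * poly V t / (\<bar>t\<bar> + y)\<^sup>2) * indicator {\<eta>..} y \<partial>\<mu>) \<partial>lborel)"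
      using bound \<eta> by (intro nn_integral_mono) (auto split: split_indicator)
    also have "\<dots> = (\<integral>\<^sup>+t. ennreal (C * poly V t / (\<bar>t\<bar> + \<eta>)) \<partial>\<mu>)"
      using C \<eta> Y by (intro nn_integral_kac sets fin) (auto simp: Vt)
    also have "\<dots> < \<infinity>"
      using poly_kac_integrable[OF \<mu>, of "smult C V" \<eta>] degV \<eta> Y C by (auto simp: Vt)
    finally show "(\<integral>\<^sup>+y. ennreal (indicator {\<eta><..} y *\<^sub>R (\<bar>Im (\<tau> (\<i> * of_real y))\<bar> / y)) \<partial>lborel) < \<infinity>" .
  qed
  then show ?thesis by (auto simp: eventually_at_top_linorder)
qed

text \<open>Here \<open>P'\<close>^2 has to be bounded by |N|^2, through \<open>P'\<close> = N - c P
  with |c| \<le> 1. The error P^2 / y^2 is integrable in t and y together, since the moments at hand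
  cover the degree 2n of P^2. So \<open>P'\<close>^2 / (|t| + \<eta>) is integrable, and it controls
  |t|^(2n + 1).\<close>

lemma kac_backward:
  assumes \<mu>: "moment_solution s (2 * n) \<mu>" and lim: "(\<tau> \<longlongrightarrow> 0) nontangential"
    and eq: "\<And>z. 0 < Im z \<Longrightarrow> has_bochner_integral \<mu> (\<lambda>t. (norm (poly (den (\<tau> z)) (of_real t) / (of_real t - z)))\<^sup>2) (h * a * Im (\<tau> z) / Im z)"
    and int: "\<forall>\<^sub>F \<eta> in at_top. set_integrable lborel {\<eta><..} (\<lambda>y. \<bar>Im (\<tau> (\<i> * of_real y))\<bar> / y)"
  shows "integrable \<mu> (\<lambda>t. \<bar>t\<bar> ^ (2 * n + 1))"
proof -
  obtain Y where Y: "1 \<le> Y" "\<And>y. Y \<le> y \<Longrightarrow> norm (\<tau> (\<i> * of_real y)) \<le> 1"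
    using tau_eventually_bounded[OF lim] by blast
  have sets: "sets \<mu> = sets borel" using \<mu> by (simp add: moment_solution_def)
  have [measurable_cong]: "sets \<mu> = sets borel" by fact
  have fin: "finite_measure \<mu>" by (rule moment_solution_finite_measure[OF \<mu>])
  interpret finite_measure \<mu> by fact
  obtain \<eta>0 where \<eta>0: "Y \<le> \<eta>0" "set_integrable lborel {\<eta>0<..} (\<lambda>y. \<bar>Im (\<tau> (\<i> * of_real y))\<bar> / y)"
  proof -
    have "\<forall>\<^sub>F \<eta> in at_top. Y \<le> \<eta> \<and> set_integrable lborel {\<eta><..} (\<lambda>y. \<bar>Im (\<tau> (\<i> * of_real y))\<bar> / y)"
      using int eventually_ge_at_top[of Y] by eventually_elim simp
    then show ?thesis using that eventually_happens[of _ "at_top :: real filter"] by auto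
  qed
  define \<eta> where "\<eta> = \<eta>0 + 1"
  have \<eta>: "Y \<le> \<eta>" "0 < \<eta>" using \<eta>0 Y by (auto simp: \<eta>_def)
  define V where "V t = (poly P' t)\<^sup>2" for t
  have Vm [measurable]: "V \<in> borel_measurable borel" unfolding V_def by measurable
  define K where "K = (\<integral>t. 2 * (poly P t)\<^sup>2 \<partial>\<mu>)"
  have intP: "integrable \<mu> (\<lambda>t. 2 * (poly P t)\<^sup>2)"
  proof -
    have "degree (smult 2 (P * P)) \<le> 2 * n" using degree_mult_le[of P P] by simp
    from poly_integrable[OF \<mu> this]
    have "integrable \<mu> (\<lambda>t. poly (smult 2 (P * P)) t)" .
    then show ?thesis by (simp only: poly_smult poly_mult power2_eq_square)
  qed
  have K: "0 \<le> K" unfolding K_def by (intro integral_nonneg_AE) auto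
  define g where "g y = indicator {\<eta>0<..} y * (\<bar>Im (\<tau> (\<i> * of_real y))\<bar> / y)" for y
  have gint: "integrable lborel g" using \<eta>0(2) unfolding set_integrable_def g_def by simp
  have gnn: "0 \<le> g y" for y using \<eta>0 Y by (auto simp: g_def split: split_indicator)
  have bound: "(\<integral>\<^sup>+t. ennreal (V t / (\<bar>t\<bar> + y)\<^sup>2) * indicator {\<eta>..} y \<partial>\<mu>) \<le>
      ennreal (2 * (h * a)) * ennreal (g y) + ennreal K * (ennreal (1 / (0 + y)\<^sup>2) * indicator {\<eta>..} y)" for y
  proof (cases "\<eta> \<le> y")
    case True
    define c where "c = \<tau> (\<i> * of_real y)"
    have y0: "0 < y" using True \<eta> by simp
    have c1: "norm c \<le> 1" using Y(2)[of y] True \<eta> by (simp add: c_def)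
    have I: "has_bochner_integral \<mu> (\<lambda>t. (norm (poly (den c) (of_real t)))\<^sup>2 / (t\<^sup>2 + y\<^sup>2)) (h * a * Im c / y)"
      using eq[of "\<i> * of_real y"] y0 unfolding c_def[symmetric] norm_den_quotient by simp
    have "has_bochner_integral \<mu> (\<lambda>t. 2 * ((norm (poly (den c) (of_real t)))\<^sup>2 / (t\<^sup>2 + y\<^sup>2)) + 2 * (poly P t)\<^sup>2 / y\<^sup>2)
        (2 * (h * a * Im c / y) + K / y\<^sup>2)"
      using intP by (intro has_bochner_integral_add has_bochner_integral_mult_right has_bochner_integral_divide_zero I)
        (simp add: has_bochner_integral_iff K_def)
    then have "(\<integral>\<^sup>+t. ennreal (2 * ((norm (poly (den c) (of_real t)))\<^sup>2 / (t\<^sup>2 + y\<^sup>2)) + 2 * (poly P t)\<^sup>2 / y\<^sup>2) \<partial>\<mu>) =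
        ennreal (2 * (h * a * Im c / y) + K / y\<^sup>2)"
      by (subst nn_integral_eq_integral) (auto simp: has_bochner_integral_iff)
    moreover have "(\<integral>\<^sup>+t. ennreal (V t / (\<bar>t\<bar> + y)\<^sup>2) \<partial>\<mu>) \<le>
        (\<integral>\<^sup>+t. ennreal (2 * ((norm (poly (den c) (of_real t)))\<^sup>2 / (t\<^sup>2 + y\<^sup>2)) + 2 * (poly P t)\<^sup>2 / y\<^sup>2) \<partial>\<mu>)"
    proof (intro nn_integral_mono ennreal_leI)
      fix t
      have "V t = (norm (poly (den c) (of_real t) + - (of_real (poly P t) * c)))\<^sup>2"
        by (simp add: den_of_real V_def)
      also have "\<dots> \<le> 2 * (norm (poly (den c) (of_real t)))\<^sup>2 + 2 * (norm (- (of_real (poly P t) * c)))\<^sup>2"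
        by (rule norm_sum_square_le)
      also have "\<dots> \<le> 2 * (norm (poly (den c) (of_real t)))\<^sup>2 + 2 * (poly P t)\<^sup>2"
        using c1 by (auto simp: norm_mult power_mult_distrib abs_square_le_1 intro!: mult_left_le)
      finally have "V t * (1 / (t\<^sup>2 + y\<^sup>2)) \<le> (2 * (norm (poly (den c) (of_real t)))\<^sup>2 + 2 * (poly P t)\<^sup>2) * (1 / (t\<^sup>2 + y\<^sup>2))"
        by (intro mult_right_mono) auto
      moreover have "V t * (1 / (\<bar>t\<bar> + y)\<^sup>2) \<le> V t * (1 / (t\<^sup>2 + y\<^sup>2))"
        using kernel_bounds(1)[OF y0] by (intro mult_left_mono) (auto simp: V_def)
      moreover have "2 * (poly P t)\<^sup>2 * (1 / (t\<^sup>2 + y\<^sup>2)) \<le> 2 * (poly P t)\<^sup>2 * (1 / y\<^sup>2)"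
        using kernel_bounds(3)[OF y0] by (intro mult_left_mono) auto
      ultimately show "V t / (\<bar>t\<bar> + y)\<^sup>2 \<le> 2 * ((norm (poly (den c) (of_real t)))\<^sup>2 / (t\<^sup>2 + y\<^sup>2)) + 2 * (poly P t)\<^sup>2 / y\<^sup>2"
        by (simp add: distrib_right add_divide_distrib)
    qed
    ultimately have "(\<integral>\<^sup>+t. ennreal (V t / (\<bar>t\<bar> + y)\<^sup>2) \<partial>\<mu>) \<le> ennreal (2 * (h * a * Im c / y) + K / y\<^sup>2)" by simp
    also have "\<dots> \<le> ennreal (2 * (h * a) * g y + K * (1 / (0 + y)\<^sup>2))"
    proof (intro ennreal_leI add_mono)
      have "Im c / y \<le> g y" using True y0 by (simp add: g_def c_def \<eta>_def divide_right_mono)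
      then have "2 * (h * a) * (Im c / y) \<le> 2 * (h * a) * g y"
        using h_pos a_pos by (intro mult_left_mono) auto
      then show "2 * (h * a * Im c / y) \<le> 2 * (h * a) * g y" by simp
    qed simp
    also have "\<dots> = ennreal (2 * (h * a)) * ennreal (g y) + ennreal K * ennreal (1 / (0 + y)\<^sup>2)"
    proof -
      have "ennreal (b * u + v * w) = ennreal b * ennreal u + ennreal v * ennreal w"
        if "0 \<le> b" "0 \<le> u" "0 \<le> v" "0 \<le> w" for b u v w
        using that by (simp add: ennreal_plus ennreal_mult)
      from this[of "2 * (h * a)" "g y" K "1 / (0 + y)\<^sup>2"] show ?thesis
        using K gnn[of y] h_pos a_pos by simp
    qed
    finally show ?thesis using True by simp
  qed simp
  have "(\<integral>\<^sup>+t. ennreal (V t / (\<bar>t\<bar> + \<eta>)) \<partial>\<mu>) = (\<integral>\<^sup>+y. (\<integral>\<^sup>+t. ennreal (V t / (\<bar>t\<bar> + y)\<^sup>2) * indicator {\<eta>..} y \<partial>\<mu>) \<partial>lborel)"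
    using \<eta> by (intro nn_integral_kac[symmetric] sets fin) (auto simp: V_def)
  also have "\<dots> \<le> (\<integral>\<^sup>+y. ennreal (2 * (h * a)) * ennreal (g y) + ennreal K * (ennreal (1 / (0 + y)\<^sup>2) * indicator {\<eta>..} y) \<partial>lborel)"
    by (intro nn_integral_mono bound)
  also have "\<dots> = ennreal (2 * (h * a)) * (\<integral>\<^sup>+y. ennreal (g y) \<partial>lborel) + ennreal K * (\<integral>\<^sup>+y. ennreal (1 / (0 + y)\<^sup>2) * indicator {\<eta>..} y \<partial>lborel)"
  proof -
    have [measurable]: "g \<in> borel_measurable borel" using gint by auto
    show ?thesis by (subst nn_integral_add) (simp_all add: nn_integral_cmult)
  qed
  also have "(\<integral>\<^sup>+y. ennreal (1 / (0 + y)\<^sup>2) * indicator {\<eta>..} y \<partial>lborel) = ennreal (1 / (0 + \<eta>))"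
    using \<eta> by (intro nn_integral_inverse_square) auto
  also have "(\<integral>\<^sup>+y. ennreal (g y) \<partial>lborel) = ennreal (\<integral>y. g y \<partial>lborel)"
    using gint gnn by (intro nn_integral_eq_integral) auto
  finally have "(\<integral>\<^sup>+t. ennreal (V t / (\<bar>t\<bar> + \<eta>)) \<partial>\<mu>) < \<infinity>"
    by (rule le_less_trans) (simp add: ennreal_mult_less_top)
  then have V: "integrable \<mu> (\<lambda>t. V t / (\<bar>t\<bar> + \<eta>))"
    using \<eta> by (intro integrableI_nonneg) (auto simp: V_def)
  obtain B C where BC: "0 \<le> B" "0 \<le> C" "\<And>t. \<bar>t\<bar> ^ (2 * n + 1) \<le> B + C * (V t / (\<bar>t\<bar> + \<eta>))"
    using poly_square_lower_bound[of P' n \<eta>] \<eta> unfolding V_def by auto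
  show ?thesis
  proof (rule Bochner_Integration.integrable_bound)
    show "integrable \<mu> (\<lambda>t. B + C * (V t / (\<bar>t\<bar> + \<eta>)))"
      using V by (intro Bochner_Integration.integrable_add integrable_const integrable_mult_right)
    have "norm (\<bar>t\<bar> ^ (2 * n + 1)) \<le> norm (B + C * (V t / (\<bar>t\<bar> + \<eta>)))" for t
    proof -
      have "norm (\<bar>t\<bar> ^ (2 * n + 1)) = \<bar>t\<bar> ^ (2 * n + 1)" by (simp only: real_norm_def power_abs[symmetric] abs_abs)
      also note BC(3)[of t]
      finally show ?thesis by simp
    qed
    then show "AE t in \<mu>. norm (\<bar>t\<bar> ^ (2 * n + 1)) \<le> norm (B + C * (V t / (\<bar>t\<bar> + \<eta>)))" by blast
  qed measurable
qed

end

section \<open>Solutions of the moment problem\<close>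

lemma orthogonal_poly_norm_pos:
  assumes pos: "hankel_pos_def s n" and k: "k \<le> n" and p: "orthogonal_poly s k p"
  shows "0 < moment_functional s (p * monom 1 k)" "0 < moment_functional s (p * p)"
proof -
  define R where "R = (map_poly of_real p :: complex poly)"
  have deg: "degree p = k" and lead: "0 < lead_coeff p" using p by (auto simp: orthogonal_poly_def)
  have "p \<noteq> 0" using lead by auto
  then have "R \<noteq> 0" using lead by (auto simp: R_def poly_eq_iff coeff_map_poly)
  then have "0 < Re (moment_functional s (R * map_poly cnj R))"
    using deg k by (intro hankel_pos[OF pos]) (auto simp: R_def)
  then have R: "0 < Re (moment_functional s (R * R))" by (simp add: R_def)
  have "moment_functional s (R * R) = of_real (moment_functional s (p * monom 1 k)) * of_real (lead_coeff p)"
    unfolding R_def using deg by (subst orthogonal_poly_mult[OF p]) (simp_all add: coeff_map_poly)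
  with R have "0 < moment_functional s (p * monom 1 k) * lead_coeff p" by simp
  then show "0 < moment_functional s (p * monom 1 k)" using lead by (rule zero_less_mult_pos2)
  have "R * R = map_poly of_real (p * p)" by (simp add: R_def map_poly_of_real_mult)
  with R show "0 < moment_functional s (p * p)" by (simp add: moment_functional_of_real)
qed

lemma orthogonal_poly_monomI:
  fixes r :: "real poly"
  assumes "r = 0 \<or> degree r < k" "\<And>i. i < k \<Longrightarrow> moment_functional s ((monom 1 k - r) * monom 1 i) = 0"
  shows "orthogonal_poly s k (monom 1 k - r)"
proof -
  have c: "coeff (monom 1 k - r) k = 1" using assms(1) by (auto simp: coeff_eq_0)
  have "degree (monom 1 k - r) \<le> k" using assms(1) by (intro degree_diff_le) (auto simp: degree_monom_le)
  moreover have "k \<le> degree (monom 1 k - r)" using c by (intro le_degree) simp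
  ultimately have "degree (monom 1 k - r) = k" by simp
  with c assms(2) show ?thesis by (simp add: orthogonal_poly_def)
qed

text \<open>Gram-Schmidt. The induction hypothesis is applied to t^k, which gives an orthogonal
  polynomial p of degree k, and to q; a multiple of p then corrects the projection of q. Hence q is
  arbitrary in the induction. The step divides by S(p t^k) with k \<le> n only, so positivity up to
  degree n suffices to reach degree n + 1.\<close>

lemma orthogonal_projection_exists:
  fixes q :: "real poly"
  assumes pos: "hankel_pos_def s n"
  shows "k \<le> n + 1 \<Longrightarrow> \<exists>r. (r = 0 \<or> degree r < k) \<and> (\<forall>i<k. moment_functional s ((q - r) * monom 1 i) = 0)"
proof (induction k arbitrary: q)
  case (Suc k)
  then have k: "k \<le> n" by simp
  from Suc obtain r0 :: "real poly" where r0: "r0 = 0 \<or> degree r0 < k"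
      "\<And>i. i < k \<Longrightarrow> moment_functional s ((monom 1 k - r0) * monom 1 i) = 0"
    by (metis Suc_leD)
  define p where "p = monom 1 k - r0"
  have p: "orthogonal_poly s k p" unfolding p_def by (rule orthogonal_poly_monomI) (use r0 in auto)
  define d where "d = moment_functional s (p * monom 1 k)"
  have d: "0 < d" unfolding d_def by (rule orthogonal_poly_norm_pos[OF pos k p])
  from Suc obtain r where r: "r = 0 \<or> degree r < k"
      "\<And>i. i < k \<Longrightarrow> moment_functional s ((q - r) * monom 1 i) = 0"
    by (metis Suc_leD)
  define e where "e = moment_functional s ((q - r) * monom 1 k)"
  have "degree (r + smult (e / d) p) < Suc k"
  proof -
    have "degree (smult (e / d) p) \<le> k"
      using p degree_smult_le[of "e / d" p] by (simp add: orthogonal_poly_def)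
    moreover have "degree r \<le> k" using r(1) by auto
    ultimately show ?thesis by (simp add: degree_add_le less_Suc_eq_le)
  qed
  moreover have "moment_functional s ((q - (r + smult (e / d) p)) * monom 1 i) = 0" if "i < Suc k" for i
  proof -
    have "(q - (r + smult (e / d) p)) * monom 1 i = (q - r) * monom 1 i - smult (e / d) (p * monom 1 i)"
      by (simp add: algebra_simps)
    then have *: "moment_functional s ((q - (r + smult (e / d) p)) * monom 1 i) =
        moment_functional s ((q - r) * monom 1 i) - e / d * moment_functional s (p * monom 1 i)"
      by (simp only: moment_functional_diff moment_functional_smult)
    show ?thesis
    proof (cases "i = k")
      case True
      then show ?thesis using d unfolding * by (simp add: e_def[symmetric] d_def[symmetric])
    next
      case False
      then have "i < k" using that by simp
      then show ?thesis using r(2) p unfolding * by (simp add: orthogonal_poly_def)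
    qed
  qed
  ultimately show ?case by blast
qed auto

lemma orthogonal_poly_exists:
  assumes "hankel_pos_def s n" "k \<le> n + 1"
  shows "\<exists>p. orthogonal_poly s k p"
  using orthogonal_projection_exists[OF assms, of "monom 1 k"] orthogonal_poly_monomI by blast

lemma orthonormal_poly_exists:
  assumes pos: "hankel_pos_def s n"
  shows "\<exists>p. orthonormal_poly s n p"
proof -
  obtain p where p: "orthogonal_poly s n p" using orthogonal_poly_exists[OF pos, of n] by auto
  define d where "d = moment_functional s (p * p)"
  have d: "0 < d" unfolding d_def by (rule orthogonal_poly_norm_pos[OF pos _ p]) simp
  define q where "q = smult (1 / sqrt d) p"
  have "moment_functional s (q * monom 1 i) = 1 / sqrt d * moment_functional s (p * monom 1 i)" for i
    by (simp only: q_def mult_smult_left moment_functional_smult)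
  moreover have "degree p = n" "0 < coeff p n" using p by (auto simp: orthogonal_poly_def)
  ultimately have "orthogonal_poly s n q" using p d by (simp add: orthogonal_poly_def q_def)
  moreover have "moment_functional s (q ^ 2) = 1"
  proof -
    have "q ^ 2 = smult (1 / d) (p * p)" using d by (simp add: q_def power2_eq_square real_sqrt_mult_self)
    then show ?thesis using d by (simp add: moment_functional_smult d_def[symmetric])
  qed
  ultimately show ?thesis by (auto simp: orthonormal_poly_def)
qed

section \<open>Holomorphy of Cauchy transforms\<close>

lemma norm_stieltjes_kernel_le:
  fixes z :: complex
  assumes "z \<notin> \<real>"
  shows "norm (1 / (of_real t - z)) \<le> 1 / \<bar>Im z\<bar>"
proof -
  have "\<bar>Im z\<bar> \<le> norm (of_real t - z)" using abs_Im_le_cmod[of "of_real t - z"] by simp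
  moreover have "0 < \<bar>Im z\<bar>" using assms by (simp add: complex_is_Real_iff)
  ultimately show ?thesis by (simp add: norm_divide frac_le)
qed

lemma stieltjes_kernel_integrable:
  fixes z :: complex
  assumes sets: "sets \<mu> = sets borel" and fin: "finite_measure \<mu>" and z: "z \<notin> \<real>"
  shows "integrable \<mu> (\<lambda>t. 1 / (of_real t - z))"
proof -
  interpret finite_measure \<mu> by fact
  have [measurable_cong]: "sets \<mu> = sets borel" by fact
  show ?thesis
    by (rule integrable_const_bound[where B = "1 / \<bar>Im z\<bar>"]) (use norm_stieltjes_kernel_le[OF z] in auto)
qed

text \<open>For u = t - w and v = t - z the error of the difference quotient of the kernel is (w -
  z) / (u v^2). It is bounded uniformly in t, so it can be integrated against the finite
  measure.\<close>

lemma stieltjes_holomorphic: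
  assumes sets: "sets \<mu> = sets borel" and fin: "finite_measure \<mu>"
  shows "(\<lambda>z. \<integral>t. 1 / (of_real t - z) \<partial>\<mu>) holomorphic_on - \<real>"
proof -
  interpret finite_measure \<mu> by fact
  have [measurable_cong]: "sets \<mu> = sets borel" by fact
  define \<phi> where "\<phi> z = (\<integral>t. 1 / (of_real t - z) \<partial>\<mu>)" for z :: complex
  have "(\<phi> has_field_derivative (\<integral>t. (1 / (of_real t - z))\<^sup>2 \<partial>\<mu>)) (at z)" if z: "z \<in> - \<real>" for z
  proof -
    define d where "d = \<bar>Im z\<bar>"
    have d: "0 < d" using z by (simp add: d_def complex_is_Real_iff)
    define D where "D = (\<integral>t. (1 / (of_real t - z))\<^sup>2 \<partial>\<mu>)"
    have kz: "norm (1 / (of_real t - z)) \<le> 1 / d" for t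
      using norm_stieltjes_kernel_le[of z t] z by (simp add: d_def)
    have D: "integrable \<mu> (\<lambda>t. (1 / (of_real t - z))\<^sup>2)"
    proof (rule integrable_const_bound[where B = "(1 / d)\<^sup>2"])
      show "AE t in \<mu>. norm ((1 / (of_real t - z))\<^sup>2) \<le> (1 / d)\<^sup>2"
        unfolding norm_power by (intro AE_I2 power_mono kz) simp
    qed measurable
    \<comment> \<open>Within d / 2 of z the kernel at w is at most 2 / d and the one at z at most 1
      / d, which gives 2 / d^3.\<close>
    have "norm ((\<phi> w - \<phi> z) / (w - z) - D) \<le> norm (w - z) * (2 / d ^ 3 * measure \<mu> (space \<mu>))"
      if w: "w \<noteq> z" "norm (w - z) < d / 2" for w
    proof -
      have "\<bar>Im w - Im z\<bar> < d / 2" using abs_Im_le_cmod[of "w - z"] w by simp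
      then have Imw: "d / 2 \<le> \<bar>Im w\<bar>" by (auto simp: d_def abs_if split: if_splits)
      then have wR: "w \<notin> \<real>" using d by (auto simp: complex_is_Real_iff)
      have kw: "norm (1 / (of_real t - w)) \<le> 2 / d" for t
      proof -
        have "1 / \<bar>Im w\<bar> \<le> 1 / (d / 2)" using Imw d by (intro divide_left_mono) auto
        then show ?thesis using norm_stieltjes_kernel_le[OF wR, of t] by simp
      qed
      have int: "integrable \<mu> (\<lambda>t. 1 / (of_real t - w))" "integrable \<mu> (\<lambda>t. 1 / (of_real t - z))"
        using stieltjes_kernel_integrable[OF sets fin] wR z by auto
      have "(\<phi> w - \<phi> z) / (w - z) - D = (\<integral>t. (1 / (of_real t - w) - 1 / (of_real t - z)) / (w - z) - (1 / (of_real t - z))\<^sup>2 \<partial>\<mu>)"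
        using int D by (simp add: \<phi>_def D_def)
      also have "norm \<dots> \<le> (\<integral>t. norm (w - z) * (2 / d ^ 3) \<partial>\<mu>)"
      proof (rule Bochner_Integration.integral_norm_bound_integral)
        show "integrable \<mu> (\<lambda>t. (1 / (of_real t - w) - 1 / (of_real t - z)) / (w - z) - (1 / (of_real t - z))\<^sup>2)"
          using int D by (intro Bochner_Integration.integrable_diff integrable_divide) auto
        fix t
        define u v where "u = of_real t - w" and "v = of_real t - z"
        have nz: "u \<noteq> 0" "v \<noteq> 0" using wR z by (auto simp: u_def v_def)
        have wz: "w - z = v - u" by (simp add: u_def v_def)
        have ne: "v - u \<noteq> 0" using w(1) unfolding wz[symmetric] by simp
        have uv: "1 / u - 1 / v = (v - u) * (1 / u * (1 / v))" using nz by (simp add: field_simps)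
        have "(1 / u - 1 / v) / (w - z) = 1 / u * (1 / v)"
          unfolding wz uv by (rule nonzero_mult_div_cancel_left[OF ne])
        then have "(1 / u - 1 / v) / (w - z) - (1 / v)\<^sup>2 = (1 / u - 1 / v) * (1 / v)"
          by (simp only: power2_eq_square left_diff_distrib)
        also have "\<dots> = (w - z) * (1 / u) * (1 / v) * (1 / v)"
          unfolding wz uv by simp
        finally have "norm ((1 / u - 1 / v) / (w - z) - (1 / v)\<^sup>2) = norm (w - z) * (norm (1 / u) * norm (1 / v) * norm (1 / v))"
          by (simp add: norm_mult norm_divide)
        also have "\<dots> \<le> norm (w - z) * (2 / d * (1 / d) * (1 / d))"
          using kw[of t] kz[of t] d unfolding u_def v_def by (intro mult_left_mono mult_mono) auto
        also have "2 / d * (1 / d) * (1 / d) = 2 / d ^ 3" by (simp add: power3_eq_cube)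
        finally show "norm ((1 / (of_real t - w) - 1 / (of_real t - z)) / (w - z) - (1 / (of_real t - z))\<^sup>2) \<le> norm (w - z) * (2 / d ^ 3)"
          by (simp only: u_def v_def)
      qed simp
      finally show ?thesis by (simp add: mult_ac)
    qed
    then have "\<forall>\<^sub>F w in at z. norm ((\<phi> w - \<phi> z) / (w - z) - D) \<le> norm (w - z) * (2 / d ^ 3 * measure \<mu> (space \<mu>))"
      using d by (auto simp: eventually_at dist_norm intro!: exI[of _ "d / 2"])
    moreover have "((\<lambda>w. norm (w - z) * (2 / d ^ 3 * measure \<mu> (space \<mu>))) \<longlongrightarrow> norm (z - z) * (2 / d ^ 3 * measure \<mu> (space \<mu>))) (at z)"
      by (intro tendsto_intros)
    then have "((\<lambda>w. norm (w - z) * (2 / d ^ 3 * measure \<mu> (space \<mu>))) \<longlongrightarrow> 0) (at z)" by simp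
    ultimately have "((\<lambda>w. (\<phi> w - \<phi> z) / (w - z) - D) \<longlongrightarrow> 0) (at z)"
      by (rule Lim_null_comparison)
    then have "((\<lambda>w. (\<phi> w - \<phi> z) / (w - z)) \<longlongrightarrow> D) (at z)" by (simp add: LIM_zero_iff)
    then show ?thesis by (simp add: has_field_derivative_iff D_def)
  qed
  then show ?thesis unfolding \<phi>_def[symmetric, abs_def]
    by (intro holomorphic_onI) (auto simp: field_differentiable_def intro: has_field_derivative_at_within)
qed

section \<open>The parametrization of the solutions\<close>

context hamburger_data
begin

lemma den_nonzero_nevanlinna:
  assumes \<tau>: "\<tau> \<in> nevanlinna" and z: "z \<notin> \<real>"
  shows "poly (den (\<tau> z)) z \<noteq> 0"
proof (cases "0 < Im z")
  case True
  then show ?thesis using \<tau> by (intro den_nonzero) (auto simp: nevanlinna_def)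
next
  case False
  then have "0 < Im (cnj z)" using z by (auto simp: complex_is_Real_iff)
  then have "poly (den (\<tau> (cnj z))) (cnj z) \<noteq> 0"
    using \<tau> by (intro den_nonzero) (auto simp: nevanlinna_def)
  moreover have "\<tau> (cnj z) = cnj (\<tau> z)" using \<tau> z by (auto simp: nevanlinna_def)
  ultimately have "cnj (poly (den (\<tau> z)) z) \<noteq> 0" by (simp add: poly_den cpoly_cnj)
  then show ?thesis by simp
qed

lemma lin_frac_nevanlinna:
  assumes \<tau>: "\<tau> \<in> nevanlinna"
  shows "lin_frac s P P' \<tau> \<in> nevanlinna"
  unfolding nevanlinna_def
proof (intro CollectI conjI ballI allI impI)
  have "\<tau> holomorphic_on - \<real>" using \<tau> by (simp add: nevanlinna_def)
  then show "lin_frac s P P' \<tau> holomorphic_on - \<real>"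
    unfolding lin_frac_def[abs_def] using den_nonzero_nevanlinna[OF \<tau>]
    by (intro holomorphic_intros) (auto simp: poly_den)
  fix z :: complex
  show "lin_frac s P P' \<tau> (cnj z) = cnj (lin_frac s P P' \<tau> z)" if "z \<in> - \<real>"
    using \<tau> that by (simp add: lin_frac_def cpoly_cnj second_kind_cnj nevanlinna_def)
  show "0 \<le> Im (lin_frac s P P' \<tau> z)" if "0 < Im z"
    by (rule less_imp_le, rule lin_frac_Im) (use \<tau> that in \<open>auto simp: nevanlinna_def\<close>)
qed

lemma lin_frac_asymp:
  assumes "\<tau> \<in> nevanlinna" "(\<tau> \<longlongrightarrow> 0) nontangential"
  shows "lin_frac s P P' \<tau> \<in> nevanlinna_asymp s (2 * n + 1)"
  unfolding nevanlinna_asymp_iff using lin_frac_nevanlinna[OF assms(1)] lin_frac_tendsto[OF assms(2)] by simp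

lemma lin_frac_zero:
  assumes "\<tau> \<in> nevanlinna" "z \<notin> \<real>"
  shows "poly (den (\<tau> z)) z * lin_frac s P P' \<tau> z + moment_functional s (num (\<tau> z) z) = 0"
  by (subst cross_zero_iff[OF den_nonzero_nevanlinna[OF assms]]) (simp add: lin_frac_eq)

text \<open>\<tau> enters as an arbitrary function. Solving the relation for it, which
  \<open>second_den_nonzero\<close> permits, gives holomorphy and symmetry, and
  \<open>tau_Im\<close> expresses Im \<tau> / Im z as a nonnegative integral up to a positive
  constant.\<close>

lemma tau_nevanlinna:
  assumes \<mu>: "moment_solution s (2 * n) \<mu>" and \<phi>: "cauchy_transform_eq \<mu> \<phi>"
    and hol: "\<phi> holomorphic_on - \<real>" and cnj: "\<And>z. z \<in> - \<real> \<Longrightarrow> \<phi> (cnj z) = cnj (\<phi> z)"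
    and zero: "\<And>z. z \<in> - \<real> \<Longrightarrow> poly (den (\<tau> z)) z * \<phi> z + moment_functional s (num (\<tau> z) z) = 0"
  shows "\<tau> \<in> nevanlinna"
proof -
  have nz: "cpoly P z * \<phi> z + second_kind s P z \<noteq> 0" if "z \<in> - \<real>" for z
    using that \<phi> by (intro second_den_nonzero[OF \<mu>]) (auto simp: cauchy_transform_eq_def)
  define T where "T z = - (cpoly P' z * \<phi> z + second_kind s P' z) / (cpoly P z * \<phi> z + second_kind s P z)" for z
  have \<tau>T: "\<tau> z = T z" if z: "z \<in> - \<real>" for z
  proof -
    have "\<tau> z * (cpoly P z * \<phi> z + second_kind s P z) + (cpoly P' z * \<phi> z + second_kind s P' z) = 0"
      using zero[OF z] by (simp add: poly_den moment_num algebra_simps)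
    then have "\<tau> z * (cpoly P z * \<phi> z + second_kind s P z) = - (cpoly P' z * \<phi> z + second_kind s P' z)"
      by (simp only: eq_neg_iff_add_eq_0)
    then show ?thesis unfolding T_def using nz[OF z] by (metis nonzero_mult_div_cancel_right)
  qed
  have "T holomorphic_on - \<real>"
    unfolding T_def using hol nz by (intro holomorphic_intros) auto
  then have "\<tau> holomorphic_on - \<real>" by (rule holomorphic_transform) (simp add: \<tau>T)
  moreover have "\<tau> (cnj z) = cnj (\<tau> z)" if "z \<in> - \<real>" for z
  proof -
    have "cnj z \<in> - \<real>" using that by (simp add: complex_is_Real_iff)
    then show ?thesis using that by (simp add: \<tau>T T_def cnj cpoly_cnj second_kind_cnj)
  qed
  moreover have "0 \<le> Im (\<tau> z)" if z: "0 < Im z" for z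
  proof -
    have zR: "z \<in> - \<real>" using z by (auto simp: complex_is_Real_iff)
    have "has_bochner_integral \<mu> (\<lambda>t. (norm (poly (den (\<tau> z)) (of_real t) / (of_real t - z)))\<^sup>2) (h * a * Im (\<tau> z) / Im z)"
      using \<phi> zR by (intro tau_Im[OF \<mu> _ _ zero]) (auto simp: cauchy_transform_eq_def)
    then have "0 \<le> h * a * Im (\<tau> z) / Im z"
      by (rule has_bochner_integral_le[OF has_bochner_integral_zero]) simp
    moreover have "0 < h * a" using h_pos a_pos by simp
    ultimately show ?thesis using z by (auto simp: zero_le_divide_iff zero_le_mult_iff)
  qed
  ultimately show ?thesis by (simp add: nevanlinna_def)
qed

text \<open>Im \<phi> / Im z is the integral of 1 / |t - z|^2, which vanishes only for the null
  measure, against s 0 > 0.\<close>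

lemma cauchy_transform_nonzero:
  fixes z :: complex
  assumes \<mu>: "moment_solution s (2 * n) \<mu>" and z: "z \<notin> \<real>"
    and \<phi>: "has_bochner_integral \<mu> (\<lambda>t. 1 / (of_real t - z)) \<phi>"
  shows "\<phi> \<noteq> 0"
proof
  assume "\<phi> = 0"
  have I: "has_bochner_integral \<mu> (\<lambda>t. Im (1 / (of_real t - z)) / Im z) 0"
    using has_bochner_integral_divide_zero[OF has_bochner_integral_Im[OF \<phi>], of "Im z"] \<open>\<phi> = 0\<close> by simp
  have Imz: "Im z \<noteq> 0" using z by (simp add: complex_is_Real_iff)
  have e: "Im (1 / (of_real t - z)) / Im z = 1 / (norm (of_real t - z))\<^sup>2" for t
    using Imz unfolding Im_divide cmod_power2 by simp
  have nz: "of_real t - z \<noteq> 0" for t using z by auto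
  have "AE t in \<mu>. 1 / (norm (of_real t - z))\<^sup>2 = 0"
    using I unfolding e by (subst integral_nonneg_eq_0_iff_AE[symmetric]) (auto simp: has_bochner_integral_iff)
  then have "AE t in \<mu>. t ^ 0 = (0 :: real)" by eventually_elim (use nz in simp)
  then have "(\<integral>t. t ^ 0 \<partial>\<mu>) = (0 :: real)" by (rule integral_eq_zero_AE)
  moreover have "has_bochner_integral \<mu> (\<lambda>t. t ^ 0) (s 0)" using \<mu> unfolding moment_solution_def by blast
  ultimately show False using s0_pos by (simp add: has_bochner_integral_iff)
qed

text \<open>Nothing is known about \<tau> at the start, so \<open>lin_frac\<close> cannot be
  inverted at once: zeros of its denominator are excluded only after \<phi> has been represented by
  a measure.\<close>

lemma nevanlinna_asymp_lin_fracD: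
  assumes \<phi>: "lin_frac s P P' \<tau> \<in> nevanlinna_asymp s (2 * n + 1)"
  shows "\<tau> \<in> nevanlinna" "(\<tau> \<longlongrightarrow> 0) nontangential"
proof -
  define \<phi> where "\<phi> = lin_frac s P P' \<tau>"
  have \<phi>_nev: "\<phi> \<in> nevanlinna"
    and asymp: "((\<lambda>z. z ^ (2 * n + 1 + 1) * (\<phi> z + moment_series s (2 * n + 1) z)) \<longlongrightarrow> 0) nontangential"
    using \<phi> by (auto simp: nevanlinna_asymp_iff \<phi>_def)
  obtain \<mu> where \<mu>: "cauchy_transform_eq \<mu> \<phi>" "moment_solution s (2 * n) \<mu>"
    using nevanlinna_asymp_measure[OF \<phi> s0_pos] by (auto simp: \<phi>_def)
  have zero: "poly (den (\<tau> z)) z * \<phi> z + moment_functional s (num (\<tau> z) z) = 0" if z: "z \<in> - \<real>" for z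
  proof -
    have "\<phi> z \<noteq> 0"
      using \<mu> z by (intro cauchy_transform_nonzero[OF \<mu>(2)]) (auto simp: cauchy_transform_eq_def)
    \<comment> \<open>where the denominator vanishes, division by zero makes \<open>lin_frac\<close> vanish\<close>
    then have "poly (den (\<tau> z)) z \<noteq> 0" by (auto simp: \<phi>_def lin_frac_eq)
    then show ?thesis by (subst cross_zero_iff) (simp_all add: \<phi>_def lin_frac_eq)
  qed
  show "\<tau> \<in> nevanlinna"
    using \<phi>_nev zero by (intro tau_nevanlinna[OF \<mu>(2,1)]) (auto simp: nevanlinna_def)
  show "(\<tau> \<longlongrightarrow> 0) nontangential"
  proof (rule tau_tendsto_0[OF asymp])
    show "\<forall>\<^sub>F z in nontangential. poly (den (\<tau> z)) z * \<phi> z + moment_functional s (num (\<tau> z) z) = 0"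
      using eventually_nontangential_Im_pos by eventually_elim (intro zero, auto simp: complex_is_Real_iff)
  qed
qed

text \<open>The expansion yields the moments up to order 2n, the integrability condition on \<tau>
  then makes |t|^(2n + 1) integrable, and uniqueness of the expansion gives the last moment its
  value.\<close>

lemma lin_frac_moment_solution:
  assumes \<tau>: "\<tau> \<in> nevanlinna_01" and lim: "(\<tau> \<longlongrightarrow> 0) nontangential"
    and sets: "sets \<mu> = sets borel" and \<mu>: "cauchy_transform_eq \<mu> (lin_frac s P P' \<tau>)"
  shows "moment_solution s (2 * n + 1) \<mu>"
proof -
  have nev: "\<tau> \<in> nevanlinna" using \<tau> by (simp add: nevanlinna_01_def)
  have real: "z \<notin> \<real>" if "0 < Im z" for z using that by (auto simp: complex_is_Real_iff)
  have int: "has_bochner_integral \<mu> (\<lambda>t. 1 / (of_real t - z)) (lin_frac s P P' \<tau> z)" if "0 < Im z" for z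
    using \<mu> real[OF that] by (auto simp: cauchy_transform_eq_def)
  have asymp: "((\<lambda>z. z ^ (2 * n + 1 + 1) * (lin_frac s P P' \<tau> z + moment_series s (2 * n + 1) z)) \<longlongrightarrow> 0) nontangential"
    by (rule lin_frac_tendsto[OF lim])
  have "((\<lambda>z. z ^ (2 * n + 1) * (lin_frac s P P' \<tau> z + moment_series s (2 * n) z)) \<longlongrightarrow> 0) nontangential"
    by (rule asymp_truncate[OF asymp]) simp
  from asymp_moment_solution[OF sets _ this] int
  have m: "moment_solution s (2 * n) \<mu>" by blast
  have "integrable \<mu> (\<lambda>t. \<bar>t\<bar> ^ (2 * n + 1))"
  proof (rule kac_backward[OF m lim])
    show "has_bochner_integral \<mu> (\<lambda>t. (norm (poly (den (\<tau> z)) (of_real t) / (of_real t - z)))\<^sup>2) (h * a * Im (\<tau> z) / Im z)"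
      if z: "0 < Im z" for z
      by (rule tau_Im[OF m real[OF z] int[OF z] lin_frac_zero[OF nev real[OF z]]])
  qed (use \<tau> in \<open>simp add: nevanlinna_01_def\<close>)
  moreover have "integrable \<mu> (\<lambda>t. t ^ 0)" using m unfolding moment_solution_def by (auto simp: has_bochner_integral_iff)
  ultimately have "integrable \<mu> (\<lambda>t. t ^ j)" if "j \<le> 2 * n + 1" for j
    using that by (intro power_integrable[OF sets]) simp_all
  then show ?thesis
    by (intro moment_solution_asymp_integrable[OF sets _ asymp] int)
qed

lemma lin_frac_moment_solution_exists:
  assumes \<tau>: "\<tau> \<in> nevanlinna_01" and lim: "(\<tau> \<longlongrightarrow> 0) nontangential"
  shows "\<exists>\<mu>. moment_solution s (2 * n + 1) \<mu> \<and> cauchy_transform_eq \<mu> (lin_frac s P P' \<tau>)"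
proof -
  have "\<tau> \<in> nevanlinna" using \<tau> by (simp add: nevanlinna_01_def)
  from nevanlinna_asymp_measure[OF lin_frac_asymp[OF this lim] s0_pos]
  obtain \<mu> where \<mu>: "cauchy_transform_eq \<mu> (lin_frac s P P' \<tau>)" "moment_solution s (2 * n) \<mu>" by blast
  moreover have "sets \<mu> = sets borel" using \<mu>(2) by (simp add: moment_solution_def)
  ultimately show ?thesis using lin_frac_moment_solution[OF \<tau> lim] by blast
qed

lemma moment_solution_lin_frac:
  assumes \<mu>: "moment_solution s (2 * n + 1) \<mu>"
  shows "\<exists>\<tau>\<in>nevanlinna_01. (\<tau> \<longlongrightarrow> 0) nontangential \<and> cauchy_transform_eq \<mu> (lin_frac s P P' \<tau>)"
proof -
  have sets: "sets \<mu> = sets borel" using \<mu> by (simp add: moment_solution_def)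
  have fin: "finite_measure \<mu>" by (rule moment_solution_finite_measure[OF \<mu>])
  have \<mu>': "moment_solution s (2 * n) \<mu>" using \<mu> by (simp add: moment_solution_def)
  define \<phi> where "\<phi> z = (\<integral>t. 1 / (of_real t - z) \<partial>\<mu>)" for z :: complex
  have \<phi>: "has_bochner_integral \<mu> (\<lambda>t. 1 / (of_real t - z)) (\<phi> z)" if "z \<notin> \<real>" for z
    using stieltjes_kernel_integrable[OF sets fin that] by (simp add: has_bochner_integral_iff \<phi>_def)
  have hol: "\<phi> holomorphic_on - \<real>" unfolding \<phi>_def by (rule stieltjes_holomorphic[OF sets fin])
  have cnj: "\<phi> (cnj z) = cnj (\<phi> z)" for z
    unfolding \<phi>_def by (simp flip: Bochner_Integration.integral_cnj)
  \<comment> \<open>The linear fractional relation solved for \<tau>.\<close>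
  define \<tau> where "\<tau> z = - (cpoly P' z * \<phi> z + second_kind s P' z) / (cpoly P z * \<phi> z + second_kind s P z)" for z
  have zero: "poly (den (\<tau> z)) z * \<phi> z + moment_functional s (num (\<tau> z) z) = 0" if z: "z \<in> - \<real>" for z
  proof -
    have "cpoly P z * \<phi> z + second_kind s P z \<noteq> 0"
      using z by (intro second_den_nonzero[OF \<mu>' _ \<phi>]) auto
    then have "\<tau> z * (cpoly P z * \<phi> z + second_kind s P z) = - (cpoly P' z * \<phi> z + second_kind s P' z)"
      unfolding \<tau>_def by simp
    then have "\<tau> z * (cpoly P z * \<phi> z + second_kind s P z) + (cpoly P' z * \<phi> z + second_kind s P' z) = 0"
      by (simp only: eq_neg_iff_add_eq_0)
    then show ?thesis by (simp add: poly_den moment_num algebra_simps)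
  qed
  have ct: "cauchy_transform_eq \<mu> \<phi>" using \<phi> by (simp add: cauchy_transform_eq_def)
  have nev: "\<tau> \<in> nevanlinna" by (rule tau_nevanlinna[OF \<mu>' ct hol cnj zero])
  have real: "z \<notin> \<real>" if "0 < Im z" for z using that by (auto simp: complex_is_Real_iff)
  have asymp: "((\<lambda>z. z ^ (2 * n + 1 + 1) * (\<phi> z + moment_series s (2 * n + 1) z)) \<longlongrightarrow> 0) nontangential"
    by (rule moment_solution_asymp[OF \<mu>]) (intro \<phi> real)
  have lim: "(\<tau> \<longlongrightarrow> 0) nontangential"
  proof (rule tau_tendsto_0[OF asymp])
    show "\<forall>\<^sub>F z in nontangential. poly (den (\<tau> z)) z * \<phi> z + moment_functional s (num (\<tau> z) z) = 0"
      using eventually_nontangential_Im_pos by eventually_elim (intro zero, auto simp: complex_is_Real_iff)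
  qed
  have "\<tau> \<in> nevanlinna_01"
    unfolding nevanlinna_01_def
  proof (intro CollectI conjI nev)
    have "((\<lambda>z. \<tau> z * inverse z) \<longlongrightarrow> 0 * 0) nontangential"
      by (intro tendsto_mult lim tendsto_mono[OF nontangential_le_at_infinity] tendsto_inverse_0)
    then show "((\<lambda>z. \<tau> z / z) \<longlongrightarrow> 0) nontangential" by (simp add: divide_inverse)
    show "\<forall>\<^sub>F \<eta> in at_top. set_integrable lborel {\<eta><..} (\<lambda>y. \<bar>Im (\<tau> (\<i> * of_real y))\<bar> / y)"
    proof (rule kac_forward[OF \<mu> _ lim])
      show "\<tau> holomorphic_on - \<real>" using nev by (simp add: nevanlinna_def)
      show "has_bochner_integral \<mu> (\<lambda>t. (norm (poly (den (\<tau> z)) (of_real t) / (of_real t - z)))\<^sup>2) (h * a * Im (\<tau> z) / Im z)"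
        if z: "0 < Im z" for z
        using real[OF z] by (intro tau_Im[OF \<mu>' _ \<phi> zero]) auto
    qed
  qed
  moreover have "lin_frac s P P' \<tau> z = \<phi> z" if "z \<in> - \<real>" for z
    using zero[OF that] cross_zero_iff[OF den_nonzero_nevanlinna[OF nev], of z "\<phi> z"] that by (simp add: lin_frac_eq)
  then have "cauchy_transform_eq \<mu> (lin_frac s P P' \<tau>)"
    using ct by (simp add: cauchy_transform_eq_def)
  ultimately show ?thesis using lim by blast
qed

end

text \<open>The equivalence for a given \<mu> says nothing about a \<tau> that might belong to no
  measure; the separate existence clause states that every admissible \<tau> occurs.\<close>

theorem corollary5p2:
  fixes n :: nat and s :: "nat \<Rightarrow> real"
  assumes "hankel_pos_def s n"
  shows "(\<exists>\<mu>. moment_solution s (2 * n + 1) \<mu>) \<and>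
    (\<forall>P P'. orthonormal_poly s n P \<longrightarrow> orthogonal_poly s (n + 1) P' \<longrightarrow>
      (\<forall>\<mu>. moment_solution s (2 * n + 1) \<mu> \<longleftrightarrow>
         sets \<mu> = sets borel \<and>
         (\<exists>\<tau>\<in>nevanlinna_01. \<tau> \<in> o[nontangential](\<lambda>_. 1) \<and>
            cauchy_transform_eq \<mu> (lin_frac s P P' \<tau>))) \<and>
      (\<forall>\<tau>\<in>nevanlinna_01. \<tau> \<in> o[nontangential](\<lambda>_. 1) \<longrightarrow>
         (\<exists>\<mu>. moment_solution s (2 * n + 1) \<mu> \<and> cauchy_transform_eq \<mu> (lin_frac s P P' \<tau>))) \<and>
      (\<forall>\<tau>. lin_frac s P P' \<tau> \<in> nevanlinna_asymp s (2 * n + 1) \<longleftrightarrow>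
         \<tau> \<in> nevanlinna \<and> \<tau> \<in> o[nontangential](\<lambda>_. 1)))"
proof (intro conjI allI impI ballI)
  obtain P P' where "orthonormal_poly s n P" "orthogonal_poly s (n + 1) P'"
    using orthonormal_poly_exists[OF assms] orthogonal_poly_exists[OF assms, of "n + 1"] by auto
  then interpret hamburger_data s n P P' using assms by unfold_locales
  \<comment> \<open>The parameter 0 gives the quotient of the second-kind polynomial of
    \<open>P'\<close> by \<open>P'\<close>, up to the sign: the Gauss quadrature at the zeros of
    \<open>P'\<close>.\<close>
  have "(\<lambda>_. 0) \<in> nevanlinna_01" by (simp add: nevanlinna_01_def nevanlinna_def set_integrable_def)
  from lin_frac_moment_solution_exists[OF this] show "\<exists>\<mu>. moment_solution s (2 * n + 1) \<mu>" by auto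
next
  fix P P' assume "orthonormal_poly s n P" "orthogonal_poly s (n + 1) P'"
  then interpret hamburger_data s n P P' using assms by unfold_locales
  fix \<mu>
  show "moment_solution s (2 * n + 1) \<mu> \<longleftrightarrow> sets \<mu> = sets borel \<and>
     (\<exists>\<tau>\<in>nevanlinna_01. \<tau> \<in> o[nontangential](\<lambda>_. 1) \<and> cauchy_transform_eq \<mu> (lin_frac s P P' \<tau>))"
    unfolding smallo_1_iff
  proof (intro iffI conjI)
    assume \<mu>: "moment_solution s (2 * n + 1) \<mu>"
    then show "sets \<mu> = sets borel" by (simp add: moment_solution_def)
    show "\<exists>\<tau>\<in>nevanlinna_01. (\<tau> \<longlongrightarrow> 0) nontangential \<and> cauchy_transform_eq \<mu> (lin_frac s P P' \<tau>)"
      by (rule moment_solution_lin_frac[OF \<mu>])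
  qed (use lin_frac_moment_solution in blast)
next
  fix P P' \<tau> assume "orthonormal_poly s n P" "orthogonal_poly s (n + 1) P'"
  then interpret hamburger_data s n P P' using assms by unfold_locales
  assume "\<tau> \<in> nevanlinna_01" "\<tau> \<in> o[nontangential](\<lambda>_. 1)"
  then show "\<exists>\<mu>. moment_solution s (2 * n + 1) \<mu> \<and> cauchy_transform_eq \<mu> (lin_frac s P P' \<tau>)"
    unfolding smallo_1_iff by (rule lin_frac_moment_solution_exists)
next
  fix P P' \<tau> assume "orthonormal_poly s n P" "orthogonal_poly s (n + 1) P'"
  then interpret hamburger_data s n P P' using assms by unfold_locales
  show "lin_frac s P P' \<tau> \<in> nevanlinna_asymp s (2 * n + 1) \<longleftrightarrow> \<tau> \<in> nevanlinna \<and> \<tau> \<in> o[nontangential](\<lambda>_. 1)"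
    unfolding smallo_1_iff using nevanlinna_asymp_lin_fracD lin_frac_asymp by blast
qed

end
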